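(* Let $E$ be an end of a complete noncompact Riemannian manifold $M$ with bounded geometry. Let $\lambda:E\to[0,\infty)$ be a nonnegative $C^1$ function. Assume that $$|\nabla\lambda|\le\kappa\lambda\quad\text{in }E,$$ for some constant $\kappa\ge0$. Then either $\lim_{x\to\infty,\ x\in E}\lambda(x)=0$, or $\int_E\lambda^p=\infty$ for all $p\ge1$.
   Context: Manifolds are connected. An end $E$ of $M$ is an unbounded connected component of $M-\Omega$ for some compact subset $\Omega\subset M$. A Riemannian manifold has bounded geometry if its sectional curvature is bounded from above and its injectivity radius is bounded from below by a positive constant. $\nabla\lambda$ is the gradient of $\lambda$. The limit $x\to\infty$, $x\in E$, means $d_M(x,x_0)\to\infty$ with $x\in E$, for a fixed $x_0\in M$. Integrals are with respect to the Riemannian measure of $M$. *)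

theory Defs
  imports "HOL-Analysis.Analysis"
begin

section \<open>Functions of class \<open>C\<^sup>k\<close> on open subsets of Euclidean space\<close>

definition partial :: "'n \<Rightarrow> (real^'n \<Rightarrow> 'b::real_normed_vector) \<Rightarrow> real^'n \<Rightarrow> 'b" where
  "partial i f y = frechet_derivative f (at y) (axis i 1)"

text \<open>Only meant for open \<open>S\<close>; derivatives are taken in the full space.\<close>

primrec Ck_on :: "nat \<Rightarrow> (real^'n) set \<Rightarrow> (real^'n \<Rightarrow> 'b::real_normed_vector) \<Rightarrow> bool" where
  "Ck_on 0 S f \<longleftrightarrow> continuous_on S f"
| "Ck_on (Suc k) S f \<longleftrightarrow> (\<forall>y\<in>S. f differentiable (at y)) \<and> (\<forall>i. Ck_on k S (partial i f))"

definition smooth_on :: "(real^'n) set \<Rightarrow> (real^'n \<Rightarrow> 'b::real_normed_vector) \<Rightarrow> bool" where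
  "smooth_on S f \<longleftrightarrow> (\<forall>k. Ck_on k S f)"


section \<open>Riemannian manifolds\<close>

text \<open>
  A manifold of dimension \<open>n = CARD('n)\<close> is a topological space together with an atlas. A chart is a
  pair of its domain and its coordinate map. The metric tensor is given by its matrices of
  coefficients \<open>g\<^sub>i\<^sub>j\<close> in each chart, as functions of the coordinates; \<open>riemannian_manifold\<close> requires
  these to transform as a covariant 2-tensor.
\<close>

type_synonym ('a, 'n) chart = "'a set \<times> ('a \<Rightarrow> real^'n)"

record ('a, 'n::finite) riemannian =
  top_of :: "'a topology"
  atlas :: "('a, 'n::finite) chart set"
  gcoeff :: "('a, 'n::finite) chart \<Rightarrow> real^'n \<Rightarrow> real^'n^'n"

abbreviation points :: "('a, 'n::finite) riemannian \<Rightarrow> 'a set" where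
  "points M \<equiv> topspace (top_of M)"

abbreviation chart_dom :: "('a, 'n::finite) chart \<Rightarrow> 'a set" where
  "chart_dom c \<equiv> fst c"

abbreviation chart_map :: "('a, 'n::finite) chart \<Rightarrow> 'a \<Rightarrow> real^'n" where
  "chart_map c \<equiv> snd c"

definition chart_inv :: "('a, 'n::finite) chart \<Rightarrow> real^'n \<Rightarrow> 'a" where
  "chart_inv c = inv_into (chart_dom c) (chart_map c)"

definition transition :: "('a, 'n::finite) chart \<Rightarrow> ('a, 'n::finite) chart \<Rightarrow> real^'n \<Rightarrow> real^'n" where
  "transition c c' = chart_map c' \<circ> chart_inv c"

definition jacobian_matrix :: "(real^'n \<Rightarrow> real^'n) \<Rightarrow> real^'n \<Rightarrow> real^'n^'n" where
  "jacobian_matrix f y = matrix (frechet_derivative f (at y))"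

definition smooth_manifold :: "('a, 'n::finite) riemannian \<Rightarrow> bool" where
  "smooth_manifold M \<longleftrightarrow>
     Hausdorff_space (top_of M) \<and> second_countable (top_of M) \<and> connected_space (top_of M) \<and>
     (\<Union>c\<in>atlas M. chart_dom c) = points M \<and>
     (\<forall>c\<in>atlas M. openin (top_of M) (chart_dom c) \<and> open (chart_map c ` chart_dom c) \<and>
        homeomorphic_map (subtopology (top_of M) (chart_dom c))
          (top_of_set (chart_map c ` chart_dom c)) (chart_map c)) \<and>
     (\<forall>c\<in>atlas M. \<forall>c'\<in>atlas M.
        smooth_on (chart_map c ` (chart_dom c \<inter> chart_dom c')) (transition c c'))"

definition riemannian_manifold :: "('a, 'n::finite) riemannian \<Rightarrow> bool" where
  "riemannian_manifold M \<longleftrightarrow>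
     smooth_manifold M \<and>
     (\<forall>c\<in>atlas M.
        smooth_on (chart_map c ` chart_dom c) (gcoeff M c) \<and>
        (\<forall>y\<in>chart_map c ` chart_dom c.
           transpose (gcoeff M c y) = gcoeff M c y \<and> (\<forall>v. v \<noteq> 0 \<longrightarrow> v \<bullet> (gcoeff M c y *v v) > 0))) \<and>
     (\<forall>c\<in>atlas M. \<forall>c'\<in>atlas M. \<forall>y\<in>chart_map c ` (chart_dom c \<inter> chart_dom c').
        gcoeff M c y =
          transpose (jacobian_matrix (transition c c') y) ** gcoeff M c' (transition c c' y)
            ** jacobian_matrix (transition c c') y)"

text \<open>
  The tangent space at \<open>x\<close> is identified with \<open>real^'n\<close> through the coordinate frame of a preferred
  chart around \<open>x\<close>.
\<close>

definition chart_at :: "('a, 'n::finite) riemannian \<Rightarrow> 'a \<Rightarrow> ('a, 'n::finite) chart" where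
  "chart_at M x = (SOME c. c \<in> atlas M \<and> x \<in> chart_dom c)"

definition metric_at :: "('a, 'n::finite) riemannian \<Rightarrow> 'a \<Rightarrow> real^'n \<Rightarrow> real^'n \<Rightarrow> real" where
  "metric_at M x u v = u \<bullet> (gcoeff M (chart_at M x) (chart_map (chart_at M x) x) *v v)"

definition tangent_norm :: "('a, 'n::finite) riemannian \<Rightarrow> 'a \<Rightarrow> real^'n \<Rightarrow> real" where
  "tangent_norm M x v = sqrt (metric_at M x v v)"


subsection \<open>Distance\<close>

definition C1_curve_on :: "('a, 'n::finite) riemannian \<Rightarrow> real \<Rightarrow> real \<Rightarrow> (real \<Rightarrow> 'a) \<Rightarrow> bool" where
  "C1_curve_on M a b \<gamma> \<longleftrightarrow>
     (\<forall>c\<in>atlas M. \<exists>w. continuous_on {t\<in>{a..b}. \<gamma> t \<in> chart_dom c} w \<and>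
        (\<forall>t\<in>{a..b}. \<gamma> t \<in> chart_dom c \<longrightarrow>
           ((chart_map c \<circ> \<gamma>) has_vector_derivative w t) (at t within {a..b})))"

definition piecewise_C1_path :: "('a, 'n::finite) riemannian \<Rightarrow> (real \<Rightarrow> 'a) \<Rightarrow> bool" where
  "piecewise_C1_path M \<gamma> \<longleftrightarrow>
     pathin (top_of M) \<gamma> \<and>
     (\<exists>S. finite S \<and>
        (\<forall>a b. 0 \<le> a \<and> a < b \<and> b \<le> 1 \<and> {a<..<b} \<inter> S = {} \<longrightarrow> C1_curve_on M a b \<gamma>))"

definition speed :: "('a, 'n::finite) riemannian \<Rightarrow> (real \<Rightarrow> 'a) \<Rightarrow> real \<Rightarrow> real" where
  "speed M \<gamma> t =
     tangent_norm M (\<gamma> t) (vector_derivative (chart_map (chart_at M (\<gamma> t)) \<circ> \<gamma>) (at t))"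

definition curve_length :: "('a, 'n::finite) riemannian \<Rightarrow> (real \<Rightarrow> 'a) \<Rightarrow> real" where
  "curve_length M \<gamma> = integral {0..1} (speed M \<gamma>)"

definition riem_dist :: "('a, 'n::finite) riemannian \<Rightarrow> 'a \<Rightarrow> 'a \<Rightarrow> real" where
  "riem_dist M x y = (INF \<gamma>\<in>{\<gamma>. piecewise_C1_path M \<gamma> \<and> \<gamma> 0 = x \<and> \<gamma> 1 = y}. curve_length M \<gamma>)"

definition complete_manifold :: "('a, 'n::finite) riemannian \<Rightarrow> bool" where
  "complete_manifold M \<longleftrightarrow> Metric_space.mcomplete (points M) (riem_dist M)"

definition is_end :: "('a, 'n::finite) riemannian \<Rightarrow> 'a set \<Rightarrow> bool" where
  "is_end M E \<longleftrightarrow>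
     (\<exists>\<Omega>. compactin (top_of M) \<Omega> \<and>
        E \<in> connected_components_of (subtopology (top_of M) (points M - \<Omega>)) \<and>
        \<not> Metric_space.mbounded (points M) (riem_dist M) E)"


subsection \<open>Curvature\<close>

definition christoffel ::
  "('a, 'n::finite) riemannian \<Rightarrow> ('a, 'n::finite) chart \<Rightarrow> 'n \<Rightarrow> 'n \<Rightarrow> 'n \<Rightarrow> real^'n \<Rightarrow> real" where
  "christoffel M c k i j y =
     1/2 * (\<Sum>l\<in>UNIV. matrix_inv (gcoeff M c y) $ k $ l *
       (partial i (\<lambda>z. gcoeff M c z $ j $ l) y + partial j (\<lambda>z. gcoeff M c z $ i $ l) y
        - partial l (\<lambda>z. gcoeff M c z $ i $ j) y))"

text \<open>
  \<open>riemann M c l i j k\<close> is the coefficient \<open>R\<^sup>l\<close> in \<open>R(\<partial>\<^sub>i, \<partial>\<^sub>j) \<partial>\<^sub>k = \<Sum>\<^sub>l R\<^sup>l \<partial>\<^sub>l\<close>, with the sign convention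
  \<open>R(X, Y) Z = \<nabla>\<^sub>X \<nabla>\<^sub>Y Z - \<nabla>\<^sub>Y \<nabla>\<^sub>X Z - \<nabla>\<^bsub>[X, Y]\<^esub> Z\<close>.
\<close>

definition riemann ::
  "('a, 'n::finite) riemannian \<Rightarrow> ('a, 'n::finite) chart \<Rightarrow> 'n \<Rightarrow> 'n \<Rightarrow> 'n \<Rightarrow> 'n \<Rightarrow> real^'n \<Rightarrow> real" where
  "riemann M c l i j k y =
     partial i (christoffel M c l j k) y - partial j (christoffel M c l i k) y
     + (\<Sum>m\<in>UNIV. christoffel M c l i m y * christoffel M c m j k y
                - christoffel M c l j m y * christoffel M c m i k y)"

definition curvature_op ::
  "('a, 'n::finite) riemannian \<Rightarrow> 'a \<Rightarrow> real^'n \<Rightarrow> real^'n \<Rightarrow> real^'n \<Rightarrow> real^'n" where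
  "curvature_op M x u v w =
     (\<chi> l. \<Sum>i\<in>UNIV. \<Sum>j\<in>UNIV. \<Sum>k\<in>UNIV.
        riemann M (chart_at M x) l i j k (chart_map (chart_at M x) x) * u $ i * v $ j * w $ k)"

definition sectional_curvature ::
  "('a, 'n::finite) riemannian \<Rightarrow> 'a \<Rightarrow> real^'n \<Rightarrow> real^'n \<Rightarrow> real" where
  "sectional_curvature M x u v =
     metric_at M x (curvature_op M x u v v) u /
       (metric_at M x u u * metric_at M x v v - (metric_at M x u v)\<^sup>2)"


subsection \<open>Exponential map and injectivity radius\<close>

text \<open>
  In each chart the curve solves \<open>\<gamma>\<^sup>k'' = - \<Sum>\<^sub>i\<^sub>j \<Gamma>\<^sup>k\<^sub>i\<^sub>j \<gamma>\<^sup>i' \<gamma>\<^sup>j'\<close>; \<open>w\<close> is its coordinate velocity.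
\<close>

definition geodesic :: "('a, 'n::finite) riemannian \<Rightarrow> (real \<Rightarrow> 'a) \<Rightarrow> bool" where
  "geodesic M \<gamma> \<longleftrightarrow>
     pathin (top_of M) \<gamma> \<and>
     (\<forall>c\<in>atlas M. \<exists>w. \<forall>t\<in>{0..1}. \<gamma> t \<in> chart_dom c \<longrightarrow>
        ((chart_map c \<circ> \<gamma>) has_vector_derivative w t) (at t within {0..1}) \<and>
        (w has_vector_derivative
           (\<chi> k. - (\<Sum>i\<in>UNIV. \<Sum>j\<in>UNIV.
              christoffel M c k i j (chart_map c (\<gamma> t)) * w t $ i * w t $ j))) (at t within {0..1}))"

definition geodesic_from :: "('a, 'n::finite) riemannian \<Rightarrow> 'a \<Rightarrow> real^'n \<Rightarrow> (real \<Rightarrow> 'a) \<Rightarrow> bool" where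
  "geodesic_from M x v \<gamma> \<longleftrightarrow>
     geodesic M \<gamma> \<and> \<gamma> 0 = x \<and>
     ((chart_map (chart_at M x) \<circ> \<gamma>) has_vector_derivative v) (at 0 within {0..1})"

definition riem_exp :: "('a, 'n::finite) riemannian \<Rightarrow> 'a \<Rightarrow> real^'n \<Rightarrow> 'a" where
  "riem_exp M x v = (THE y. \<exists>\<gamma>. geodesic_from M x v \<gamma> \<and> \<gamma> 1 = y)"

definition diffeo_onto_open_image ::
  "('a, 'n::finite) riemannian \<Rightarrow> (real^'n) set \<Rightarrow> (real^'n \<Rightarrow> 'a) \<Rightarrow> bool" where
  "diffeo_onto_open_image M U f \<longleftrightarrow>
     openin (top_of M) (f ` U) \<and>
     homeomorphic_map (top_of_set U) (subtopology (top_of M) (f ` U)) f \<and>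
     (\<forall>c\<in>atlas M.
        smooth_on {v\<in>U. f v \<in> chart_dom c} (chart_map c \<circ> f) \<and>
        smooth_on (chart_map c ` (chart_dom c \<inter> f ` U)) (inv_into U f \<circ> chart_inv c))"

definition injectivity_radius_at :: "('a, 'n::finite) riemannian \<Rightarrow> 'a \<Rightarrow> ereal" where
  "injectivity_radius_at M x =
     (SUP r\<in>{r. 0 < r \<and>
            (\<forall>v. tangent_norm M x v < r \<longrightarrow> (\<exists>\<gamma>. geodesic_from M x v \<gamma>)) \<and>
            diffeo_onto_open_image M {v. tangent_norm M x v < r} (riem_exp M x)}. ereal r)"

definition injectivity_radius :: "('a, 'n::finite) riemannian \<Rightarrow> ereal" where
  "injectivity_radius M = (INF x\<in>points M. injectivity_radius_at M x)"

definition bounded_geometry :: "('a, 'n::finite) riemannian \<Rightarrow> bool" where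
  "bounded_geometry M \<longleftrightarrow>
     (\<exists>K. \<forall>x\<in>points M. \<forall>u v. u \<noteq> v \<and> independent {u, v} \<longrightarrow> sectional_curvature M x u v \<le> K) \<and>
     (\<exists>i\<^sub>0>0. ereal i\<^sub>0 \<le> injectivity_radius M)"


subsection \<open>Riemannian measure\<close>

text \<open>The Borel measure given by \<open>sqrt (det g) dy\<^sup>1 \<dots> dy\<^sup>n\<close> in every chart.\<close>

definition riem_measure :: "('a, 'n::finite) riemannian \<Rightarrow> 'a measure" where
  "riem_measure M = (THE \<mu>.
     space \<mu> = points M \<and>
     sets \<mu> = sigma_sets (points M) {U. openin (top_of M) U} \<and>
     (\<forall>c\<in>atlas M. \<forall>A\<in>sets \<mu>. A \<subseteq> chart_dom c \<longrightarrow>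
        emeasure \<mu> A = (\<integral>\<^sup>+y\<in>chart_map c ` A. ennreal (sqrt (det (gcoeff M c y))) \<partial>lborel)))"


subsection \<open>Functions on open subsets of a manifold\<close>

definition C1_function_on :: "('a, 'n::finite) riemannian \<Rightarrow> 'a set \<Rightarrow> ('a \<Rightarrow> real) \<Rightarrow> bool" where
  "C1_function_on M E f \<longleftrightarrow>
     (\<forall>c\<in>atlas M. Ck_on 1 (chart_map c ` (chart_dom c \<inter> E)) (f \<circ> chart_inv c))"

definition gradient :: "('a, 'n::finite) riemannian \<Rightarrow> ('a \<Rightarrow> real) \<Rightarrow> 'a \<Rightarrow> real^'n" where
  "gradient M f x =
     (let c = chart_at M x; y = chart_map c x
      in matrix_inv (gcoeff M c y) *v (\<chi> i. partial i (f \<circ> chart_inv c) y))"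

text \<open>The filter \<open>x \<longrightarrow> \<infinity>\<close>, \<open>x \<in> E\<close>; it does not depend on the base point \<open>x\<^sub>0\<close>.\<close>

definition at_infinity_in :: "('a, 'n::finite) riemannian \<Rightarrow> 'a \<Rightarrow> 'a set \<Rightarrow> 'a filter" where
  "at_infinity_in M x\<^sub>0 E = inf (filtercomap (\<lambda>x. riem_dist M x x\<^sub>0) at_top) (principal E)"

end

theory Submission
  imports Defs
begin

text \<open>
  If \<open>\<lambda>\<close> does not tend to \<open>0\<close> at infinity in \<open>E\<close>, there are \<open>\<epsilon> > 0\<close> and points \<open>x\<^sub>n \<in> E\<close> with
  \<open>\<lambda>(x\<^sub>n) \<ge> \<epsilon>\<close> whose distances to \<open>x\<^sub>0\<close> increase by more than \<open>2\<rho>\<close>, so that the geodesic balls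
  \<open>B(x\<^sub>n, \<rho>)\<close> are disjoint and, being connected and disjoint from \<open>\<Omega>\<close>, are contained in \<open>E\<close>. Integrating
  \<open>|\<nabla>\<lambda>| \<le> \<kappa>\<lambda>\<close> along radial geodesics gives \<open>\<lambda> \<ge> \<epsilon> exp (-\<kappa>\<rho>)\<close> on each of them, hence the integral is
  infinite as soon as the volumes of these balls are bounded below.

  For the volume, let \<open>J\<close> be the Jacobi field along \<open>t \<mapsto> exp\<^sub>x (tv)\<close> with \<open>J(0) = 0\<close>, \<open>J'(0) = w\<close>. An upper
  curvature bound \<open>K\<close> gives \<open>|J|'' \<ge> -K |v|\<^sup>2 |J|\<close>, and Sturm comparison gives
  \<open>|d(exp\<^sub>x)\<^sub>v w| = |J(1)| \<ge> 5/6 |w|\<close> whenever \<open>K |v|\<^sup>2 \<le> 1\<close>. So \<open>exp\<^sub>x\<close>, a diffeomorphism on the ball of radius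
  \<open>\<rho>\<close>, shrinks volumes by at most the factor \<open>(5/6)\<^sup>n\<close>. At a given time the Jacobi equation is computed in
  the preferred chart of the point of the geodesic, so the tensoriality of the curvature is never needed;
  only the functions \<open>|J|\<^sup>2\<close> and \<open>|\<gamma>'|\<^sup>2\<close> have to be independent of the chart.
\<close>

section \<open>Change of variables\<close>

text \<open>The radius \<rho> has to be the same at every point: it lies strictly below a lower
  bound of the injectivity radius and satisfies K \<rho>^2 \<le> 1. Under this normalization the
  sine of Rauch's comparison can be replaced by its Taylor polynomial t - m t^3/6, whose value at 1
  is at least 5/6; this is the origin of the constant. Two definite descriptions shape the work.
  \<open>riem_exp\<close> has a value only once geodesics are known to be unique, and
  \<open>riem_measure\<close> only once the chart volumes have been glued to a measure and this
  measure is shown to be unique. A countable Borel partition subordinate to charts does the gluing,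
  and later it splits the geodesic ball, which need not lie in one chart. Distances enter only
  through |d(exp v, y) - d(x, y)| \<le> |v|, obtained by putting the radial geodesic in front of an
  arbitrary path. This bounds d(., x0) on compact sets, keeps the balls away from \<Omega> and
  separates them from one another, always by comparing values of the one function d(., x0).\<close>

lemma det_reindex:
  fixes A :: "real^'n^'n" and \<beta> :: "'m::finite \<Rightarrow> 'n::finite"
  assumes \<beta>: "bij \<beta>"
  shows "det (\<chi> i j. A $ \<beta> i $ \<beta> j) = det A"
proof -
  let ?m = "map_permutation (UNIV::'m set) \<beta>"
  have inj: "inj_on \<beta> UNIV" and surj: "surj \<beta>"
    using \<beta> by (auto simp: bij_def)
  have m: "?m p = \<beta> \<circ> p \<circ> inv \<beta>" for p
    using surj by (simp add: map_permutation_def restrict_id_def fun_eq_iff)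
  \<comment> \<open>Conjugation by \<beta> maps the permutations of one index type bijectively onto
    those of the other and keeps the sign, so the two Leibniz expansions agree term by term.\<close>
  have bb: "bij_betw ?m {p. p permutes UNIV} {p. p permutes (UNIV::'n set)}"
    using bij_betw_permutations[OF \<beta>]
    by (rule bij_betw_cong[THEN iffD1, rotated]) (simp add: map_permutation_def restrict_id_def fun_eq_iff surj inv_into_def)
  have "det A = (\<Sum>p\<in>{p. p permutes (UNIV::'m set)}. of_int (sign (?m p)) * (\<Prod>i\<in>UNIV. A $ i $ (?m p) i))"
    unfolding det_def by (rule sum.reindex_bij_betw[OF bb, symmetric])
  also have "\<dots> = (\<Sum>p\<in>{p. p permutes (UNIV::'m set)}. of_int (sign p) * (\<Prod>i\<in>UNIV. A $ \<beta> i $ \<beta> (p i)))"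
  proof (rule sum.cong[OF refl])
    fix p :: "'m \<Rightarrow> 'm" assume p: "p \<in> {p. p permutes UNIV}"
    have "(\<Prod>i\<in>UNIV. A $ i $ (?m p) i) = (\<Prod>i\<in>UNIV. A $ \<beta> i $ (?m p) (\<beta> i))"
      by (rule prod.reindex_bij_betw[OF \<beta>, symmetric])
    then show "of_int (sign (?m p)) * (\<Prod>i\<in>UNIV. A $ i $ (?m p) i) = of_int (sign p) * (\<Prod>i\<in>UNIV. A $ \<beta> i $ \<beta> (p i))"
      using sign_map_permutation[OF inj] p by (simp add: m inj)
  qed
  finally show ?thesis
    by (simp add: det_def)
qed

text \<open>
  The change of variables theorem of the library needs a well-ordered index type, so it is
  transferred to arbitrary finite index types along a bijection with an initial segment of \<open>nat\<close>.
\<close>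

typedef (overloaded) ('n::finite) idx = "{..<CARD('n)}"
  by (rule exI[of _ 0]) simp

setup_lifting type_definition_idx

instantiation idx :: (finite) linorder
begin
lift_definition less_eq_idx :: "'a idx \<Rightarrow> 'a idx \<Rightarrow> bool" is "(\<le>)" .
lift_definition less_idx :: "'a idx \<Rightarrow> 'a idx \<Rightarrow> bool" is "(<)" .
instance by standard (transfer; auto)+
end

lemma range_Rep_idx: "range (Rep_idx :: 'n::finite idx \<Rightarrow> nat) = {..<CARD('n)}"
  by (rule type_definition.Rep_range[OF type_definition_idx])

lemma inj_Rep_idx: "inj Rep_idx"
  by (simp add: inj_def Rep_idx_inject)

instance idx :: (finite) finite
  by standard (rule finite_imageD[OF _ inj_Rep_idx], simp add: range_Rep_idx)

instance idx :: (finite) wellorder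
proof
  fix P :: "'a idx \<Rightarrow> bool" and a
  assume P: "\<And>x. (\<And>y. y < x \<Longrightarrow> P y) \<Longrightarrow> P x"
  have "\<forall>x. Rep_idx x = k \<longrightarrow> P x" for k
  proof (induction k rule: less_induct)
    case (less k)
    show ?case
    proof (intro allI impI)
      fix x :: "'a idx" assume "Rep_idx x = k"
      show "P x"
        by (rule P) (use less \<open>Rep_idx x = k\<close> in \<open>auto simp: less_idx.rep_eq\<close>)
    qed
  qed
  then show "P a" by blast
qed

lemma ex_bij_idx: "\<exists>\<beta>::'n::finite idx \<Rightarrow> 'n. bij \<beta>"
proof -
  have "card (range (Rep_idx :: 'n idx \<Rightarrow> nat)) = card (UNIV :: 'n idx set)"
    by (rule card_image[OF inj_Rep_idx])
  then show ?thesis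
    using finite_same_card_bij[of "UNIV::'n idx set" "UNIV::'n set"] by (auto simp: range_Rep_idx)
qed

text \<open>\<open>has_measure_differentiable_image\<close> equates finite measure of the image with
  gauge integrability of the Jacobian. Splitting on whether the Lebesgue integral is infinite turns
  this into one equality in \<open>ennreal\<close> that covers infinite volume too.\<close>

lemma emeasure_image_wellorder:
  fixes f :: "real^'m::{finite,wellorder} \<Rightarrow> real^'m::_"
  assumes S: "S \<in> sets borel"
    and der: "\<And>x. x \<in> S \<Longrightarrow> (f has_derivative f' x) (at x within S)"
    and inj: "inj_on f S" and fS: "f ` S \<in> sets borel"
    and meas: "set_borel_measurable borel S (\<lambda>x. \<bar>det (matrix (f' x))\<bar>)"
  shows "emeasure lborel (f ` S) = (\<integral>\<^sup>+x\<in>S. ennreal \<bar>det (matrix (f' x))\<bar> \<partial>lborel)"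
proof -
  let ?d = "\<lambda>x. \<bar>det (matrix (f' x))\<bar>"
  have SL: "S \<in> sets lebesgue" using S by simp
  note hm = has_measure_differentiable_image[OF SL der inj]
  have lm: "f ` S \<in> lmeasurable \<longleftrightarrow> emeasure lborel (f ` S) < \<infinity>"
    using fS by (simp add: fmeasurable_def)
  have eq: "(\<integral>\<^sup>+x\<in>S. ennreal (?d x) \<partial>lborel) = (\<integral>\<^sup>+x. ennreal (indicator S x * ?d x) \<partial>lborel)"
    by (intro nn_integral_cong) (auto simp: indicator_def)
  show ?thesis
  proof (cases "(\<integral>\<^sup>+x\<in>S. ennreal (?d x) \<partial>lborel) = \<infinity>")
    case True
    have "\<not> emeasure lborel (f ` S) < \<infinity>"
    proof
      assume "emeasure lborel (f ` S) < \<infinity>"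
      then have "(?d has_integral measure lebesgue (f ` S)) S"
        using hm lm by blast
      then have "(\<integral>\<^sup>+x. ennreal (?d x) * indicator S x \<partial>lborel) = ennreal (measure lebesgue (f ` S))"
        by (intro nn_integral_has_integral_lebesgue') auto
      with True show False by simp
    qed
    with True show ?thesis by (simp add: less_top[symmetric])
  next
    case False
    then obtain r where r: "0 \<le> r" "(\<integral>\<^sup>+x\<in>S. ennreal (?d x) \<partial>lborel) = ennreal r"
      by (cases "(\<integral>\<^sup>+x\<in>S. ennreal (?d x) \<partial>lborel)" rule: ennreal_cases) auto
    have "((\<lambda>x. indicator S x * ?d x) has_integral r) UNIV"
    proof (rule nn_integral_has_integral)
      show "(\<lambda>x. indicator S x * ?d x) \<in> borel_measurable borel"
        using meas by (simp add: set_borel_measurable_def)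
    qed (use r eq in auto)
    then have "(?d has_integral r) S"
      unfolding has_integral_restrict_UNIV[of S ?d r, symmetric]
      by (rule has_integral_eq[rotated]) auto
    then have "f ` S \<in> lmeasurable" "measure lebesgue (f ` S) = r" using hm by auto
    then have "emeasure lebesgue (f ` S) = ennreal r"
      by (simp add: emeasure_eq_measure2)
    then show ?thesis using r fS by simp
  qed
qed

lemma prod_Basis_cart: "(\<Prod>b\<in>Basis. (v::real^'k) \<bullet> b) = (\<Prod>i\<in>UNIV. v $ i)"
proof -
  have B: "(Basis :: (real^'k) set) = range (\<lambda>i. axis i 1)"
    by (auto simp: Basis_vec_def)
  have inj: "inj (\<lambda>i::'k. axis i (1::real))"
    by (auto simp: inj_def axis_eq_axis)
  show ?thesis
    unfolding B prod.reindex[OF inj] by (simp add: cart_eq_inner_axis)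
qed

section \<open>Relabelling of coordinates\<close>

definition reindex :: "('m \<Rightarrow> 'n) \<Rightarrow> real^'n \<Rightarrow> real^'m" where
  "reindex \<beta> y = (\<chi> i. y $ \<beta> i)"

lemma reindex_nth [simp]: "reindex \<beta> y $ i = y $ \<beta> i"
  by (simp add: reindex_def)

lemma linear_reindex: "linear (reindex \<beta>)"
  by (auto simp: linear_iff reindex_def vec_eq_iff)

lemma has_derivative_reindex:
  "(reindex \<beta> has_derivative reindex \<beta>) (at x within S)"
  for \<beta> :: "'m::finite \<Rightarrow> 'n::finite"
  by (simp add: linear_imp_has_derivative linear_reindex)

lemma borel_measurable_reindex [measurable]: "reindex \<beta> \<in> borel_measurable borel"
  for \<beta> :: "'m::finite \<Rightarrow> 'n::finite"
  by (intro borel_measurable_continuous_onI linear_continuous_on linear_linear[THEN iffD2] linear_reindex)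

lemma reindex_inv:
  assumes "bij \<beta>"
  shows "reindex (inv \<beta>) (reindex \<beta> y) = y" "reindex \<beta> (reindex (inv \<beta>) z) = z"
  using assms by (auto simp: reindex_def vec_eq_iff bij_def inj_def surj_f_inv_f)

text \<open>Lebesgue measure is determined by its values on boxes, and relabelling the coordinates
  only permutes the side lengths of a box.\<close>

lemma distr_lborel_reindex:
  fixes \<beta> :: "'m::finite \<Rightarrow> 'n::finite"
  assumes \<beta>: "bij \<beta>"
  shows "distr lborel borel (reindex \<beta>) = lborel"
proof (rule lborel_eqI[symmetric])
  fix l u :: "real^'m" assume lu: "\<And>b. b \<in> Basis \<Longrightarrow> l \<bullet> b \<le> u \<bullet> b"
  let ?g = "reindex (inv \<beta>) :: real^'m \<Rightarrow> real^'n"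
  have lu': "l $ i \<le> u $ i" for i
    using lu[of "axis i 1"] by (simp add: cart_eq_inner_axis axis_in_Basis_iff)
  have vim: "reindex \<beta> -` box l u = box (?g l) (?g u)"
    using \<beta> by (auto simp: mem_box_cart reindex_def bij_def surj_f_inv_f)
      (metis surj_f_inv_f inv_f_f)+
  have "emeasure (distr lborel borel (reindex \<beta>)) (box l u) = emeasure lborel (box (?g l) (?g u))"
    by (subst emeasure_distr) (auto simp: vim)
  also have "\<dots> = (\<Prod>b\<in>Basis. (?g u - ?g l) \<bullet> b)"
    by (rule emeasure_lborel_box) (auto simp: Basis_vec_def inner_axis reindex_def lu')
  also have "\<dots> = (\<Prod>b\<in>Basis. (u - l) \<bullet> b)"
  proof -
    have "bij (inv \<beta>)" by (rule bij_imp_bij_inv[OF \<beta>])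
    then show ?thesis
      unfolding prod_Basis_cart by (simp add: reindex_def prod.reindex_bij_betw[where h="inv \<beta>" and g="\<lambda>i. u $ i - l $ i"])
  qed
  finally show "emeasure (distr lborel borel (reindex \<beta>)) (box l u) = (\<Prod>b\<in>Basis. (u - l) \<bullet> b)" .
qed simp

text \<open>Conjugating \<open>f\<close> by \<open>reindex \<beta>\<close> transports it to the
  well-ordered index type. The relabelling preserves Lebesgue measure, and by
  \<open>det_reindex\<close> the Jacobian determinant of the conjugate is that of
  \<open>f\<close>.\<close>

lemma emeasure_differentiable_image:
  fixes f :: "real^'n \<Rightarrow> real^'n"
  assumes S: "S \<in> sets borel"
    and der: "\<And>x. x \<in> S \<Longrightarrow> (f has_derivative f' x) (at x within S)"
    and inj: "inj_on f S" and fS: "f ` S \<in> sets borel"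
    and meas: "set_borel_measurable borel S (\<lambda>x. \<bar>det (matrix (f' x))\<bar>)"
  shows "emeasure lborel (f ` S) = (\<integral>\<^sup>+x\<in>S. ennreal \<bar>det (matrix (f' x))\<bar> \<partial>lborel)"
proof -
  obtain \<beta> :: "'n idx \<Rightarrow> 'n" where \<beta>: "bij \<beta>" using ex_bij_idx by blast
  let ?R = "reindex \<beta>" and ?R' = "reindex (inv \<beta>)"
  note \<beta>' = bij_imp_bij_inv[OF \<beta>]
  note inv = reindex_inv[OF \<beta>]
  let ?f = "\<lambda>z. ?R (f (?R' z))" and ?f' = "\<lambda>z v. ?R (f' (?R' z) (?R' v))"
  have img: "?R ` A = ?R' -` A" for A
    by (auto simp: inv intro: image_eqI[where x="?R' z" for z])
  have imgb: "?R ` A \<in> sets borel" if "A \<in> sets borel" for A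
    unfolding img using measurable_sets[OF borel_measurable_reindex that, of "inv \<beta>"] by simp
  have em: "emeasure lborel (?R ` A) = emeasure lborel A" if "A \<in> sets borel" for A
  proof -
    have "emeasure lborel (?R ` A) = emeasure lborel (?R' -` A)" by (simp add: img)
    also have "\<dots> = emeasure (distr lborel borel ?R') A"
      using that by (subst emeasure_distr) auto
    finally show ?thesis by (simp add: distr_lborel_reindex[OF \<beta>'])
  qed
  have lin: "linear (f' x)" if "x \<in> S" for x
    using der[OF that] by (rule has_derivative_linear)
  have det: "det (matrix (?f' z)) = det (matrix (f' (?R' z)))" if "?R' z \<in> S" for z
  proof -
    have R'ax: "?R' (axis j 1) = axis (\<beta> j) 1" for j
      using \<beta> by (auto simp: reindex_def axis_def vec_eq_iff bij_def inv_f_f surj_f_inv_f)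
    show ?thesis
      by (subst det_reindex[OF \<beta>, symmetric]) (simp add: matrix_def R'ax)
  qed
  have ff: "?f ` (?R ` S) = ?R ` (f ` S)"
    by (simp add: image_image inv)
  have "emeasure lborel (?f ` (?R ` S)) = (\<integral>\<^sup>+z\<in>?R ` S. ennreal \<bar>det (matrix (?f' z))\<bar> \<partial>lborel)"
  proof (rule emeasure_image_wellorder)
    show "?R ` S \<in> sets borel" by (rule imgb[OF S])
    show "inj_on ?f (?R ` S)"
      using inj by (auto simp: inj_on_def inv) (metis inv(1))
    show "?f ` (?R ` S) \<in> sets borel" unfolding ff by (rule imgb[OF fS])
    show "(?f has_derivative ?f' z) (at z within ?R ` S)" if "z \<in> ?R ` S" for z
    proof -
      have z: "?R' z \<in> S" using that by (auto simp: inv)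
      have "((\<lambda>z. f (?R' z)) has_derivative (\<lambda>v. f' (?R' z) (?R' v))) (at z within ?R ` S)"
        by (rule has_derivative_in_compose2[OF der _ _ has_derivative_reindex])
          (use that in \<open>auto simp: inv\<close>)
      from has_derivative_compose[OF this has_derivative_reindex] show ?thesis .
    qed
    have "(\<lambda>z. indicator S (?R' z) *\<^sub>R \<bar>det (matrix (f' (?R' z)))\<bar>) \<in> borel_measurable borel"
      using meas unfolding set_borel_measurable_def
      by (rule measurable_compose[OF borel_measurable_reindex])
    also have "(\<lambda>z. indicator S (?R' z) *\<^sub>R \<bar>det (matrix (f' (?R' z)))\<bar>) =
        (\<lambda>z. indicator (?R ` S) z *\<^sub>R \<bar>det (matrix (?f' z))\<bar>)"
      by (auto simp: fun_eq_iff indicator_def img det)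
    finally show "set_borel_measurable borel (?R ` S) (\<lambda>z. \<bar>det (matrix (?f' z))\<bar>)"
      unfolding set_borel_measurable_def .
  qed
  also have "\<dots> = (\<integral>\<^sup>+z. ennreal (indicator S (?R' z) *\<^sub>R \<bar>det (matrix (f' (?R' z)))\<bar>) \<partial>lborel)"
    by (intro nn_integral_cong) (auto simp: indicator_def img det)
  also have "\<dots> = (\<integral>\<^sup>+x. ennreal (indicator S x *\<^sub>R \<bar>det (matrix (f' x))\<bar>) \<partial>distr lborel borel ?R')"
    using meas unfolding set_borel_measurable_def
    by (subst nn_integral_distr) auto
  also have "\<dots> = (\<integral>\<^sup>+x\<in>S. ennreal \<bar>det (matrix (f' x))\<bar> \<partial>lborel)"
    unfolding distr_lborel_reindex[OF \<beta>']
    by (intro nn_integral_cong) (auto simp: indicator_def)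
  finally show ?thesis
    using em[OF fS] by (simp only: ff)
qed

text \<open>Forward images are Borel here because they are preimages under the continuous inverse
  \<open>g\<close>, cut with the open set \<open>V\<close>.\<close>

lemma homeomorphism_borel_image:
  fixes f :: "'x::euclidean_space \<Rightarrow> 'y::euclidean_space"
  assumes h: "homeomorphism U V f g" and V: "open V" and C: "C \<in> sets borel" "C \<subseteq> U"
  shows "f ` C \<in> sets borel"
proof -
  have eq: "f ` C = V \<inter> g -` C"
  proof (intro set_eqI iffI)
    fix y assume "y \<in> f ` C"
    then show "y \<in> V \<inter> g -` C"
      using h C unfolding homeomorphism_def by auto
  next
    fix y assume "y \<in> V \<inter> g -` C"
    then show "y \<in> f ` C"
      using h unfolding homeomorphism_def by (intro image_eqI[where x="g y"]) auto
  qed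
  have "continuous_on V g" using h by (simp add: homeomorphism_def)
  then have "g \<in> borel_measurable (restrict_space borel V)"
    by (rule borel_measurable_continuous_on_restrict)
  from measurable_sets[OF this C(1)] have "g -` C \<inter> V \<in> sets (restrict_space borel V)"
    by (simp add: space_restrict_space)
  then show ?thesis
    using V by (subst (asm) sets_restrict_space_iff) (auto simp: eq Int_commute)
qed

text \<open>Passes from sets to weights. The measure formula, applied to the points of
  \<open>A\<close> whose image lies in an arbitrary Borel set, says that the Jacobian density on
  \<open>A\<close> is pushed forward by \<open>f\<close> to Lebesgue measure on the image;
  integrating \<open>w\<close> against these two equal measures gives the claim.\<close>

lemma nn_integral_differentiable_image:
  fixes f :: "real^'n \<Rightarrow> real^'n" and w :: "real^'n \<Rightarrow> ennreal"
  assumes h: "homeomorphism U V f g" and U: "open U" and V: "open V"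
    and der: "\<And>x. x \<in> U \<Longrightarrow> (f has_derivative f' x) (at x)"
    and cont: "continuous_on U (\<lambda>x. det (matrix (f' x)))"
    and A: "A \<in> sets borel" "A \<subseteq> U"
    and w: "(\<lambda>y. w y * indicator V y) \<in> borel_measurable borel"
  shows "(\<integral>\<^sup>+y\<in>f ` A. w y \<partial>lborel) = (\<integral>\<^sup>+x\<in>A. w (f x) * ennreal \<bar>det (matrix (f' x))\<bar> \<partial>lborel)"
proof -
  let ?d = "\<lambda>x. ennreal \<bar>det (matrix (f' x))\<bar>"
  \<comment> \<open>Extending \<open>f\<close> by zero outside \<open>U\<close> makes it Borel on
    the whole space, as \<open>distr\<close> demands; the density vanishes off \<open>A\<close>, so
    the extension changes no integral.\<close>
  let ?f = "\<lambda>x. indicator U x *\<^sub>R f x"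
  have inj: "inj_on f U" and fU: "f ` U = V" and contf: "continuous_on U f"
    using h by (auto simp: homeomorphism_def inj_on_def) metis
  have dm: "set_borel_measurable borel B (\<lambda>x. \<bar>det (matrix (f' x))\<bar>)" if "B \<in> sets borel" "B \<subseteq> U" for B
    unfolding set_borel_measurable_def
    by (rule borel_measurable_continuous_on_indicator)
      (use that cont continuous_on_subset in \<open>auto intro!: continuous_intros\<close>)
  have fm [measurable]: "?f \<in> borel_measurable borel"
    by (rule borel_measurable_continuous_on_indicator) (use U contf in auto)
  have dmA: "(\<lambda>x. ?d x * indicator A x) \<in> borel_measurable borel"
  proof -
    have "(\<lambda>x. ennreal (indicator A x *\<^sub>R \<bar>det (matrix (f' x))\<bar>)) \<in> borel_measurable borel"
      using dm[OF A] by (auto simp: set_borel_measurable_def)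
    also have "(\<lambda>x. ennreal (indicator A x *\<^sub>R \<bar>det (matrix (f' x))\<bar>)) = (\<lambda>x. ?d x * indicator A x)"
      by (auto simp: fun_eq_iff indicator_def)
    finally show ?thesis .
  qed
  have fA: "f ` A \<in> sets borel" by (rule homeomorphism_borel_image[OF h V A])
  let ?N1 = "distr (density lborel (\<lambda>x. ?d x * indicator A x)) borel ?f"
  let ?N2 = "density lborel (indicator (f ` A))"
  have "?N1 = ?N2"
  proof (rule measure_eqI)
    fix B assume "B \<in> sets ?N1"
    then have B [measurable]: "B \<in> sets borel" by simp
    let ?C = "A \<inter> ?f -` B"
    have C: "?C \<in> sets borel" "?C \<subseteq> U"
      using A measurable_sets[OF fm B] by auto
    have "emeasure ?N1 B = (\<integral>\<^sup>+x\<in>?C. ?d x \<partial>lborel)"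
      using dmA measurable_sets[OF fm B]
      by (subst emeasure_distr) (auto simp: emeasure_density indicator_inter_arith mult.assoc intro!: nn_integral_cong)
    also have "\<dots> = emeasure lborel (f ` ?C)"
      by (rule emeasure_differentiable_image[symmetric])
        (use C inj der dm homeomorphism_borel_image[OF h V] in
          \<open>auto intro: inj_on_subset has_derivative_at_withinI\<close>)
    also have "f ` ?C = f ` A \<inter> B"
      using A by (auto simp: indicator_def)
    also have "emeasure lborel (f ` A \<inter> B) = emeasure ?N2 B"
      using fA by (simp add: emeasure_density_const emeasure_restricted)
    finally show "emeasure ?N1 B = emeasure ?N2 B" .
  qed simp
  let ?w = "\<lambda>y. w y * indicator V y"
  have "(\<integral>\<^sup>+y\<in>f ` A. w y \<partial>lborel) = (\<integral>\<^sup>+y. indicator (f ` A) y * ?w y \<partial>lborel)"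
    using A fU by (intro nn_integral_cong) (auto simp: indicator_def)
  also have "\<dots> = (\<integral>\<^sup>+y. ?w y \<partial>?N2)"
    using fA w by (subst nn_integral_density) auto
  also have "\<dots> = (\<integral>\<^sup>+y. ?w y \<partial>?N1)" using \<open>?N1 = ?N2\<close> by simp
  also have "\<dots> = (\<integral>\<^sup>+x. (?d x * indicator A x) * ?w (?f x) \<partial>lborel)"
    using w dmA fm by (simp add: nn_integral_distr nn_integral_density)
  also have "\<dots> = (\<integral>\<^sup>+x\<in>A. w (f x) * ?d x \<partial>lborel)"
    using A fU by (intro nn_integral_cong) (auto simp: indicator_def mult_ac)
  finally show ?thesis .
qed

text \<open>The image of the unit ball under \<open>T\<close> contains the ball of radius
  \<open>c\<close>; comparing volumes gives the bound.\<close>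

lemma det_lower_bound:
  fixes T :: "real^'n \<Rightarrow> real^'n"
  assumes T: "linear T" and c: "0 < c" and lower: "\<And>u. c * norm u \<le> norm (T u)"
  shows "c ^ CARD('n) \<le> \<bar>det (matrix T)\<bar>"
proof -
  have ker: "T u = 0 \<Longrightarrow> u = 0" for u
    using lower[of u] c by (simp add: mult_le_0_iff)
  have inj: "inj T" using ker T by (simp add: linear_injective_0)
  have surj: "surj T" by (rule linear_inj_imp_surj[OF T inj])
  have sub: "ball (0::real^'n) c \<subseteq> T ` ball 0 1"
  proof
    fix y :: "real^'n" assume y: "y \<in> ball 0 c"
    obtain u where u: "y = T u" using surj by (metis surjD)
    have "c * norm u < c" using lower[of u] y u by simp
    then show "y \<in> T ` ball 0 1" using u c by auto
  qed
  have op: "open (T ` ball 0 1)"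
    using open_surjective_linear_image[OF _ T surj] by simp
  have b: "emeasure lborel (ball (0::real^'n) 1) = ennreal (measure lborel (ball (0::real^'n) 1))"
    "emeasure lborel (ball (0::real^'n) c) = ennreal (measure lborel (ball (0::real^'n) c))"
    by (rule emeasure_eq_ennreal_measure, metis emeasure_lborel_ball_finite infinity_ennreal_def less_irrefl)+
  have "emeasure lborel (ball (0::real^'n) c) \<le> emeasure lborel (T ` ball 0 1)"
    using sub op by (intro emeasure_mono) auto
  also have "\<dots> = (\<integral>\<^sup>+x\<in>ball (0::real^'n) 1. ennreal \<bar>det (matrix T)\<bar> \<partial>lborel)"
    by (rule emeasure_differentiable_image[where f'="\<lambda>_. T"])
      (use T op inj in \<open>auto simp: linear_imp_has_derivative set_borel_measurable_def intro: inj_on_subset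
        intro!: borel_measurable_times borel_measurable_indicator\<close>)
  also have "\<dots> = ennreal \<bar>det (matrix T)\<bar> * emeasure lborel (ball (0::real^'n) 1)"
    by (simp add: nn_integral_cmult_indicator)
  finally have "measure lborel (ball (0::real^'n) c) \<le> \<bar>det (matrix T)\<bar> * measure lborel (ball (0::real^'n) 1)"
    unfolding b by (simp add: ennreal_mult[symmetric])
  then show ?thesis
    using c content_ball_pos[of 1 "0::real^'n"] by (simp add: content_ball_conv_unit_ball[of c])
qed

text \<open>Gram--Schmidt: the columns of \<open>C\<close> are an orthonormal basis for the inner product \<open>G\<close>.\<close>

lemma orthonormal_frame:
  fixes G :: "real^'n^'n"
  assumes sym: "transpose G = G" and pos: "\<And>v. v \<noteq> 0 \<Longrightarrow> v \<bullet> (G *v v) > 0"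
  shows "\<exists>C::real^'n^'n. transpose C ** G ** C = mat 1"
proof -
  let ?g = "\<lambda>u v. u \<bullet> (G *v v)"
  have gs: "?g u v = ?g v u" for u v
    by (metis dot_lmul_matrix inner_commute sym transpose_matrix_vector)
  have "k \<le> CARD('n) \<Longrightarrow> \<exists>B. finite B \<and> card B = k \<and> (\<forall>u\<in>B. \<forall>v\<in>B. ?g u v = (if u = v then 1 else 0))" for k
  proof (induction k)
    case (Suc k)
    then obtain B where B: "finite B" "card B = k" "\<And>u v. u \<in> B \<Longrightarrow> v \<in> B \<Longrightarrow> ?g u v = (if u = v then 1 else 0)"
      by auto
    have "dim (span B) < CARD('n)"
      using dim_le_card'[OF B(1)] B(2) Suc.prems by (simp add: dim_span)
    then have "span B \<noteq> UNIV" by (metis dim_UNIV DIM_cart DIM_real mult_1_right nat_neq_iff)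
    then obtain x where x: "x \<notin> span B" by auto
    define y where "y = x - (\<Sum>b\<in>B. ?g b x *\<^sub>R b)"
    have "y \<noteq> 0"
    proof
      assume "y = 0"
      then have "x = (\<Sum>b\<in>B. ?g b x *\<^sub>R b)" by (simp add: y_def)
      also have "\<dots> \<in> span B" by (intro span_sum span_mul span_base)
      finally show False using x by simp
    qed
    have orth: "?g b y = 0" if "b \<in> B" for b
    proof -
      have "?g b y = ?g b x - (\<Sum>b'\<in>B. ?g b' x * ?g b b')"
        by (simp add: y_def matrix_vector_mult_diff_distrib inner_diff_right linear_sum[OF matrix_vector_mul_linear]
          matrix_vector_mult_scaleR inner_sum_right)
      also have "(\<Sum>b'\<in>B. ?g b' x * ?g b b') = (\<Sum>b'\<in>B. if b' = b then ?g b x else 0)"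
        using B(3)[OF that] by (intro sum.cong) auto
      finally show ?thesis using B(1) that by simp
    qed
    define z where "z = (1 / sqrt (?g y y)) *\<^sub>R y"
    have gyy: "?g y y > 0" using pos[OF \<open>y \<noteq> 0\<close>] .
    have zz: "?g z z = 1"
      using gyy by (simp add: z_def matrix_vector_mult_scaleR)
    have zo: "?g b z = 0" "?g z b = 0" if "b \<in> B" for b
      using orth[OF that] gs[of z b] by (simp_all add: z_def matrix_vector_mult_scaleR)
    have "z \<notin> B" using zo(1)[of z] zz by auto
    then show ?case
      using B zz zo by (intro exI[of _ "insert z B"]) auto
  qed (rule exI[of _ "{}"], simp)
  from this[of "CARD('n)"] obtain B where B: "finite B" "card B = CARD('n)"
    "\<And>u v. u \<in> B \<Longrightarrow> v \<in> B \<Longrightarrow> ?g u v = (if u = v then 1 else 0)"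
    by (auto simp del: matrix_vector_mul_assoc)
  obtain f :: "'n \<Rightarrow> real^'n" where f: "bij_betw f UNIV B"
    using finite_same_card_bij[OF finite B(1), of "UNIV::'n set"] B(2) by auto
  define C :: "real^'n^'n" where "C = (\<chi> i j. f j $ i)"
  have col: "column j C = f j" for j by (simp add: C_def column_def vec_eq_iff)
  have "(transpose C ** G ** C) $ i $ j = ?g (f i) (f j)" for i j
  proof -
    have "(transpose C ** (G ** C)) $ i $ j = column i C \<bullet> column j (G ** C)"
      by (simp add: matrix_matrix_mult_def transpose_def column_def inner_vec_def)
    also have "column j (G ** C) = G *v column j C"
      by (simp add: matrix_matrix_mult_def matrix_vector_mult_def column_def vec_eq_iff)
    finally show ?thesis by (simp add: col matrix_mul_assoc)
  qed
  moreover have "?g (f i) (f j) = (if i = j then 1 else 0)" for i j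
    using B(3)[of "f i" "f j"] f by (auto simp: bij_betw_def inj_def)
  ultimately have "transpose C ** G ** C = mat 1"
    by (simp add: vec_eq_iff mat_def)
  then show ?thesis ..
qed

section \<open>Differentiation\<close>

lemma vector_derivative_bound:
  fixes f :: "real \<Rightarrow> 'b::real_normed_vector"
  assumes "convex S" and "\<And>x. x \<in> S \<Longrightarrow> (f has_vector_derivative f' x) (at x within S)"
    and "\<And>x. x \<in> S \<Longrightarrow> norm (f' x) \<le> B" and "x \<in> S" "y \<in> S"
  shows "norm (f x - f y) \<le> B * \<bar>x - y\<bar>"
proof -
  have "norm (f x - f y) \<le> B * norm (x - y)"
  proof (rule differentiable_bound[OF assms(1) assms(2)[unfolded has_vector_derivative_def] _ assms(4,5)])
    show "onorm (\<lambda>h. h *\<^sub>R f' x) \<le> B" if "x \<in> S" for x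
      using assms(3)[OF that] by (intro onorm_le) (simp add: mult.commute[of B] mult_left_mono)
  qed
  then show ?thesis by simp
qed

lemma norm_vector_derivative_le:
  fixes f :: "real \<Rightarrow> 'b::real_normed_vector"
  assumes f: "(f has_vector_derivative D) (at x)" and "0 < \<delta>"
    and bd: "\<And>y. \<bar>y - x\<bar> < \<delta> \<Longrightarrow> norm (f y - f x) \<le> M * \<bar>y - x\<bar>"
  shows "norm D \<le> M"
proof (rule field_le_epsilon)
  fix e :: real assume "0 < e"
  then obtain d where d: "0 < d" "\<And>y. \<bar>y - x\<bar> < d \<Longrightarrow> norm (f y - f x - (y - x) *\<^sub>R D) \<le> e * \<bar>y - x\<bar>"
    using f unfolding has_vector_derivative_def has_derivative_at_alt real_norm_def by meson
  define y where "y = x + min d \<delta> / 2"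
  have y: "0 < \<bar>y - x\<bar>" "\<bar>y - x\<bar> < d" "\<bar>y - x\<bar> < \<delta>"
    using d(1) assms(2) by (auto simp: y_def)
  have "norm ((y - x) *\<^sub>R D) \<le> norm (f y - f x) + norm (f y - f x - (y - x) *\<^sub>R D)"
    by (metis add_diff_cancel_left' diff_add_cancel norm_triangle_ineq4)
  also have "\<dots> \<le> (M + e) * \<bar>y - x\<bar>"
    using d(2)[OF y(2)] bd[OF y(3)] by (simp add: algebra_simps)
  finally show "norm D \<le> M + e"
    using y(1) by (simp add: mult.commute)
qed

text \<open>A form of Schwarz's theorem in which the mixed derivative is given in one order only,
  first in t and then in s, and is continuous just at the point (0, t0). Two mean value estimates
  for the second difference of \<open>a\<close> show that the s-derivative \<alpha> can be
  differentiated in t, with the same value.\<close>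

lemma mixed_vector_derivative:
  fixes a b \<beta> :: "real \<Rightarrow> real \<Rightarrow> 'b::real_normed_vector"
  assumes "0 < \<delta>"
    and a: "\<And>s t. \<bar>s\<bar> < \<delta> \<Longrightarrow> \<bar>t - t0\<bar> < \<delta> \<Longrightarrow> (a s has_vector_derivative b s t) (at t)"
    and \<alpha>: "\<And>t. \<bar>t - t0\<bar> < \<delta> \<Longrightarrow> ((\<lambda>s. a s t) has_vector_derivative \<alpha> t) (at 0)"
    and \<beta>: "\<And>s t. \<bar>s\<bar> < \<delta> \<Longrightarrow> \<bar>t - t0\<bar> < \<delta> \<Longrightarrow> ((\<lambda>s. b s t) has_vector_derivative \<beta> s t) (at s)"
    and cont: "isCont (\<lambda>(s, t). \<beta> s t) (0, t0)"
  shows "(\<alpha> has_vector_derivative \<beta> 0 t0) (at t0)"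
  unfolding has_vector_derivative_def has_derivative_at_alt real_norm_def
proof (intro conjI allI impI)
  show "bounded_linear (\<lambda>x. x *\<^sub>R \<beta> 0 t0)" by (rule bounded_linear_scaleR_left)
  fix e :: real assume "0 < e"
  let ?B = "\<beta> 0 t0"
  obtain d1 where d1: "0 < d1" "\<And>s t. dist (s, t) (0, t0) < d1 \<Longrightarrow> dist (\<beta> s t) ?B < e"
    using cont \<open>0 < e\<close> unfolding continuous_at_eps_delta by fastforce
  define d where "d = min (d1 / 2) \<delta>"
  have d: "0 < d" "d \<le> \<delta>" using d1 \<open>0 < \<delta>\<close> by (auto simp: d_def)
  have nb: "norm (\<beta> s t - ?B) \<le> e" if "\<bar>s\<bar> < d" "\<bar>t - t0\<bar> < d" for s t
  proof -
    have "dist (s, t) (0, t0) \<le> \<bar>s\<bar> + \<bar>t - t0\<bar>"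
      unfolding dist_Pair_Pair by (rule order_trans[OF sqrt_sum_squares_le_sum]) (auto simp: dist_real_def)
    also have "\<dots> < d1" using that by (auto simp: d_def)
    finally show ?thesis using d1(2) by (force simp: dist_norm)
  qed
  have cv: "convex {r::real. \<bar>r - z\<bar> < d}" for z
    using convex_ball[of z d] by (simp add: ball_def dist_real_def abs_minus_commute)
  have b1: "norm (b s t - b 0 t - s *\<^sub>R ?B) \<le> e * \<bar>s\<bar>" if "\<bar>s\<bar> < d" "\<bar>t - t0\<bar> < d" for s t
  proof -
    have "norm ((b s t - s *\<^sub>R ?B) - (b 0 t - 0 *\<^sub>R ?B)) \<le> e * \<bar>s - 0\<bar>"
      by (rule vector_derivative_bound[where S="{r. \<bar>r - 0\<bar> < d}" and f'="\<lambda>s. \<beta> s t - ?B", OF cv])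
        (use that d nb in \<open>auto intro!: derivative_eq_intros \<beta>[THEN has_vector_derivative_at_within]\<close>)
    then show ?thesis by (simp add: algebra_simps)
  qed
  \<comment> \<open>The mean value inequality in t, fed with \<open>b1\<close>; the result is
    written so that it can be read as a bound linear in s.\<close>
  have b2: "norm ((a s t - a s t0 - s *\<^sub>R ((t - t0) *\<^sub>R ?B)) - (a 0 t - a 0 t0)) \<le> e * \<bar>t - t0\<bar> * \<bar>s\<bar>"
    if "\<bar>s\<bar> < d" "\<bar>t - t0\<bar> < d" for s t
  proof -
    let ?k = "\<lambda>t. a s t - a 0 t - (t - t0) *\<^sub>R (s *\<^sub>R ?B)"
    have "norm (?k t - ?k t0) \<le> e * \<bar>s\<bar> * \<bar>t - t0\<bar>"
      by (rule vector_derivative_bound[where S="{r. \<bar>r - t0\<bar> < d}" and f'="\<lambda>t. b s t - b 0 t - s *\<^sub>R ?B", OF cv])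
        (use that d b1 in \<open>auto intro!: derivative_eq_intros a[THEN has_vector_derivative_at_within]\<close>)
    then show ?thesis by (simp add: algebra_simps)
  qed
  show "\<exists>d>0. \<forall>y. \<bar>y - t0\<bar> < d \<longrightarrow> norm (\<alpha> y - \<alpha> t0 - (y - t0) *\<^sub>R ?B) \<le> e * \<bar>y - t0\<bar>"
  proof (intro exI conjI allI impI)
    fix t assume t: "\<bar>t - t0\<bar> < d"
    \<comment> \<open>By \<open>b2\<close> the increments of \<open>?c\<close> from 0 are at most e
      |t - t0| |s|, so its derivative at 0 is at most e |t - t0|; this derivative is exactly the
      remainder to be estimated.\<close>
    let ?c = "\<lambda>s. a s t - a s t0 - s *\<^sub>R ((t - t0) *\<^sub>R ?B)"
    have "(?c has_vector_derivative (\<alpha> t - \<alpha> t0 - (t - t0) *\<^sub>R ?B)) (at 0)"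
      using t d by (auto intro!: derivative_eq_intros \<alpha>)
    then show "norm (\<alpha> t - \<alpha> t0 - (t - t0) *\<^sub>R ?B) \<le> e * \<bar>t - t0\<bar>"
      by (rule norm_vector_derivative_le[OF _ d(1)]) (use b2[OF _ t] in auto)
  qed (rule d)
qed

section \<open>Partial derivatives and the classes C^k\<close>

lemma has_derivative_partial:
  fixes f :: "real^'n \<Rightarrow> 'b::real_normed_vector"
  assumes "f differentiable (at y)"
  shows "(f has_derivative (\<lambda>v. \<Sum>i\<in>UNIV. v $ i *\<^sub>R partial i f y)) (at y)"
proof -
  let ?D = "frechet_derivative f (at y)"
  have D: "(f has_derivative ?D) (at y)" using assms by (simp add: frechet_derivative_works)
  then have lin: "linear ?D" by (rule has_derivative_linear)
  have "?D v = (\<Sum>i\<in>UNIV. v $ i *\<^sub>R partial i f y)" for v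
  proof -
    have "?D v = ?D (\<Sum>i\<in>UNIV. v $ i *\<^sub>R axis i 1)"
      by (simp only: basis_expansion scalar_mult_eq_scaleR[symmetric])
    then show ?thesis
      by (simp add: linear_sum[OF lin] linear_scale[OF lin] partial_def)
  qed
  then have "?D = (\<lambda>v. \<Sum>i\<in>UNIV. v $ i *\<^sub>R partial i f y)" by (rule ext)
  with D show ?thesis by simp
qed

lemma partial_eq:
  "(f has_derivative f') (at y) \<Longrightarrow> partial i f y = f' (axis i 1)"
  unfolding partial_def by (drule frechet_derivative_at) simp

lemma partial_cong:
  assumes "open S" "y \<in> S" "\<And>z. z \<in> S \<Longrightarrow> f z = g z" "f differentiable (at y)"
  shows "partial i f y = partial i g y" "g differentiable (at y)"
proof -
  have f: "(f has_derivative frechet_derivative f (at y)) (at y)"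
    using assms(4) by (simp add: frechet_derivative_works)
  then have g: "(g has_derivative frechet_derivative f (at y)) (at y)"
    by (rule has_derivative_transform_within_open[OF _ assms(1-3)])
  show "partial i f y = partial i g y"
    using partial_eq[OF f] partial_eq[OF g] by simp
  show "g differentiable (at y)" using g by (auto simp: differentiable_def)
qed

text \<open>Openness of \<open>S\<close> matters because \<open>Ck_on\<close> differentiates in the
  full space: the two functions coincide in a neighbourhood of each point, hence so do their partial
  derivatives.\<close>

lemma Ck_on_cong:
  assumes "open S"
  shows "(\<And>z. z \<in> S \<Longrightarrow> f z = g z) \<Longrightarrow> Ck_on k S f \<Longrightarrow> Ck_on k S g"
proof (induction k arbitrary: f g)
  case 0
  then show ?case by (simp cong: continuous_on_cong)
next
  case (Suc k)
  have "Ck_on k S (partial i g)" for i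
    by (rule Suc.IH[of "partial i f"]) (use partial_cong(1)[OF assms _ Suc.prems(1)] Suc.prems(2) in auto)
  then show ?case
    using partial_cong(2)[OF assms _ Suc.prems(1)] Suc.prems(2) by auto
qed

lemma Ck_on_bounded_linear:
  assumes S: "open S" and L: "bounded_linear L"
  shows "Ck_on k S f \<Longrightarrow> Ck_on k S (\<lambda>z. L (f z))"
proof (induction k arbitrary: f)
  case 0
  then show ?case by (simp add: bounded_linear.continuous_on[OF L])
next
  case (Suc k)
  have d: "((\<lambda>z. L (f z)) has_derivative (\<lambda>v. L (frechet_derivative f (at y) v))) (at y)" if "y \<in> S" for y
    using Suc.prems that by (intro bounded_linear.has_derivative[OF L]) (simp add: frechet_derivative_works)
  have p: "partial i (\<lambda>z. L (f z)) y = L (partial i f y)" if "y \<in> S" for i y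
    using partial_eq[OF d[OF that]] by (simp add: partial_def)
  have "Ck_on k S (partial i (\<lambda>z. L (f z)))" for i
    by (rule Ck_on_cong[OF S, of "\<lambda>z. L (partial i f z)"]) (use p Suc in auto)
  then show ?case
    using d by (auto simp: differentiable_def)
qed

lemma smooth_onD:
  assumes "smooth_on S f"
  shows "\<And>y. y \<in> S \<Longrightarrow> f differentiable (at y)" "smooth_on S (partial i f)" "continuous_on S f" "Ck_on k S f"
proof -
  have "Ck_on (Suc k) S f" for k using assms by (simp add: smooth_on_def)
  then show "y \<in> S \<Longrightarrow> f differentiable (at y)" "smooth_on S (partial i f)" for y
    by (auto simp: smooth_on_def)
  have "Ck_on 0 S f" using assms by (simp only: smooth_on_def)
  then show "continuous_on S f" by simp
  show "Ck_on k S f" using assms by (simp only: smooth_on_def)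
qed

lemma smooth_on_bounded_linear:
  "open S \<Longrightarrow> bounded_linear L \<Longrightarrow> smooth_on S f \<Longrightarrow> smooth_on S (\<lambda>z. L (f z))"
  by (simp add: smooth_on_def Ck_on_bounded_linear)

lemma C1_onI:
  assumes "\<And>y. y \<in> S \<Longrightarrow> (f has_derivative f' y) (at y)"
    and "\<And>i. continuous_on S (\<lambda>y. f' y (axis i 1))"
  shows "Ck_on 1 S f"
proof -
  have "continuous_on S (partial i f)" for i
    using assms(2)[of i] by (rule continuous_on_eq) (simp add: partial_eq[OF assms(1)])
  then show ?thesis
    using assms(1) by (auto simp: differentiable_def)
qed

lemma C1_onD:
  assumes "Ck_on 1 S f"
  shows "\<And>y. y \<in> S \<Longrightarrow> (f has_derivative frechet_derivative f (at y)) (at y)"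
    "\<And>i. continuous_on S (\<lambda>y. frechet_derivative f (at y) (axis i 1))"
    "continuous_on S f"
proof -
  show d: "\<And>y. y \<in> S \<Longrightarrow> (f has_derivative frechet_derivative f (at y)) (at y)"
    using assms by (simp add: frechet_derivative_works)
  show "\<And>i. continuous_on S (\<lambda>y. frechet_derivative f (at y) (axis i 1))"
    using assms by (simp add: partial_def cong: continuous_on_cong)
  show "continuous_on S f"
    by (rule has_derivative_continuous_on) (rule has_derivative_at_withinI[OF d])
qed

lemma C1_on_const: "Ck_on 1 S (\<lambda>_. c)"
  by (rule C1_onI[where f'="\<lambda>_ _. 0"]) auto

lemma C1_on_add: "Ck_on 1 S f \<Longrightarrow> Ck_on 1 S g \<Longrightarrow> Ck_on 1 S (\<lambda>y. f y + g y)"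
  by (rule C1_onI, rule has_derivative_add[OF C1_onD(1) C1_onD(1)], assumption+)
    (intro continuous_on_add C1_onD(2); assumption)

lemma C1_on_diff: "Ck_on 1 S f \<Longrightarrow> Ck_on 1 S g \<Longrightarrow> Ck_on 1 S (\<lambda>y. f y - g y)"
  by (rule C1_onI, rule has_derivative_diff[OF C1_onD(1) C1_onD(1)], assumption+)
    (intro continuous_on_diff C1_onD(2); assumption)

lemma C1_on_mult: "Ck_on 1 S f \<Longrightarrow> Ck_on 1 S g \<Longrightarrow> Ck_on 1 S (\<lambda>y. f y * g y :: real)"
  by (rule C1_onI, rule has_derivative_mult[OF C1_onD(1) C1_onD(1)], assumption+)
    (intro continuous_on_add continuous_on_mult C1_onD(2); assumption?; erule C1_onD(3))

lemma C1_on_divide: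
  assumes "Ck_on 1 S f" "Ck_on 1 S g" "\<And>y. y \<in> S \<Longrightarrow> g y \<noteq> 0"
  shows "Ck_on 1 S (\<lambda>y. f y / g y :: real)"
proof (rule C1_onI)
  show "((\<lambda>y. f y / g y) has_derivative (\<lambda>h. (frechet_derivative f (at y) h * g y - f y * frechet_derivative g (at y) h)
      / (g y * g y))) (at y)" if "y \<in> S" for y
    by (rule has_derivative_divide'[OF C1_onD(1)[OF assms(1) that] C1_onD(1)[OF assms(2) that] assms(3)[OF that]])
  show "continuous_on S (\<lambda>y. (frechet_derivative f (at y) (axis i 1) * g y - f y * frechet_derivative g (at y) (axis i 1))
      / (g y * g y))" for i
    using C1_onD(2,3)[OF assms(1)] C1_onD(2,3)[OF assms(2)] assms(3)
    by (intro continuous_on_divide continuous_on_diff continuous_on_mult) auto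
qed

lemma C1_on_sum: "(\<And>i. i \<in> I \<Longrightarrow> Ck_on 1 S (f i)) \<Longrightarrow> Ck_on 1 S (\<lambda>y. \<Sum>i\<in>I. f i y)"
  by (induction I rule: infinite_finite_induct) (auto simp: C1_on_const C1_on_add simp del: Ck_on.simps One_nat_def)

lemma C1_on_prod: "(\<And>i. i \<in> I \<Longrightarrow> Ck_on 1 S (f i)) \<Longrightarrow> Ck_on 1 S (\<lambda>y. \<Prod>i\<in>I. f i y :: real)"
  by (induction I rule: infinite_finite_induct) (auto simp: C1_on_const C1_on_mult simp del: Ck_on.simps One_nat_def)

section \<open>Determinants and inverses of matrices of class C^1\<close>

lemma C1_on_det:
  assumes "\<And>i j. Ck_on 1 S (\<lambda>y. A y $ i $ j)"
  shows "Ck_on 1 S (\<lambda>y. det (A y :: real^'k^'k))"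
  unfolding det_def by (intro C1_on_sum C1_on_mult C1_on_prod C1_on_const assms)

lemma matrix_inv_inverse:
  fixes A :: "real^'k^'k"
  assumes "det A \<noteq> 0"
  shows "A ** matrix_inv A = mat 1" "matrix_inv A ** A = mat 1"
proof -
  have "\<exists>B. A ** B = mat 1 \<and> B ** A = mat 1"
    using assms by (simp add: invertible_det_nz[symmetric] invertible_def)
  from someI_ex[OF this] show "A ** matrix_inv A = mat 1" "matrix_inv A ** A = mat 1"
    by (simp_all add: matrix_inv_def)
qed

text \<open>Cramer's rule for the columns of the inverse. It exhibits the entries as quotients of
  determinants, to which the rules for sums, products and quotients apply.\<close>

lemma matrix_inv_nth:
  fixes A :: "real^'k^'k"
  assumes "det A \<noteq> 0"
  shows "matrix_inv A $ k $ l = det (\<chi> i j. if j = k then axis l 1 $ i else A $ i $ j) / det A"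
proof -
  have "A *v (matrix_inv A *v axis l 1) = axis l 1"
    using assms by (simp add: matrix_vector_mul_assoc matrix_inv_inverse)
  then have "matrix_inv A *v axis l 1 = (\<chi> k. det (\<chi> i j. if j = k then axis l 1 $ i else A $ i $ j) / det A)"
    by (simp add: cramer[OF assms])
  then show ?thesis
    by (simp add: vec_eq_iff matrix_vector_mult_basis column_def)
qed

lemma C1_on_matrix_inv:
  fixes A :: "real^'n \<Rightarrow> real^'k^'k"
  assumes S: "open S" and A: "\<And>i j. Ck_on 1 S (\<lambda>y. A y $ i $ j)" and det: "\<And>y. y \<in> S \<Longrightarrow> det (A y) \<noteq> 0"
  shows "Ck_on 1 S (\<lambda>y. matrix_inv (A y) $ k $ l)"
proof (rule Ck_on_cong[OF S])
  show "det (\<chi> i j. if j = k then axis l 1 $ i else A y $ i $ j) / det (A y) = matrix_inv (A y) $ k $ l" if "y \<in> S" for y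
    using matrix_inv_nth[OF det[OF that]] by simp
  have "Ck_on 1 S (\<lambda>y. (\<chi> i j. if j = k then axis l 1 $ i else A y $ i $ j) $ i $ j)" for i j
    by (cases "j = k") (use A C1_on_const in \<open>simp_all del: Ck_on.simps One_nat_def\<close>)
  then show "Ck_on 1 S (\<lambda>y. det (\<chi> i j. if j = k then axis l 1 $ i else A y $ i $ j) / det (A y))"
    by (intro C1_on_divide C1_on_det A det)
qed

section \<open>Connection and curvature in a chart\<close>

lemma has_vector_derivative_compose:
  assumes "(f has_vector_derivative f') (at t within T)" "(g has_derivative g') (at (f t))"
  shows "((\<lambda>t. g (f t)) has_vector_derivative g' f') (at t within T)"
  using vector_derivative_diff_chain_within[OF assms(1) has_derivative_at_withinI[OF assms(2)]] by (simp add: o_def)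

lemma bounded_bilinear_matrix_vector: "bounded_bilinear ((*v) :: real^'n^'m \<Rightarrow> real^'n \<Rightarrow> real^'m)"
  by (simp add: bilinear_conv_bounded_bilinear[symmetric] bilinear_def linear_iff algebra_simps
      matrix_vector_mult_def vec_eq_iff sum.distrib sum_distrib_left)

lemma C1_on_vec:
  assumes S: "open S" and "\<And>k. Ck_on 1 S (\<lambda>y. f y $ k)"
  shows "Ck_on 1 S (f :: real^'n \<Rightarrow> real^'k)"
proof (rule Ck_on_cong[OF S])
  show "(\<Sum>k\<in>UNIV. f y $ k *\<^sub>R axis k 1) = f y" for y
    by (simp only: basis_expansion scalar_mult_eq_scaleR[symmetric])
  show "Ck_on 1 S (\<lambda>y. \<Sum>k\<in>UNIV. f y $ k *\<^sub>R axis k 1)"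
    by (intro C1_on_sum Ck_on_bounded_linear[OF S bounded_linear_scaleR_left] assms)
qed

section \<open>The Levi-Civita connection of a metric in one chart\<close>

locale metric_chart =
  fixes M :: "('a, 'n::finite) riemannian" and c :: "('a, 'n) chart"
  assumes open_img: "open (chart_map c ` chart_dom c)"
    and smooth_g: "smooth_on (chart_map c ` chart_dom c) (gcoeff M c)"
    and sym_g: "\<And>y. y \<in> chart_map c ` chart_dom c \<Longrightarrow> transpose (gcoeff M c y) = gcoeff M c y"
    and pos_g: "\<And>y v. y \<in> chart_map c ` chart_dom c \<Longrightarrow> v \<noteq> 0 \<Longrightarrow> v \<bullet> (gcoeff M c y *v v) > 0"
begin

abbreviation "S \<equiv> chart_map c ` chart_dom c"

definition inn :: "real^'n \<Rightarrow> real^'n \<Rightarrow> real^'n \<Rightarrow> real" where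
  "inn y u v = u \<bullet> (gcoeff M c y *v v)"

definition chris :: "'n \<Rightarrow> 'n \<Rightarrow> real^'n \<Rightarrow> real^'n" where
  "chris i j y = (\<chi> k. christoffel M c k i j y)"

definition \<Gamma> :: "real^'n \<Rightarrow> real^'n \<Rightarrow> real^'n \<Rightarrow> real^'n" where
  "\<Gamma> y u v = (\<Sum>i\<in>UNIV. \<Sum>j\<in>UNIV. (u $ i * v $ j) *\<^sub>R chris i j y)"

text \<open>The derivative of \<Gamma> in its base point, in the direction \<open>a\<close>, with
  both vector arguments frozen.\<close>

definition d\<Gamma> :: "real^'n \<Rightarrow> real^'n \<Rightarrow> real^'n \<Rightarrow> real^'n \<Rightarrow> real^'n" where
  "d\<Gamma> y a u v = (\<Sum>i\<in>UNIV. \<Sum>j\<in>UNIV. (u $ i * v $ j) *\<^sub>R frechet_derivative (chris i j) (at y) a)"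

definition dg :: "real^'n \<Rightarrow> real^'n \<Rightarrow> real^'n^'n" where
  "dg y = frechet_derivative (gcoeff M c) (at y)"

definition curv :: "real^'n \<Rightarrow> real^'n \<Rightarrow> real^'n \<Rightarrow> real^'n \<Rightarrow> real^'n" where
  "curv y u v w = (\<chi> l. \<Sum>i\<in>UNIV. \<Sum>j\<in>UNIV. \<Sum>k\<in>UNIV. riemann M c l i j k y * u $ i * v $ j * w $ k)"

lemma det_g: "y \<in> S \<Longrightarrow> det (gcoeff M c y) \<noteq> 0"
proof -
  assume y: "y \<in> S"
  have "gcoeff M c y *v v = 0 \<Longrightarrow> v = 0" for v
    using pos_g[OF y, of v] by force
  then have "inj ((*v) (gcoeff M c y))"
    by (simp add: linear_injective_0)
  then show ?thesis
    by (simp add: inj_matrix_vector_mult matrix_left_invertible_injective invertible_det_nz[symmetric] invertible_left_inverse)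
qed

lemma inn_bilinear:
  "inn y (u + u') v = inn y u v + inn y u' v" "inn y u (v + v') = inn y u v + inn y u v'"
  "inn y (u - u') v = inn y u v - inn y u' v" "inn y u (v - v') = inn y u v - inn y u v'"
  "inn y (a *\<^sub>R u) v = a * inn y u v" "inn y u (a *\<^sub>R v) = a * inn y u v"
  "inn y (- u) v = - inn y u v" "inn y u (- v) = - inn y u v" "inn y 0 v = 0" "inn y u 0 = 0"
  by (simp_all add: inn_def inner_left_distrib inner_right_distrib matrix_vector_right_distrib matrix_vector_mult_diff_distrib
    inner_diff_left inner_diff_right matrix_vector_mult_scaleR linear_neg[OF matrix_vector_mul_linear])

lemma inn_sum: "inn y w (sum f A) = (\<Sum>a\<in>A. inn y w (f a))"
  by (simp add: inn_def linear_sum[OF matrix_vector_mul_linear] inner_sum_right)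

lemma inn_sym: "y \<in> S \<Longrightarrow> inn y u v = inn y v u"
  unfolding inn_def by (metis dot_lmul_matrix inner_commute sym_g transpose_matrix_vector)

lemma inn_pos: "y \<in> S \<Longrightarrow> v \<noteq> 0 \<Longrightarrow> inn y v v > 0"
  by (simp add: inn_def pos_g)

lemma inn_nonneg: "y \<in> S \<Longrightarrow> inn y v v \<ge> 0"
  using inn_pos[of y v] by (cases "v = 0") (auto simp: inn_bilinear)

lemma inn_cauchy_schwarz:
  assumes y: "y \<in> S"
  shows "(inn y u v)\<^sup>2 \<le> inn y u u * inn y v v"
proof (cases "v = 0")
  case False
  let ?a = "inn y u u" and ?b = "inn y u v" and ?d = "inn y v v"
  have d: "?d > 0" by (rule inn_pos[OF y False])
  have "0 \<le> inn y (?d *\<^sub>R u - ?b *\<^sub>R v) (?d *\<^sub>R u - ?b *\<^sub>R v)" by (rule inn_nonneg[OF y])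
  also have "\<dots> = ?d * (?a * ?d - ?b\<^sup>2)"
    by (simp add: inn_bilinear inn_sym[OF y, of v u] algebra_simps power2_eq_square)
  finally show ?thesis using d by (simp add: zero_le_mult_iff)
qed (simp add: inn_bilinear)

lemma g_has_derivative: "y \<in> S \<Longrightarrow> (gcoeff M c has_derivative dg y) (at y)"
  unfolding dg_def by (simp add: frechet_derivative_works[symmetric] smooth_onD(1)[OF smooth_g])

lemma g_nth_has_derivative:
  "y \<in> S \<Longrightarrow> ((\<lambda>z. gcoeff M c z $ i $ j) has_derivative (\<lambda>a. dg y a $ i $ j)) (at y)"
  by (intro bounded_linear.has_derivative[OF bounded_linear_vec_nth] g_has_derivative)

lemma partial_g: "y \<in> S \<Longrightarrow> partial m (\<lambda>z. gcoeff M c z $ i $ j) y = dg y (axis m 1) $ i $ j"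
  by (rule partial_eq[OF g_nth_has_derivative])

lemma g_nth_sym: "y \<in> S \<Longrightarrow> gcoeff M c y $ i $ j = gcoeff M c y $ j $ i"
  using arg_cong[OF sym_g[of y], of "\<lambda>A. A $ j $ i"] by (simp add: transpose_def)

lemma dg_sym:
  assumes y: "y \<in> S"
  shows "dg y a $ i $ j = dg y a $ j $ i"
proof -
  have "((\<lambda>z. gcoeff M c z $ i $ j) has_derivative (\<lambda>a. dg y a $ j $ i)) (at y)"
    by (rule has_derivative_transform_within_open[OF g_nth_has_derivative[OF y] open_img y])
      (rule g_nth_sym)
  from has_derivative_unique[OF this g_nth_has_derivative[OF y]] show ?thesis by (rule fun_cong[symmetric])
qed

lemma dg_expand:
  assumes y: "y \<in> S"
  shows "v \<bullet> (dg y u *v w) = (\<Sum>i\<in>UNIV. \<Sum>j\<in>UNIV. \<Sum>l\<in>UNIV. u $ i * v $ j * w $ l * dg y (axis i 1) $ j $ l)"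
proof -
  have lin: "linear (dg y)" using g_has_derivative[OF y] by (rule has_derivative_linear)
  have "dg y u = dg y (\<Sum>i\<in>UNIV. u $ i *\<^sub>R axis i 1)"
    by (simp only: basis_expansion scalar_mult_eq_scaleR[symmetric])
  also have "\<dots> = (\<Sum>i\<in>UNIV. u $ i *\<^sub>R dg y (axis i 1))"
    by (simp add: linear_sum[OF lin] linear_scale[OF lin])
  finally have "v \<bullet> (dg y u *v w) = (\<Sum>j\<in>UNIV. \<Sum>l\<in>UNIV. \<Sum>i\<in>UNIV. u $ i * v $ j * w $ l * dg y (axis i 1) $ j $ l)"
    by (simp add: inner_vec_def matrix_vector_mult_def sum_distrib_left sum_distrib_right algebra_simps)
  also have "\<dots> = (\<Sum>j\<in>UNIV. \<Sum>i\<in>UNIV. \<Sum>l\<in>UNIV. u $ i * v $ j * w $ l * dg y (axis i 1) $ j $ l)"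
    by (rule sum.cong[OF refl], rule sum.swap)
  also have "\<dots> = (\<Sum>i\<in>UNIV. \<Sum>j\<in>UNIV. \<Sum>l\<in>UNIV. u $ i * v $ j * w $ l * dg y (axis i 1) $ j $ l)"
    by (rule sum.swap)
  finally show ?thesis .
qed

text \<open>Lowering the upper index with the metric cancels the inverse matrix in the Christoffel
  symbols and leaves an expression linear in the derivatives of the metric.\<close>

lemma chris_lower:
  assumes y: "y \<in> S"
  shows "gcoeff M c y *v chris i j y =
    (1/2) *\<^sub>R (\<chi> l. dg y (axis i 1) $ j $ l + dg y (axis j 1) $ i $ l - dg y (axis l 1) $ i $ j)"
    (is "_ = (1/2) *\<^sub>R ?k")
proof -
  have "chris i j y = (1/2) *\<^sub>R (matrix_inv (gcoeff M c y) *v ?k)"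
    by (simp add: chris_def christoffel_def vec_eq_iff matrix_vector_mult_def partial_g[OF y])
  then show ?thesis
    by (simp add: matrix_vector_mult_scaleR matrix_vector_mul_assoc matrix_inv_inverse[OF det_g[OF y]])
qed

text \<open>The Koszul formula for fields with constant coordinates, whose brackets vanish. It
  characterizes \<Gamma> without indices, so that compatibility with the metric becomes a
  cancellation among a few terms.\<close>

lemma koszul:
  assumes y: "y \<in> S"
  shows "inn y w (\<Gamma> y u v) = (v \<bullet> (dg y u *v w) + u \<bullet> (dg y v *v w) - u \<bullet> (dg y w *v v)) / 2"
proof -
  let ?D = "\<lambda>i j l. dg y (axis i 1) $ j $ l"
  have 1: "inn y w (\<Gamma> y u v) = (\<Sum>i\<in>UNIV. \<Sum>j\<in>UNIV. \<Sum>l\<in>UNIV. u $ i * v $ j * w $ l * ((?D i j l + ?D j i l - ?D l i j) / 2))"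
    unfolding \<Gamma>_def inn_sum inn_bilinear
    by (simp add: inn_def chris_lower[OF y] inner_vec_def sum_distrib_left algebra_simps add_divide_distrib diff_divide_distrib)
  have 2: "u \<bullet> (dg y v *v w) = (\<Sum>i\<in>UNIV. \<Sum>j\<in>UNIV. \<Sum>l\<in>UNIV. u $ i * v $ j * w $ l * ?D j i l)"
    unfolding dg_expand[OF y] by (subst sum.swap) (simp add: mult_ac)
  have 3: "u \<bullet> (dg y w *v v) = (\<Sum>i\<in>UNIV. \<Sum>j\<in>UNIV. \<Sum>l\<in>UNIV. u $ i * v $ j * w $ l * ?D l i j)"
  proof -
    have "u \<bullet> (dg y w *v v) = (\<Sum>l\<in>UNIV. \<Sum>i\<in>UNIV. \<Sum>j\<in>UNIV. u $ i * v $ j * w $ l * ?D l i j)"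
      unfolding dg_expand[OF y] by (simp add: mult_ac)
    also have "\<dots> = (\<Sum>i\<in>UNIV. \<Sum>l\<in>UNIV. \<Sum>j\<in>UNIV. u $ i * v $ j * w $ l * ?D l i j)"
      by (rule sum.swap)
    also have "\<dots> = (\<Sum>i\<in>UNIV. \<Sum>j\<in>UNIV. \<Sum>l\<in>UNIV. u $ i * v $ j * w $ l * ?D l i j)"
      by (rule sum.cong[OF refl], rule sum.swap)
    finally show ?thesis .
  qed
  show ?thesis
    unfolding 1 2 3 dg_expand[OF y, of v u w]
    unfolding sum.distrib[symmetric] sum_subtractf[symmetric] sum_divide_distrib
    by (intro sum.cong refl) (simp add: field_simps)
qed

lemma dg_inner_sym: "y \<in> S \<Longrightarrow> u \<bullet> (dg y a *v v) = v \<bullet> (dg y a *v u)"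
proof -
  assume y: "y \<in> S"
  have "transpose (dg y a) = dg y a"
    using dg_sym[OF y] by (simp add: vec_eq_iff transpose_def)
  then show ?thesis by (metis dot_lmul_matrix inner_commute transpose_matrix_vector)
qed

text \<open>In the sum of the two Koszul expressions the derivatives of the metric in the directions
  \<open>u\<close> and \<open>v\<close> cancel, and the two halves of the derivative in the
  direction \<open>a\<close> remain.\<close>

lemma metric_compatible:
  assumes y: "y \<in> S"
  shows "u \<bullet> (dg y a *v v) = inn y (\<Gamma> y a u) v + inn y u (\<Gamma> y a v)"
  unfolding inn_sym[OF y, of "\<Gamma> y a u"] koszul[OF y]
  using dg_inner_sym[OF y, of u a v] dg_inner_sym[OF y, of a u v] dg_inner_sym[OF y, of a v u] by (simp add: field_simps)

text \<open>The product rule along a curve. The vectors u' + \<Gamma>(y', u) and v' + \<Gamma>(y',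
  v) are covariant derivatives; metric compatibility absorbs the derivative of the coefficients of
  the metric into them.\<close>

lemma inn_has_derivative:
  assumes y: "(y has_vector_derivative y') (at t within T)" "y t \<in> S"
    and u: "(u has_vector_derivative u') (at t within T)" and v: "(v has_vector_derivative v') (at t within T)"
  shows "((\<lambda>t. inn (y t) (u t) (v t)) has_real_derivative
    inn (y t) (u' + \<Gamma> (y t) y' (u t)) (v t) + inn (y t) (u t) (v' + \<Gamma> (y t) y' (v t))) (at t within T)"
proof -
  have "((\<lambda>t. gcoeff M c (y t)) has_vector_derivative dg (y t) y') (at t within T)"
    by (rule has_vector_derivative_compose[OF y(1) g_has_derivative[OF y(2)]])
  from bounded_bilinear.has_vector_derivative[OF bounded_bilinear_matrix_vector this v]
  have "((\<lambda>t. gcoeff M c (y t) *v v t) has_vector_derivative gcoeff M c (y t) *v v' + dg (y t) y' *v v t) (at t within T)" .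
  from bounded_bilinear.has_vector_derivative[OF bounded_bilinear_inner u this]
  show ?thesis
    unfolding has_real_derivative_iff_has_vector_derivative inn_def[symmetric]
    by (rule has_vector_derivative_eq_rhs)
      (simp add: inner_right_distrib inn_def[symmetric] metric_compatible[OF y(2)] inn_bilinear)
qed

lemma chris_C1: "Ck_on 1 S (chris i j)"
proof (rule C1_on_vec[OF open_img])
  fix k
  have g: "Ck_on 1 S (\<lambda>y. gcoeff M c y $ i $ j)" for i j
    using smooth_g by (intro Ck_on_bounded_linear[OF open_img bounded_linear_vec_nth] smooth_onD(4))
  have "smooth_on S (\<lambda>y. gcoeff M c y $ i $ j)" for i j
    by (intro smooth_on_bounded_linear[OF open_img bounded_linear_vec_nth] smooth_g)
  from smooth_onD(4)[OF smooth_onD(2)[OF this]]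
  have p: "Ck_on 1 S (partial m (\<lambda>y. gcoeff M c y $ i $ j))" for m i j .
  show "Ck_on 1 S (\<lambda>y. chris i j y $ k)"
    unfolding chris_def christoffel_def vec_lambda_beta
    by (intro C1_on_mult C1_on_const C1_on_sum C1_on_add C1_on_diff p C1_on_matrix_inv[OF open_img g det_g])
qed

lemma chris_has_derivative: "y \<in> S \<Longrightarrow> (chris i j has_derivative frechet_derivative (chris i j) (at y)) (at y)"
  by (rule C1_onD(1)[OF chris_C1])

lemma chris_sym: "y \<in> S \<Longrightarrow> chris i j y = chris j i y"
  by (simp add: chris_def christoffel_def vec_eq_iff partial_g dg_sym[of y _ i j] add.commute)

lemma \<Gamma>_sym: "y \<in> S \<Longrightarrow> \<Gamma> y u v = \<Gamma> y v u"
  unfolding \<Gamma>_def by (subst sum.swap) (simp add: chris_sym[of y] mult.commute)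

lemma d\<Gamma>_sym:
  assumes y: "y \<in> S"
  shows "d\<Gamma> y a u v = d\<Gamma> y a v u"
proof -
  have eq: "frechet_derivative (chris i j) (at y) = frechet_derivative (chris j i) (at y)" for i j
  proof -
    have "(chris j i has_derivative frechet_derivative (chris i j) (at y)) (at y)"
      by (rule has_derivative_transform_within_open[OF chris_has_derivative[OF y] open_img y]) (rule chris_sym)
    from frechet_derivative_at[OF this] show ?thesis .
  qed
  have "d\<Gamma> y a u v = (\<Sum>j\<in>UNIV. \<Sum>i\<in>UNIV. (u $ i * v $ j) *\<^sub>R frechet_derivative (chris i j) (at y) a)"
    unfolding d\<Gamma>_def by (rule sum.swap)
  also have "\<dots> = d\<Gamma> y a v u"
    unfolding d\<Gamma>_def by (intro sum.cong refl) (subst eq, simp only: mult.commute)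
  finally show ?thesis .
qed

lemma \<Gamma>_has_derivative:
  assumes y: "(y has_vector_derivative y') (at t within T)" "y t \<in> S"
    and u: "(u has_vector_derivative u') (at t within T)" and v: "(v has_vector_derivative v') (at t within T)"
  shows "((\<lambda>t. \<Gamma> (y t) (u t) (v t)) has_vector_derivative
    d\<Gamma> (y t) y' (u t) (v t) + \<Gamma> (y t) u' (v t) + \<Gamma> (y t) (u t) v') (at t within T)"
proof -
  have X: "((\<lambda>t. chris i j (y t)) has_vector_derivative frechet_derivative (chris i j) (at (y t)) y') (at t within T)" for i j
    by (rule has_vector_derivative_compose[OF y(1) chris_has_derivative[OF y(2)]])
  have uv: "((\<lambda>t. u t $ i * v t $ j) has_real_derivative (u' $ i * v t $ j + u t $ i * v' $ j)) (at t within T)" for i j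
    using bounded_bilinear.has_vector_derivative[OF bounded_bilinear_mult
        bounded_linear.has_vector_derivative[OF bounded_linear_vec_nth u, of i]
        bounded_linear.has_vector_derivative[OF bounded_linear_vec_nth v, of j]]
    unfolding has_real_derivative_iff_has_vector_derivative by (simp only: add.commute)
  show ?thesis
    unfolding \<Gamma>_def
    by (rule has_vector_derivative_eq_rhs, rule has_vector_derivative_sum, rule has_vector_derivative_sum,
        rule has_vector_derivative_scaleR[OF uv X], unfold d\<Gamma>_def sum.distrib[symmetric], intro sum.cong refl)
      (simp add: algebra_simps)
qed

lemma \<Gamma>_bilinear:
  "\<Gamma> y (u + u') v = \<Gamma> y u v + \<Gamma> y u' v" "\<Gamma> y u (v + v') = \<Gamma> y u v + \<Gamma> y u v'"
  "\<Gamma> y (- u) v = - \<Gamma> y u v" "\<Gamma> y u (- v) = - \<Gamma> y u v"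
  "\<Gamma> y (a *\<^sub>R u) v = a *\<^sub>R \<Gamma> y u v" "\<Gamma> y u (a *\<^sub>R v) = a *\<^sub>R \<Gamma> y u v"
  unfolding \<Gamma>_def sum.distrib[symmetric] sum_negf[symmetric] scaleR_sum_right
  by (intro sum.cong refl; simp add: algebra_simps)+

text \<open>Second covariant derivatives of a field with constant coordinates, antisymmetrized. In
  this index-free shape the curvature can be recognized when the geodesic equation is
  linearized.\<close>

lemma curv_eq:
  assumes y: "y \<in> S"
  shows "curv y u v w = d\<Gamma> y u v w - d\<Gamma> y v u w + \<Gamma> y u (\<Gamma> y v w) - \<Gamma> y v (\<Gamma> y u w)"
proof -
  let ?P = "\<lambda>i j k l. partial i (christoffel M c l j k) y" and ?C = "\<lambda>l i j. christoffel M c l i j y"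
  have d: "d\<Gamma> y a u v $ l = (\<Sum>i\<in>UNIV. \<Sum>j\<in>UNIV. \<Sum>k\<in>UNIV. ?P i j k l * a $ i * u $ j * v $ k)" for a u v l
  proof -
    have "((\<lambda>z. chris j k z $ l) has_derivative (\<lambda>a. frechet_derivative (chris j k) (at y) a $ l)) (at y)" for j k
      by (intro bounded_linear.has_derivative[OF bounded_linear_vec_nth] chris_has_derivative y)
    then have hd: "(christoffel M c l j k has_derivative (\<lambda>a. frechet_derivative (chris j k) (at y) a $ l)) (at y)" for j k
      by (simp add: chris_def)
    have "frechet_derivative (chris j k) (at y) a $ l = (\<Sum>i\<in>UNIV. a $ i * ?P i j k l)" for j k
      using has_derivative_unique[OF hd has_derivative_partial[OF differentiableI[OF hd]]]
      by (simp add: fun_eq_iff)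
    then have "d\<Gamma> y a u v $ l = (\<Sum>j\<in>UNIV. \<Sum>k\<in>UNIV. \<Sum>i\<in>UNIV. ?P i j k l * a $ i * u $ j * v $ k)"
      by (simp add: d\<Gamma>_def sum_distrib_left mult_ac)
    also have "\<dots> = (\<Sum>j\<in>UNIV. \<Sum>i\<in>UNIV. \<Sum>k\<in>UNIV. ?P i j k l * a $ i * u $ j * v $ k)"
      by (rule sum.cong[OF refl], rule sum.swap)
    also have "\<dots> = (\<Sum>i\<in>UNIV. \<Sum>j\<in>UNIV. \<Sum>k\<in>UNIV. ?P i j k l * a $ i * u $ j * v $ k)"
      by (rule sum.swap)
    finally show ?thesis .
  qed
  have g: "\<Gamma> y u (\<Gamma> y v w) $ l = (\<Sum>i\<in>UNIV. \<Sum>j\<in>UNIV. \<Sum>k\<in>UNIV. (\<Sum>m\<in>UNIV. ?C l i m * ?C m j k) * u $ i * v $ j * w $ k)" for u v w l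
  proof -
    have "\<Gamma> y u (\<Gamma> y v w) $ l = (\<Sum>i\<in>UNIV. \<Sum>m\<in>UNIV. \<Sum>j\<in>UNIV. \<Sum>k\<in>UNIV. ?C l i m * ?C m j k * u $ i * v $ j * w $ k)"
      by (simp add: \<Gamma>_def chris_def sum_distrib_left sum_distrib_right mult_ac)
    also have "\<dots> = (\<Sum>i\<in>UNIV. \<Sum>j\<in>UNIV. \<Sum>m\<in>UNIV. \<Sum>k\<in>UNIV. ?C l i m * ?C m j k * u $ i * v $ j * w $ k)"
      by (rule sum.cong[OF refl], rule sum.swap)
    also have "\<dots> = (\<Sum>i\<in>UNIV. \<Sum>j\<in>UNIV. \<Sum>k\<in>UNIV. \<Sum>m\<in>UNIV. ?C l i m * ?C m j k * u $ i * v $ j * w $ k)"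
      by (rule sum.cong[OF refl], rule sum.cong[OF refl], rule sum.swap)
    finally show ?thesis by (simp add: sum_distrib_right)
  qed
  have s3: "(\<Sum>i\<in>UNIV. \<Sum>j\<in>UNIV. \<Sum>k\<in>UNIV. f i j k * v $ i * u $ j * w $ k)
     = (\<Sum>i\<in>UNIV. \<Sum>j\<in>UNIV. \<Sum>k\<in>UNIV. f j i k * u $ i * v $ j * w $ k)" for f
    by (subst sum.swap) (simp only: mult_ac)
  show ?thesis
  proof (rule vec_eq_iff[THEN iffD2], rule allI)
    fix l
    show "curv y u v w $ l = (d\<Gamma> y u v w - d\<Gamma> y v u w + \<Gamma> y u (\<Gamma> y v w) - \<Gamma> y v (\<Gamma> y u w)) $ l"
      unfolding vector_minus_component vector_add_component d g
      unfolding s3 curv_def riemann_def vec_lambda_beta sum.distrib[symmetric] sum_subtractf[symmetric]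
      by (intro sum.cong refl) (simp add: sum_subtractf algebra_simps)
  qed
qed

end

section \<open>Curvature bound and Jacobi's equation in a chart\<close>

context metric_chart
begin

lemma curv_bilinear:
  "curv y (a *\<^sub>R u) v w = a *\<^sub>R curv y u v w" "curv y u (a *\<^sub>R v) w = a *\<^sub>R curv y u v w"
  by (simp_all add: curv_def vec_eq_iff sum_distrib_left mult_ac)

lemma curv_antisym: "curv y v u w = - curv y u v w"
proof -
  have r: "riemann M c l j i k y = - riemann M c l i j k y" for l i j k
    by (simp add: riemann_def sum_negf[symmetric])
  have "curv y v u w $ l = - curv y u v w $ l" for l
  proof -
    have "curv y v u w $ l = (\<Sum>j\<in>UNIV. \<Sum>i\<in>UNIV. \<Sum>k\<in>UNIV. riemann M c l i j k y * v $ i * u $ j * w $ k)"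
      unfolding curv_def vec_lambda_beta by (rule sum.swap)
    also have "\<dots> = - curv y u v w $ l"
      unfolding curv_def vec_lambda_beta sum_negf[symmetric]
      by (intro sum.cong refl) (subst r, simp add: mult_ac)
    finally show ?thesis .
  qed
  then show ?thesis by (simp add: vec_eq_iff)
qed

text \<open>Sectional curvature is bounded only on independent pairs. For a dependent pair
  antisymmetry makes the curvature term vanish; otherwise the Gram determinant in the denominator is
  enlarged to the product of the squared norms, which is legitimate as
  \<open>0 \<le> K\<close>.\<close>

lemma curv_bound:
  assumes y: "y \<in> S" and K: "0 \<le> K"
    and sec: "\<And>u v. u \<noteq> v \<Longrightarrow> independent {u, v} \<Longrightarrow>
      inn y (curv y u v v) u / (inn y u u * inn y v v - (inn y u v)\<^sup>2) \<le> K"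
  shows "inn y (curv y u v v) u \<le> K * (inn y u u * inn y v v)"
proof (cases "v = 0 \<or> (\<exists>a. u = a *\<^sub>R v)")
  case True
  have vv: "curv y v v v = 0"
    using curv_antisym[of y v v v] by (simp add: vec_eq_iff)
  have "curv y u v v = 0"
    using True
  proof
    assume "v = 0"
    then show ?thesis using curv_bilinear(2)[of y u 0 v v] by simp
  next
    assume "\<exists>a. u = a *\<^sub>R v"
    then show ?thesis using vv by (auto simp: curv_bilinear)
  qed
  then show ?thesis using K inn_nonneg[OF y] by (simp add: inn_bilinear)
next
  case False
  then have uv: "u \<noteq> v" by (metis scaleR_one)
  have ind: "independent {u, v}"
    using False by (auto simp: independent_insert span_singleton)
  let ?a = "inn y u u" and ?b = "inn y u v" and ?d = "inn y v v"
  have d: "?d > 0" using inn_pos[OF y] False by blast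
  \<comment> \<open>The squared norm of this vector is \<open>?d\<close> times the Gram determinant,
    so independence of \<open>u\<close> and \<open>v\<close> gives the strict Cauchy-Schwarz
    inequality.\<close>
  have ne: "?d *\<^sub>R u - ?b *\<^sub>R v \<noteq> 0"
  proof
    assume "?d *\<^sub>R u - ?b *\<^sub>R v = 0"
    then have "u = (?b / ?d) *\<^sub>R v"
      using d by (simp add: field_simps vector_add_divide_simps)
    then show False using False by blast
  qed
  have "0 < inn y (?d *\<^sub>R u - ?b *\<^sub>R v) (?d *\<^sub>R u - ?b *\<^sub>R v)" by (rule inn_pos[OF y ne])
  also have "\<dots> = ?d * (?a * ?d - ?b\<^sup>2)"
    by (simp add: inn_bilinear inn_sym[OF y, of v u] algebra_simps power2_eq_square)
  finally have den: "0 < ?a * ?d - ?b\<^sup>2" using d by (simp add: zero_less_mult_iff)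
  have "inn y (curv y u v v) u \<le> K * (?a * ?d - ?b\<^sup>2)"
    using sec[OF uv ind] den by (simp add: pos_divide_le_eq)
  also have "\<dots> \<le> K * (?a * ?d)"
    using K by (simp add: mult_left_mono)
  finally show ?thesis .
qed

text \<open>
  \<open>P t + \<Gamma> (y t) (W t) (J t)\<close> is the covariant derivative of \<open>J\<close> along the geodesic \<open>y\<close>; the hypothesis on
  \<open>P\<close> is the linearized geodesic equation, and the conclusion is Jacobi's equation.
\<close>

lemma jacobi_equation:
  assumes y: "(y has_vector_derivative W t) (at t)" "y t \<in> S"
    and W: "(W has_vector_derivative - \<Gamma> (y t) (W t) (W t)) (at t)"
    and J: "(J has_vector_derivative P t) (at t)"
    and P: "(P has_vector_derivative
      - (d\<Gamma> (y t) (J t) (W t) (W t) + \<Gamma> (y t) (P t) (W t) + \<Gamma> (y t) (W t) (P t))) (at t)"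
  shows "((\<lambda>t. P t + \<Gamma> (y t) (W t) (J t)) has_vector_derivative
    - curv (y t) (J t) (W t) (W t) - \<Gamma> (y t) (W t) (P t + \<Gamma> (y t) (W t) (J t))) (at t)"
proof -
  let ?C = "\<Gamma> (y t)"
  have "- (d\<Gamma> (y t) (J t) (W t) (W t) + ?C (P t) (W t) + ?C (W t) (P t))
      + (d\<Gamma> (y t) (W t) (W t) (J t) + ?C (- ?C (W t) (W t)) (J t) + ?C (W t) (P t))
    = - curv (y t) (J t) (W t) (W t) - ?C (W t) (P t + ?C (W t) (J t))"
    unfolding curv_eq[OF y(2)] \<Gamma>_bilinear d\<Gamma>_sym[OF y(2), of "W t" "W t" "J t"] \<Gamma>_sym[OF y(2), of "P t" "W t"]
      \<Gamma>_sym[OF y(2), of "J t" "W t"] \<Gamma>_sym[OF y(2), of "?C (W t) (W t)" "J t"]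
    by simp
  with has_vector_derivative_add[OF P \<Gamma>_has_derivative[OF y W J]] show ?thesis by simp
qed

section \<open>Local uniqueness of geodesics\<close>

lemma \<Gamma>_bound:
  assumes K: "compact K" "K \<subseteq> S"
  shows "\<exists>C. \<forall>y\<in>K. \<forall>u v. norm (\<Gamma> y u v) \<le> C * norm u * norm v"
proof -
  have "continuous_on K (\<lambda>y. \<Sum>i\<in>UNIV. \<Sum>j\<in>UNIV. norm (chris i j y))"
    by (intro continuous_on_sum continuous_on_norm continuous_on_subset[OF C1_onD(3)[OF chris_C1] K(2)])
  from compact_imp_bounded[OF compact_continuous_image[OF this K(1)]]
  obtain C where C: "\<And>y. y \<in> K \<Longrightarrow> norm (\<Sum>i\<in>UNIV. \<Sum>j\<in>UNIV. norm (chris i j y)) \<le> C"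
    unfolding bounded_iff by blast
  have "norm (\<Gamma> y u v) \<le> C * norm u * norm v" if "y \<in> K" for y u v
  proof -
    have "norm (\<Gamma> y u v) \<le> (\<Sum>i\<in>UNIV. \<Sum>j\<in>UNIV. (norm u * norm v) * norm (chris i j y))"
      unfolding \<Gamma>_def
      by (rule sum_norm_le, rule sum_norm_le, unfold norm_scaleR real_norm_def abs_mult,
          intro mult_mono component_le_norm_cart) auto
    also have "\<dots> = norm u * norm v * (\<Sum>i\<in>UNIV. \<Sum>j\<in>UNIV. norm (chris i j y))"
      by (simp add: sum_distrib_left)
    also have "\<dots> \<le> norm u * norm v * C"
      by (intro mult_left_mono order_trans[OF _ C[OF that]]) auto
    finally show ?thesis by (simp add: mult_ac)
  qed
  then show ?thesis by blast
qed

lemma d\<Gamma>_bound: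
  assumes K: "compact K" "K \<subseteq> S"
  shows "\<exists>C. \<forall>y\<in>K. \<forall>a u v. norm (d\<Gamma> y a u v) \<le> C * norm a * norm u * norm v"
proof -
  let ?F = "\<lambda>y. \<Sum>i\<in>UNIV. \<Sum>j\<in>UNIV. \<Sum>k\<in>UNIV. norm (partial k (chris i j) y)"
  have p: "continuous_on S (partial k (chris i j))" for i j k
    using chris_C1[of i j] by simp
  have "continuous_on K ?F"
    by (intro continuous_on_sum continuous_on_norm continuous_on_subset[OF p K(2)])
  from compact_imp_bounded[OF compact_continuous_image[OF this K(1)]]
  obtain C where C: "\<And>y. y \<in> K \<Longrightarrow> norm (?F y) \<le> C"
    unfolding bounded_iff by blast
  have "norm (d\<Gamma> y a u v) \<le> C * norm a * norm u * norm v" if "y \<in> K" for y a u v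
  proof -
    have y: "y \<in> S" using that K by auto
    have f: "frechet_derivative (chris i j) (at y) a = (\<Sum>k\<in>UNIV. a $ k *\<^sub>R partial k (chris i j) y)" for i j
      using has_derivative_unique[OF chris_has_derivative[OF y]
          has_derivative_partial[OF differentiableI[OF chris_has_derivative[OF y]]]]
      by metis
    have f': "norm (frechet_derivative (chris i j) (at y) a) \<le> norm a * (\<Sum>k\<in>UNIV. norm (partial k (chris i j) y))" for i j
      unfolding f sum_distrib_left
      by (rule sum_norm_le, unfold norm_scaleR real_norm_def, intro mult_mono component_le_norm_cart) auto
    have "norm (d\<Gamma> y a u v) \<le> (\<Sum>i\<in>UNIV. \<Sum>j\<in>UNIV. (norm u * norm v) * (norm a * (\<Sum>k\<in>UNIV. norm (partial k (chris i j) y))))"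
      unfolding d\<Gamma>_def
      by (rule sum_norm_le, rule sum_norm_le, unfold norm_scaleR real_norm_def abs_mult,
          intro mult_mono component_le_norm_cart f') auto
    also have "\<dots> = norm u * norm v * norm a * ?F y"
      by (simp add: sum_distrib_left mult_ac)
    also have "\<dots> \<le> norm u * norm v * norm a * C"
      by (intro mult_left_mono order_trans[OF _ C[OF that]]) auto
    finally show ?thesis by (simp add: mult_ac)
  qed
  then show ?thesis by blast
qed

text \<open>The geodesic field is of class C^1, hence Lipschitz on a product of balls. The bounds on
  \<Gamma> and on its derivative are integrated along the segment between the two states, which
  stays in the balls by convexity; the two summands of \<open>L\<close> come from moving the base
  point and from moving the two vector arguments.\<close>

lemma geodesic_field_lipschitz:
  assumes y0: "y0 \<in> S" and "0 \<le> R"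
  shows "\<exists>r>0. cball y0 r \<subseteq> S \<and> (\<exists>L\<ge>0. \<forall>y\<in>cball y0 r. \<forall>y'\<in>cball y0 r. \<forall>w w'. norm w \<le> R \<longrightarrow> norm w' \<le> R \<longrightarrow>
    norm (\<Gamma> y w w - \<Gamma> y' w' w') \<le> L * (norm (y - y') + norm (w - w')))"
proof -
  obtain r where r: "0 < r" "cball y0 r \<subseteq> S"
    using open_img y0 open_contains_cball by blast
  obtain C1 where C1: "\<And>y u v. y \<in> cball y0 r \<Longrightarrow> norm (\<Gamma> y u v) \<le> C1 * norm u * norm v"
    using \<Gamma>_bound[OF compact_cball r(2)] by blast
  obtain C2 where C2: "\<And>y a u v. y \<in> cball y0 r \<Longrightarrow> norm (d\<Gamma> y a u v) \<le> C2 * norm a * norm u * norm v"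
    using d\<Gamma>_bound[OF compact_cball r(2)] by blast
  define L where "L = \<bar>C2\<bar> * R * R + 2 * \<bar>C1\<bar> * R"
  have L: "0 \<le> L" using \<open>0 \<le> R\<close> by (simp add: L_def)
  have "norm (\<Gamma> y w w - \<Gamma> y' w' w') \<le> L * (norm (y - y') + norm (w - w'))"
    if y: "y \<in> cball y0 r" "y' \<in> cball y0 r" and w: "norm w \<le> R" "norm w' \<le> R" for y y' w w'
  proof -
    let ?y = "\<lambda>s. y' + s *\<^sub>R (y - y')" and ?w = "\<lambda>s. w' + s *\<^sub>R (w - w')"
    have yin: "?y s \<in> cball y0 r" if "s \<in> {0..1}" for s
    proof -
      have "(1 - s) *\<^sub>R y' + s *\<^sub>R y \<in> cball y0 r"
        using convexD_alt[OF convex_cball y(2,1), of s] that by simp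
      then show ?thesis by (simp add: algebra_simps)
    qed
    have win: "norm (?w s) \<le> R" if "s \<in> {0..1}" for s
    proof -
      have "(1 - s) *\<^sub>R w' + s *\<^sub>R w \<in> cball 0 R"
        using convexD_alt[OF convex_cball, of w' 0 R w s] that w by simp
      then show ?thesis by (simp add: algebra_simps)
    qed
    let ?D = "\<lambda>s. d\<Gamma> (?y s) (y - y') (?w s) (?w s) + \<Gamma> (?y s) (w - w') (?w s) + \<Gamma> (?y s) (?w s) (w - w')"
    have dy: "(?y has_vector_derivative (y - y')) (at s within {0..1})"
      and dw: "(?w has_vector_derivative (w - w')) (at s within {0..1})" for s
      by (auto intro!: derivative_eq_intros)
    have "norm ((\<lambda>s. \<Gamma> (?y s) (?w s) (?w s)) 1 - (\<lambda>s. \<Gamma> (?y s) (?w s) (?w s)) 0)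
      \<le> L * (norm (y - y') + norm (w - w')) * \<bar>1 - 0\<bar>"
    proof (rule vector_derivative_bound[where S="{0..1}" and f'="?D"])
      show "((\<lambda>s. \<Gamma> (?y s) (?w s) (?w s)) has_vector_derivative ?D s) (at s within {0..1})" if "s \<in> {0..1}" for s
        by (rule \<Gamma>_has_derivative[OF dy _ dw dw]) (use yin[OF that] r in auto)
      show "norm (?D s) \<le> L * (norm (y - y') + norm (w - w'))" if s: "s \<in> {0..1}" for s
      proof -
        have a: "norm (d\<Gamma> (?y s) (y - y') (?w s) (?w s)) \<le> \<bar>C2\<bar> * R * R * norm (y - y')"
        proof -
          have "norm (d\<Gamma> (?y s) (y - y') (?w s) (?w s)) \<le> C2 * norm (y - y') * norm (?w s) * norm (?w s)"
            by (rule C2[OF yin[OF s]])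
          also have "\<dots> \<le> \<bar>C2\<bar> * norm (y - y') * R * R"
            using win[OF s] \<open>0 \<le> R\<close> by (intro mult_mono) auto
          finally show ?thesis by (simp add: mult_ac)
        qed
        have b: "norm (\<Gamma> (?y s) (w - w') (?w s)) \<le> \<bar>C1\<bar> * R * norm (w - w')"
        proof -
          have "norm (\<Gamma> (?y s) (w - w') (?w s)) \<le> C1 * norm (w - w') * norm (?w s)"
            by (rule C1[OF yin[OF s]])
          also have "\<dots> \<le> \<bar>C1\<bar> * norm (w - w') * R"
            using win[OF s] \<open>0 \<le> R\<close> by (intro mult_mono) auto
          finally show ?thesis by (simp add: mult_ac)
        qed
        have ys: "?y s \<in> S" using yin[OF s] r by blast
        have b': "norm (\<Gamma> (?y s) (?w s) (w - w')) \<le> \<bar>C1\<bar> * R * norm (w - w')"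
          by (subst \<Gamma>_sym[OF ys]) (rule b)
        have "norm (?D s) \<le> \<bar>C2\<bar> * R * R * norm (y - y') + \<bar>C1\<bar> * R * norm (w - w') + \<bar>C1\<bar> * R * norm (w - w')"
          by (intro norm_triangle_mono a b b')
        also have "\<dots> = \<bar>C2\<bar> * R * R * norm (y - y') + 2 * \<bar>C1\<bar> * R * norm (w - w')" by simp
        also have "\<dots> \<le> L * norm (y - y') + L * norm (w - w')"
          using \<open>0 \<le> R\<close> by (intro add_mono mult_right_mono) (auto simp: L_def)
        finally show ?thesis by (simp add: algebra_simps)
      qed
    qed auto
    then show ?thesis by simp
  qed
  with L have "\<exists>L\<ge>0. \<forall>y\<in>cball y0 r. \<forall>y'\<in>cball y0 r. \<forall>w w'. norm w \<le> R \<longrightarrow> norm w' \<le> R \<longrightarrow>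
    norm (\<Gamma> y w w - \<Gamma> y' w' w') \<le> L * (norm (y - y') + norm (w - w'))"
    by (intro exI[of _ L]) simp
  with r show ?thesis by (intro exI[of _ r]) simp
qed

text \<open>Gronwall's argument for the first-order system in (y, w): the squared distance
  \<open>u\<close> of the two solutions satisfies u' \<le> C u and starts at 0, so exp (-C t) u
  cannot become positive.\<close>

lemma geodesic_local_unique:
  assumes "a < b"
    and y1: "\<And>t. t \<in> {a..b} \<Longrightarrow> (y1 has_vector_derivative w1 t) (at t within {a..b})"
    and y2: "\<And>t. t \<in> {a..b} \<Longrightarrow> (y2 has_vector_derivative w2 t) (at t within {a..b})"
    and w1: "\<And>t. t \<in> {a..b} \<Longrightarrow> (w1 has_vector_derivative - \<Gamma> (y1 t) (w1 t) (w1 t)) (at t within {a..b})"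
    and w2: "\<And>t. t \<in> {a..b} \<Longrightarrow> (w2 has_vector_derivative - \<Gamma> (y2 t) (w2 t) (w2 t)) (at t within {a..b})"
    and init: "y1 a \<in> S" "y1 a = y2 a" "w1 a = w2 a"
  shows "\<exists>e>a. e \<le> b \<and> (\<forall>t\<in>{a..e}. y1 t = y2 t)"
proof -
  have cont: "continuous_on {a..b} y1" "continuous_on {a..b} y2" "continuous_on {a..b} w1" "continuous_on {a..b} w2"
    by (rule continuous_on_vector_derivative, fact)+
  define R where "R = norm (w1 a) + 1"
  have "0 \<le> R" by (simp add: R_def)
  from geodesic_field_lipschitz[OF init(1) this] obtain r where r: "0 < r" "cball (y1 a) r \<subseteq> S"
    and "\<exists>L\<ge>0. \<forall>y\<in>cball (y1 a) r. \<forall>y'\<in>cball (y1 a) r. \<forall>w w'. norm w \<le> R \<longrightarrow> norm w' \<le> R \<longrightarrow>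
      norm (\<Gamma> y w w - \<Gamma> y' w' w') \<le> L * (norm (y - y') + norm (w - w'))"
    by blast
  then obtain L where L: "0 \<le> L" and lip: "\<forall>y\<in>cball (y1 a) r. \<forall>y'\<in>cball (y1 a) r. \<forall>w w'. norm w \<le> R \<longrightarrow> norm w' \<le> R \<longrightarrow>
      norm (\<Gamma> y w w - \<Gamma> y' w' w') \<le> L * (norm (y - y') + norm (w - w'))"
    by blast
  have near: "\<exists>d>0. \<forall>t\<in>{a..b}. \<bar>t - a\<bar> < d \<longrightarrow> dist (f t) (f a) < \<epsilon>"
    if "continuous_on {a..b} f" "0 < \<epsilon>" for f :: "real \<Rightarrow> real^'n" and \<epsilon>
    using that \<open>a < b\<close> unfolding continuous_on_iff dist_real_def by (meson atLeastAtMost_iff less_imp_le order_refl)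
  obtain d1 where d1: "0 < d1" "\<forall>t\<in>{a..b}. \<bar>t - a\<bar> < d1 \<longrightarrow> dist (y1 t) (y1 a) < r"
    using near[OF cont(1) r(1)] by blast
  obtain d2 where d2: "0 < d2" "\<forall>t\<in>{a..b}. \<bar>t - a\<bar> < d2 \<longrightarrow> dist (y2 t) (y2 a) < r"
    using near[OF cont(2) r(1)] by blast
  obtain d3 where d3: "0 < d3" "\<forall>t\<in>{a..b}. \<bar>t - a\<bar> < d3 \<longrightarrow> dist (w1 t) (w1 a) < 1"
    using near[OF cont(3) zero_less_one] by blast
  obtain d4 where d4: "0 < d4" "\<forall>t\<in>{a..b}. \<bar>t - a\<bar> < d4 \<longrightarrow> dist (w2 t) (w2 a) < 1"
    using near[OF cont(4) zero_less_one] by blast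
  note d = d1(1) d2(1) d3(1) d4(1)
  define e where "e = min b (a + min (min d1 d2) (min d3 d4) / 2)"
  have e: "a < e" "e \<le> b" using d(1-4) \<open>a < b\<close> by (auto simp: e_def)
  have bds: "y1 t \<in> cball (y1 a) r" "y2 t \<in> cball (y1 a) r" "norm (w1 t) \<le> R" "norm (w2 t) \<le> R" if "t \<in> {a..e}" for t
  proof -
    have t: "t \<in> {a..b}" "\<bar>t - a\<bar> < d1" "\<bar>t - a\<bar> < d2" "\<bar>t - a\<bar> < d3" "\<bar>t - a\<bar> < d4"
      using that e d(1-4) by (auto simp: e_def)
    show "y1 t \<in> cball (y1 a) r" "y2 t \<in> cball (y1 a) r"
      using d1(2)[rule_format, OF t(1,2)] d2(2)[rule_format, OF t(1,3)] init(2) by (auto simp: dist_commute)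
    show "norm (w1 t) \<le> R" "norm (w2 t) \<le> R"
      using d3(2)[rule_format, OF t(1,4)] d4(2)[rule_format, OF t(1,5)] init(3) norm_triangle_sub[of "w1 t" "w1 a"] norm_triangle_sub[of "w2 t" "w2 a"]
      by (auto simp: R_def dist_norm)
  qed
  let ?y = "\<lambda>t. y1 t - y2 t" and ?w = "\<lambda>t. w1 t - w2 t"
  define u where "u = (\<lambda>t. ?y t \<bullet> ?y t + ?w t \<bullet> ?w t)"
  \<comment> \<open>The estimate below yields u' \<le> (1 + 3 L) u, the 1 + L coming from the mixed
    product by 2 A B \<le> A^2 + B^2; the chosen constant exceeds this.\<close>
  define C where "C = 2 + 3 * L"
  let ?f = "\<lambda>t. exp (- C * t) * u t"
  have contu: "continuous_on {a..e} ?f"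
    unfolding u_def using e by (intro continuous_intros continuous_on_subset[OF cont(1)] continuous_on_subset[OF cont(2)]
      continuous_on_subset[OF cont(3)] continuous_on_subset[OF cont(4)]) auto
  have "?f t \<le> ?f a" if t: "t \<in> {a..e}" for t
  proof (rule DERIV_nonpos_imp_decreasing_open[where f="?f"])
    show "a \<le> t" using t by simp
    show "continuous_on {a..t} ?f" using contu t by (auto intro: continuous_on_subset)
    fix s assume s: "a < s" "s < t"
    have at: "at s within {a..b} = at s" using s t e by (intro at_within_Icc_at) auto
    have sb: "s \<in> {a..b}" and se: "s \<in> {a..e}" using s t e by auto
    have dy: "(?y has_vector_derivative ?w s) (at s)"
      using has_vector_derivative_diff[OF y1[OF sb] y2[OF sb]] at by simp
    let ?G = "\<Gamma> (y1 s) (w1 s) (w1 s) - \<Gamma> (y2 s) (w2 s) (w2 s)"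
    have dw: "(?w has_vector_derivative - ?G) (at s)"
      using has_vector_derivative_diff[OF w1[OF sb] w2[OF sb]] at by simp
    have du: "(u has_real_derivative 2 * (?y s \<bullet> ?w s) - 2 * (?w s \<bullet> ?G)) (at s)"
      unfolding u_def has_real_derivative_iff_has_vector_derivative
      by (rule has_vector_derivative_eq_rhs[OF has_vector_derivative_add
          [OF bounded_bilinear.has_vector_derivative[OF bounded_bilinear_inner dy dy]
            bounded_bilinear.has_vector_derivative[OF bounded_bilinear_inner dw dw]]])
        (simp add: inner_commute inner_diff_right algebra_simps)
    let ?A = "norm (?y s)" and ?B = "norm (?w s)"
    have "2 * (?y s \<bullet> ?w s) - 2 * (?w s \<bullet> ?G) \<le> 2 * (?A * ?B) + 2 * (?B * norm ?G)"
      using Cauchy_Schwarz_ineq2[of "?y s" "?w s"] Cauchy_Schwarz_ineq2[of "?w s" ?G] by (simp add: abs_le_iff)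
    also have "\<dots> \<le> 2 * (?A * ?B) + 2 * (?B * (L * (?A + ?B)))"
      using lip[rule_format, OF bds[OF se]] by (intro add_left_mono mult_left_mono) auto
    also have "\<dots> = (2 + 2 * L) * (?A * ?B) + 2 * L * ?B\<^sup>2"
      by (simp add: algebra_simps power2_eq_square)
    also have "\<dots> \<le> (2 + 2 * L) * (?A\<^sup>2 + ?B\<^sup>2) / 2 + 2 * L * (?A\<^sup>2 + ?B\<^sup>2)"
    proof -
      have "?A * ?B \<le> (?A\<^sup>2 + ?B\<^sup>2) / 2"
        using sum_squares_bound[of ?A ?B] by simp
      then have "(2 + 2 * L) * (?A * ?B) \<le> (2 + 2 * L) * ((?A\<^sup>2 + ?B\<^sup>2) / 2)"
        using L by (intro mult_left_mono) auto
      moreover have "2 * L * ?B\<^sup>2 \<le> 2 * L * (?A\<^sup>2 + ?B\<^sup>2)"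
        using L by (intro mult_left_mono) auto
      ultimately show ?thesis by simp
    qed
    also have "\<dots> \<le> C * u s"
      using L by (simp add: u_def C_def dot_square_norm algebra_simps)
    finally have le: "2 * (?y s \<bullet> ?w s) - 2 * (?w s \<bullet> ?G) \<le> C * u s" .
    have "(?f has_real_derivative exp (- C * s) * (2 * (?y s \<bullet> ?w s) - 2 * (?w s \<bullet> ?G) - C * u s)) (at s)"
      by (rule derivative_eq_intros du refl | simp add: algebra_simps)+
    moreover have "exp (- C * s) * (2 * (?y s \<bullet> ?w s) - 2 * (?w s \<bullet> ?G) - C * u s) \<le> 0"
      using le by (simp add: mult_le_0_iff)
    ultimately show "\<exists>D. (?f has_real_derivative D) (at s) \<and> D \<le> 0" by blast
  qed
  moreover have "u a = 0" using init by (simp add: u_def)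
  ultimately have "u t \<le> 0" if "t \<in> {a..e}" for t
    using that by (simp add: mult_le_0_iff)
  then have "y1 t = y2 t" if "t \<in> {a..e}" for t
    using that inner_ge_zero[of "?y t"] inner_ge_zero[of "?w t"] unfolding u_def
    by (metis add_nonneg_eq_0_iff antisym_conv add_nonneg_nonneg inner_eq_zero_iff right_minus_eq)
  then show ?thesis using e by blast
qed

end

section \<open>Geodesics and the exponential map\<close>

lemma has_vector_derivative_affine:
  fixes f :: "real \<Rightarrow> 'b::real_normed_vector"
  assumes f: "(f has_vector_derivative f') (at (a + b * s) within {0..1})"
    and ab: "\<And>s. s \<in> {0..1} \<Longrightarrow> a + b * s \<in> {0..1}"
  shows "((\<lambda>s. f (a + b * s)) has_vector_derivative b *\<^sub>R f') (at s within {0..1})"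
proof -
  have 1: "((\<lambda>s. a + b * s) has_vector_derivative b) (at s within {0..1})"
    by (auto intro!: derivative_eq_intros)
  have 2: "(f has_vector_derivative f') (at (a + b * s) within (\<lambda>s. a + b * s) ` {0..1})"
    by (rule has_vector_derivative_within_subset[OF f]) (use ab in blast)
  from vector_diff_chain_within[OF 1 2] show ?thesis by (simp add: o_def)
qed

lemma vector_derivative_unique_Icc:
  fixes a b :: real
  assumes "a < b" "x \<in> {a..b}"
    and "(f has_vector_derivative f') (at x within {a..b})" "(f has_vector_derivative f'') (at x within {a..b})"
  shows "f' = f''"
  using vector_derivative_unique_within_closed_interval[of a b x f f' f''] assms by simp

lemma affine_unit_interval:
  fixes a b s :: real
  assumes "a \<in> {0..1}" "a + b \<in> {0..1}" "s \<in> {0..1}"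
  shows "a + b * s \<in> {0..1}"
proof -
  have "a + b * s = (1 - s) * a + s * (a + b)" by (simp add: algebra_simps)
  moreover have "(1 - s) * a + s * (a + b) \<ge> 0" using assms by auto
  moreover have "(1 - s) * a + s * (a + b) \<le> (1 - s) * 1 + s * 1"
    using assms by (intro add_mono mult_left_mono) auto
  ultimately show ?thesis by simp
qed

section \<open>Charts, transition maps and paths\<close>

locale riem =
  fixes M :: "('a, 'n::finite) riemannian"
  assumes rm: "riemannian_manifold M"
begin

lemma manifold: "smooth_manifold M"
  using rm by (simp add: riemannian_manifold_def)

lemma hausdorff: "Hausdorff_space (top_of M)" and second_countable: "second_countable (top_of M)"
  using manifold by (simp_all add: smooth_manifold_def)

lemma dom_open: "c \<in> atlas M \<Longrightarrow> openin (top_of M) (chart_dom c)"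
  and img_open: "c \<in> atlas M \<Longrightarrow> open (chart_map c ` chart_dom c)"
  and chart_homeo: "c \<in> atlas M \<Longrightarrow> homeomorphic_map (subtopology (top_of M) (chart_dom c))
          (top_of_set (chart_map c ` chart_dom c)) (chart_map c)"
  using manifold unfolding smooth_manifold_def by blast+

lemma dom_sub: "c \<in> atlas M \<Longrightarrow> chart_dom c \<subseteq> points M"
  by (rule openin_subset[OF dom_open])

lemma chart_at:
  assumes "x \<in> points M"
  shows "chart_at M x \<in> atlas M" "x \<in> chart_dom (chart_at M x)"
proof -
  have "\<exists>c. c \<in> atlas M \<and> x \<in> chart_dom c"
    using manifold assms unfolding smooth_manifold_def by blast
  from someI_ex[OF this] show "chart_at M x \<in> atlas M" "x \<in> chart_dom (chart_at M x)"
    by (simp_all add: chart_at_def)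
qed

lemma chart_inj: "c \<in> atlas M \<Longrightarrow> inj_on (chart_map c) (chart_dom c)"
  using homeomorphic_imp_injective_map[OF chart_homeo[of c]] dom_sub[of c] by (simp add: Int_absorb1)

lemma chart_inv_left: "c \<in> atlas M \<Longrightarrow> x \<in> chart_dom c \<Longrightarrow> chart_inv c (chart_map c x) = x"
  by (simp add: chart_inv_def chart_inj)

lemma chart_image_open:
  assumes c: "c \<in> atlas M" and U: "openin (top_of M) U" "U \<subseteq> chart_dom c"
  shows "open (chart_map c ` U)"
proof -
  have "openin (subtopology (top_of M) (chart_dom c)) U"
    using U by (simp add: openin_open_subtopology dom_open[OF c])
  then have "openin (top_of_set (chart_map c ` chart_dom c)) (chart_map c ` U)"
    using homeomorphic_imp_open_map[OF chart_homeo[OF c]] by (simp add: open_map_def)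
  then show ?thesis
    using openin_open_trans[OF _ img_open[OF c]] by blast
qed

lemma metric_chart: "c \<in> atlas M \<Longrightarrow> metric_chart M c"
  using rm img_open unfolding metric_chart_def riemannian_manifold_def by blast

abbreviation "Inn c \<equiv> metric_chart.inn M c"
abbreviation "Chr c \<equiv> metric_chart.\<Gamma> M c"

lemmas inn_def = metric_chart.inn_def[OF metric_chart]

lemma metric_at_eq:
  "x \<in> points M \<Longrightarrow> metric_at M x u v = Inn (chart_at M x) (chart_map (chart_at M x) x) u v"
  by (simp add: metric_at_def inn_def chart_at)

lemma metric_at_nonneg: "x \<in> points M \<Longrightarrow> 0 \<le> metric_at M x u u"
  by (simp add: metric_at_eq metric_chart.inn_nonneg[OF metric_chart] chart_at)

lemma transition_derivative:
  assumes "c \<in> atlas M" "c' \<in> atlas M" "x \<in> chart_dom c" "x \<in> chart_dom c'"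
  shows "(transition c c' has_derivative frechet_derivative (transition c c') (at (chart_map c x))) (at (chart_map c x))"
proof -
  have "smooth_on (chart_map c ` (chart_dom c \<inter> chart_dom c')) (transition c c')"
    using manifold assms unfolding smooth_manifold_def by blast
  from smooth_onD(1)[OF this, of "chart_map c x"] show ?thesis
    using assms by (simp add: frechet_derivative_works)
qed

lemma gcoeff_change:
  assumes "c \<in> atlas M" "c' \<in> atlas M" "x \<in> chart_dom c" "x \<in> chart_dom c'"
  shows "gcoeff M c (chart_map c x) =
    transpose (jacobian_matrix (transition c c') (chart_map c x)) ** gcoeff M c' (chart_map c' x)
      ** jacobian_matrix (transition c c') (chart_map c x)"
proof -
  have "chart_map c x \<in> chart_map c ` (chart_dom c \<inter> chart_dom c')" using assms by blast
  moreover have "transition c c' (chart_map c x) = chart_map c' x"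
    using assms by (simp add: transition_def chart_inv_left)
  moreover have "\<forall>y\<in>chart_map c ` (chart_dom c \<inter> chart_dom c'). gcoeff M c y =
      transpose (jacobian_matrix (transition c c') y) ** gcoeff M c' (transition c c' y)
        ** jacobian_matrix (transition c c') y"
    using rm assms(1,2) unfolding riemannian_manifold_def by blast
  ultimately show ?thesis by (metis (no_types, lifting))
qed

text \<open>The transformation law of the coefficients says precisely that the differential of the
  transition map is an isometry between the two coordinate metrics.\<close>

lemma inn_change:
  assumes "c \<in> atlas M" "c' \<in> atlas M" "x \<in> chart_dom c" "x \<in> chart_dom c'"
  shows "Inn c (chart_map c x) u v = Inn c' (chart_map c' x)
    (frechet_derivative (transition c c') (at (chart_map c x)) u) (frechet_derivative (transition c c') (at (chart_map c x)) v)"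
proof -
  let ?D = "frechet_derivative (transition c c') (at (chart_map c x))"
  let ?J = "jacobian_matrix (transition c c') (chart_map c x)"
  have lin: "linear ?D" by (rule has_derivative_linear[OF transition_derivative[OF assms]])
  have J: "?J *v u = ?D u" for u
    unfolding jacobian_matrix_def by (rule fun_cong[OF matrix_vector_mul(2)[OF lin]])
  have "u \<bullet> (gcoeff M c (chart_map c x) *v v) = u \<bullet> (transpose ?J *v (gcoeff M c' (chart_map c' x) *v (?J *v v)))"
    unfolding gcoeff_change[OF assms] by (simp only: matrix_vector_mul_assoc[symmetric])
  also have "\<dots> = (?J *v u) \<bullet> (gcoeff M c' (chart_map c' x) *v (?J *v v))"
    by (metis dot_lmul_matrix vector_transpose_matrix)
  finally show ?thesis
    unfolding inn_def[OF assms(1)] inn_def[OF assms(2)] J .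
qed

lemma path_near:
  assumes \<gamma>: "pathin (top_of M) \<gamma>" and U: "openin (top_of M) U" and t: "t \<in> {0..1}" "\<gamma> t \<in> U"
  shows "\<exists>d>0. \<forall>s\<in>{0..1}. \<bar>s - t\<bar> < d \<longrightarrow> \<gamma> s \<in> U"
proof -
  have "openin (top_of_set {0..1}) {s \<in> topspace (top_of_set {0..1}). \<gamma> s \<in> U}"
    using \<gamma> unfolding pathin_def by (rule openin_continuous_map_preimage) (rule U)
  then have "openin (top_of_set {0..1}) {s \<in> {0..1}. \<gamma> s \<in> U}" by simp
  then have "\<exists>e>0. \<forall>s\<in>{0..1}. dist s t < e \<longrightarrow> s \<in> {s \<in> {0..1}. \<gamma> s \<in> U}"
    using t unfolding openin_euclidean_subtopology_iff by blast
  then show ?thesis by (simp add: dist_real_def)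
qed

lemma path_points: "pathin (top_of M) \<gamma> \<Longrightarrow> t \<in> {0..1} \<Longrightarrow> \<gamma> t \<in> points M"
  unfolding pathin_def continuous_map_def by auto

section \<open>Geodesics on the manifold\<close>

lemma geodesicD:
  assumes "geodesic M \<gamma>" "c \<in> atlas M"
  obtains w where "\<And>t. t \<in> {0..1} \<Longrightarrow> \<gamma> t \<in> chart_dom c \<Longrightarrow>
      ((\<lambda>t. chart_map c (\<gamma> t)) has_vector_derivative w t) (at t within {0..1})"
    "\<And>t. t \<in> {0..1} \<Longrightarrow> \<gamma> t \<in> chart_dom c \<Longrightarrow>
      (w has_vector_derivative - Chr c (chart_map c (\<gamma> t)) (w t) (w t)) (at t within {0..1})"
proof -
  have G: "(\<chi> k. - (\<Sum>i\<in>UNIV. \<Sum>j\<in>UNIV. christoffel M c k i j y * v $ i * v $ j)) = - Chr c y v v" for y v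
    unfolding metric_chart.\<Gamma>_def[OF metric_chart[OF assms(2)]] metric_chart.chris_def[OF metric_chart[OF assms(2)]]
    by (simp add: vec_eq_iff mult_ac)
  have "\<exists>w. \<forall>t\<in>{0..1}. \<gamma> t \<in> chart_dom c \<longrightarrow>
        ((chart_map c \<circ> \<gamma>) has_vector_derivative w t) (at t within {0..1}) \<and>
        (w has_vector_derivative - Chr c (chart_map c (\<gamma> t)) (w t) (w t)) (at t within {0..1})"
    by (rule bspec[OF conjunct2[OF assms(1)[unfolded geodesic_def]] assms(2), unfolded G])
  then obtain w where "\<forall>t\<in>{0..1}. \<gamma> t \<in> chart_dom c \<longrightarrow>
        ((chart_map c \<circ> \<gamma>) has_vector_derivative w t) (at t within {0..1}) \<and>
        (w has_vector_derivative - Chr c (chart_map c (\<gamma> t)) (w t) (w t)) (at t within {0..1})" ..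
  then show ?thesis using that[of w] unfolding o_def by blast
qed

lemma geodesic_path: "geodesic M \<gamma> \<Longrightarrow> pathin (top_of M) \<gamma>"
  by (simp add: geodesic_def)

text \<open>The geodesic equation is quadratic in the velocity, so a change of parameter with slope
  \<open>b\<close> multiplies both sides by b^2. Slopes between 0 and 1 give the scaling of initial
  velocities; slope -1 reverses a geodesic.\<close>

lemma geodesic_affine:
  assumes \<gamma>: "geodesic M \<gamma>" and ab: "a \<in> {0..1}" "a + b \<in> {0..1}"
  shows "geodesic M (\<lambda>s. \<gamma> (a + b * s))"
  unfolding geodesic_def
proof (intro conjI ballI)
  note ab' = affine_unit_interval[OF ab]
  have "continuous_map (top_of_set {0..1}) (top_of_set {0..1}) (\<lambda>s. a + b * s)"
    using ab' by (auto simp: continuous_map_in_subtopology intro!: continuous_intros)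
  from continuous_map_compose[OF this geodesic_path[OF \<gamma>, unfolded pathin_def]]
  show "pathin (top_of M) (\<lambda>s. \<gamma> (a + b * s))" by (simp add: pathin_def o_def)
  fix c assume c: "c \<in> atlas M"
  obtain w where w: "\<And>t. t \<in> {0..1} \<Longrightarrow> \<gamma> t \<in> chart_dom c \<Longrightarrow>
      ((\<lambda>t. chart_map c (\<gamma> t)) has_vector_derivative w t) (at t within {0..1})"
    "\<And>t. t \<in> {0..1} \<Longrightarrow> \<gamma> t \<in> chart_dom c \<Longrightarrow>
      (w has_vector_derivative - Chr c (chart_map c (\<gamma> t)) (w t) (w t)) (at t within {0..1})"
    using geodesicD[OF \<gamma> c] by blast
  have G: "(\<chi> k. - (\<Sum>i\<in>UNIV. \<Sum>j\<in>UNIV. christoffel M c k i j y * (b *\<^sub>R v) $ i * (b *\<^sub>R v) $ j))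
      = b *\<^sub>R (b *\<^sub>R - Chr c y v v)" for y v
    unfolding metric_chart.\<Gamma>_def[OF metric_chart[OF c]] metric_chart.chris_def[OF metric_chart[OF c]]
    by (simp add: vec_eq_iff sum_distrib_left mult_ac)
  show "\<exists>w. \<forall>t\<in>{0..1}. \<gamma> (a + b * t) \<in> chart_dom c \<longrightarrow>
        ((chart_map c \<circ> (\<lambda>s. \<gamma> (a + b * s))) has_vector_derivative w t) (at t within {0..1}) \<and>
        (w has_vector_derivative (\<chi> k. - (\<Sum>i\<in>UNIV. \<Sum>j\<in>UNIV.
              christoffel M c k i j (chart_map c (\<gamma> (a + b * t))) * w t $ i * w t $ j))) (at t within {0..1})"
  proof (rule exI[of _ "\<lambda>s. b *\<^sub>R w (a + b * s)"], intro ballI impI conjI)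
    fix s :: real assume s: "s \<in> {0..1}" "\<gamma> (a + b * s) \<in> chart_dom c"
    show "((chart_map c \<circ> (\<lambda>s. \<gamma> (a + b * s))) has_vector_derivative b *\<^sub>R w (a + b * s)) (at s within {0..1})"
      using has_vector_derivative_affine[OF w(1)[OF ab'[OF s(1)] s(2)] ab'] by (simp add: o_def)
    show "((\<lambda>s. b *\<^sub>R w (a + b * s)) has_vector_derivative (\<chi> k. - (\<Sum>i\<in>UNIV. \<Sum>j\<in>UNIV.
        christoffel M c k i j (chart_map c (\<gamma> (a + b * s))) * (b *\<^sub>R w (a + b * s)) $ i * (b *\<^sub>R w (a + b * s)) $ j)))
        (at s within {0..1})"
      unfolding G
      by (rule bounded_linear.has_vector_derivative[OF bounded_linear_scaleR_right
          has_vector_derivative_affine[OF w(2)[OF ab'[OF s(1)] s(2)] ab']])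
  qed
qed

text \<open>Continuation: let \<open>T\<close> be the supremum of the times up to which the curves
  agree. They agree at \<open>T\<close> because the space is Hausdorff, their velocities agree there
  too, and local uniqueness in a chart around the common point carries the agreement beyond
  \<open>T\<close> unless T = 1.\<close>

lemma geodesic_unique:
  assumes x: "x \<in> points M" and g1: "geodesic_from M x v \<gamma>1" and g2: "geodesic_from M x v \<gamma>2" and t: "t \<in> {0..1}"
  shows "\<gamma>1 t = \<gamma>2 t"
proof -
  have geo: "geodesic M \<gamma>1" "geodesic M \<gamma>2" and start: "\<gamma>1 0 = x" "\<gamma>2 0 = x"
    using g1 g2 by (simp_all add: geodesic_from_def)
  note p1 = geodesic_path[OF geo(1)] and p2 = geodesic_path[OF geo(2)]
  define A where "A = {t \<in> {0..1::real}. \<forall>s\<in>{0..t}. \<gamma>1 s = \<gamma>2 s}"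
  have A0: "0 \<in> A" using start by (simp add: A_def)
  have bdd: "bdd_above A" by (rule bdd_aboveI[of _ 1]) (simp add: A_def)
  define T where "T = Sup A"
  have "0 \<le> T" unfolding T_def by (rule cSup_upper[OF A0 bdd])
  moreover have "T \<le> 1" unfolding T_def by (rule cSup_least) (use A0 in blast, simp add: A_def)
  ultimately have T: "T \<in> {0..1}" by simp
  have below: "\<gamma>1 s = \<gamma>2 s" if s: "0 \<le> s" "s < T" for s
  proof -
    obtain a where a: "a \<in> A" "s < a" using less_cSupD[of A s] A0 s by (auto simp: T_def)
    then show ?thesis using s by (auto simp: A_def)
  qed
  have atT: "\<gamma>1 T = \<gamma>2 T"
  proof (rule ccontr)
    assume ne: "\<gamma>1 T \<noteq> \<gamma>2 T"
    then have "T \<noteq> 0" using start by auto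
    then have T0: "0 < T" using T by simp
    obtain U V where UV: "openin (top_of M) U" "openin (top_of M) V" "\<gamma>1 T \<in> U" "\<gamma>2 T \<in> V" "disjnt U V"
      using hausdorff ne path_points[OF p1 T] path_points[OF p2 T] unfolding Hausdorff_space_def by blast
    obtain d1 where d1: "d1 > 0" "\<forall>s\<in>{0..1}. \<bar>s - T\<bar> < d1 \<longrightarrow> \<gamma>1 s \<in> U"
      using path_near[OF p1 UV(1) T UV(3)] by blast
    obtain d2 where d2: "d2 > 0" "\<forall>s\<in>{0..1}. \<bar>s - T\<bar> < d2 \<longrightarrow> \<gamma>2 s \<in> V"
      using path_near[OF p2 UV(2) T UV(4)] by blast
    define s where "s = T - min T (min d1 d2) / 2"
    have s: "0 \<le> s" "s < T" "\<bar>s - T\<bar> < d1" "\<bar>s - T\<bar> < d2" "s \<in> {0..1}"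
      using T0 T d1 d2 by (auto simp: s_def min_def)
    show False
      using below[OF s(1,2)] d1(2)[rule_format, OF s(5,3)] d2(2)[rule_format, OF s(5,4)] UV(5)
      by (auto simp: disjnt_def)
  qed
  have TA: "T \<in> A" using T below atT unfolding A_def by (auto simp: order_le_less)
  have "T = 1"
  proof (rule ccontr)
    assume "T \<noteq> 1"
    then have T1: "T < 1" using T by simp
    define c where "c = chart_at M (\<gamma>1 T)"
    have c: "c \<in> atlas M" "\<gamma>1 T \<in> chart_dom c" "\<gamma>2 T \<in> chart_dom c"
      using chart_at[OF path_points[OF p1 T]] atT by (simp_all add: c_def)
    obtain w1 where w1: "\<And>t. t \<in> {0..1} \<Longrightarrow> \<gamma>1 t \<in> chart_dom c \<Longrightarrow>
        ((\<lambda>t. chart_map c (\<gamma>1 t)) has_vector_derivative w1 t) (at t within {0..1})"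
      "\<And>t. t \<in> {0..1} \<Longrightarrow> \<gamma>1 t \<in> chart_dom c \<Longrightarrow>
        (w1 has_vector_derivative - Chr c (chart_map c (\<gamma>1 t)) (w1 t) (w1 t)) (at t within {0..1})"
      using geodesicD[OF geo(1) c(1)] by blast
    obtain w2 where w2: "\<And>t. t \<in> {0..1} \<Longrightarrow> \<gamma>2 t \<in> chart_dom c \<Longrightarrow>
        ((\<lambda>t. chart_map c (\<gamma>2 t)) has_vector_derivative w2 t) (at t within {0..1})"
      "\<And>t. t \<in> {0..1} \<Longrightarrow> \<gamma>2 t \<in> chart_dom c \<Longrightarrow>
        (w2 has_vector_derivative - Chr c (chart_map c (\<gamma>2 t)) (w2 t) (w2 t)) (at t within {0..1})"
      using geodesicD[OF geo(2) c(1)] by blast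
    \<comment> \<open>At T = 0 the velocities agree by the initial condition, which is stated in the
      very chart \<open>c\<close>; at T > 0 they are left derivatives of curves that coincide up to
      \<open>T\<close>.\<close>
    have wT: "w1 T = w2 T"
    proof (cases "T = 0")
      case True
      have "c = chart_at M x" using start True by (simp add: c_def)
      then have v: "((\<lambda>t. chart_map c (\<gamma>1 t)) has_vector_derivative v) (at T within {0..1})"
        "((\<lambda>t. chart_map c (\<gamma>2 t)) has_vector_derivative v) (at T within {0..1})"
        using g1 g2 True by (simp_all add: geodesic_from_def o_def)
      have "w1 T = v" "w2 T = v"
        by (rule vector_derivative_unique_Icc[OF zero_less_one _ w1(1)[OF T c(2)] v(1)], use T in simp)
          (rule vector_derivative_unique_Icc[OF zero_less_one _ w2(1)[OF T c(3)] v(2)], use T in simp)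
      then show ?thesis by simp
    next
      case False
      then have T0: "0 < T" using T by simp
      have sub: "{0..T} \<subseteq> {0..1}" using T by auto
      have 1: "((\<lambda>t. chart_map c (\<gamma>1 t)) has_vector_derivative w1 T) (at T within {0..T})"
        by (rule has_vector_derivative_within_subset[OF w1(1)[OF T c(2)] sub])
      have 2: "((\<lambda>t. chart_map c (\<gamma>2 t)) has_vector_derivative w2 T) (at T within {0..T})"
        by (rule has_vector_derivative_within_subset[OF w2(1)[OF T c(3)] sub])
      have 3: "((\<lambda>t. chart_map c (\<gamma>1 t)) has_vector_derivative w2 T) (at T within {0..T})"
        by (rule has_vector_derivative_transform[OF _ _ 2]) (use TA T0 in \<open>auto simp: A_def\<close>)
      show ?thesis
        by (rule vector_derivative_unique_Icc[OF T0 _ 1 3]) (use T0 in simp)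
    qed
    obtain d1 where d1: "d1 > 0" "\<forall>s\<in>{0..1}. \<bar>s - T\<bar> < d1 \<longrightarrow> \<gamma>1 s \<in> chart_dom c"
      using path_near[OF p1 dom_open[OF c(1)] T c(2)] by blast
    obtain d2 where d2: "d2 > 0" "\<forall>s\<in>{0..1}. \<bar>s - T\<bar> < d2 \<longrightarrow> \<gamma>2 s \<in> chart_dom c"
      using path_near[OF p2 dom_open[OF c(1)] T c(3)] by blast
    define b where "b = min 1 (T + min d1 d2 / 2)"
    have b: "T < b" "b \<le> 1" using T1 d1 d2 by (auto simp: b_def)
    have sub: "{T..b} \<subseteq> {0..1}" using T b by auto
    have inb: "t \<in> {0..1}" "\<gamma>1 t \<in> chart_dom c" "\<gamma>2 t \<in> chart_dom c" if "t \<in> {T..b}" for t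
    proof -
      have t: "t \<in> {0..1}" "\<bar>t - T\<bar> < d1" "\<bar>t - T\<bar> < d2"
        using that sub d1(1) d2(1) by (auto simp: b_def)
      show "t \<in> {0..1}" "\<gamma>1 t \<in> chart_dom c" "\<gamma>2 t \<in> chart_dom c"
        using t d1(2) d2(2) by blast+
    qed
    have "\<exists>e>T. e \<le> b \<and> (\<forall>t\<in>{T..e}. chart_map c (\<gamma>1 t) = chart_map c (\<gamma>2 t))"
    proof (rule metric_chart.geodesic_local_unique[OF metric_chart[OF c(1)] b(1)])
      show "((\<lambda>t. chart_map c (\<gamma>1 t)) has_vector_derivative w1 t) (at t within {T..b})" if "t \<in> {T..b}" for t
        by (rule has_vector_derivative_within_subset[OF w1(1)[OF inb(1,2)[OF that]] sub])
      show "((\<lambda>t. chart_map c (\<gamma>2 t)) has_vector_derivative w2 t) (at t within {T..b})" if "t \<in> {T..b}" for t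
        by (rule has_vector_derivative_within_subset[OF w2(1)[OF inb(1,3)[OF that]] sub])
      show "(w1 has_vector_derivative - Chr c (chart_map c (\<gamma>1 t)) (w1 t) (w1 t)) (at t within {T..b})" if "t \<in> {T..b}" for t
        by (rule has_vector_derivative_within_subset[OF w1(2)[OF inb(1,2)[OF that]] sub])
      show "(w2 has_vector_derivative - Chr c (chart_map c (\<gamma>2 t)) (w2 t) (w2 t)) (at t within {T..b})" if "t \<in> {T..b}" for t
        by (rule has_vector_derivative_within_subset[OF w2(2)[OF inb(1,3)[OF that]] sub])
    qed (use c atT wT in auto)
    then obtain e where e: "T < e" "e \<le> b" "\<And>t. t \<in> {T..e} \<Longrightarrow> chart_map c (\<gamma>1 t) = chart_map c (\<gamma>2 t)" by blast
    have "\<gamma>1 t = \<gamma>2 t" if "t \<in> {T..e}" for t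
    proof (rule inj_onD[OF chart_inj[OF c(1)] e(3)[OF that]])
      show "\<gamma>1 t \<in> chart_dom c" "\<gamma>2 t \<in> chart_dom c" using inb(2,3)[of t] that e by auto
    qed
    then have "\<gamma>1 s = \<gamma>2 s" if "s \<in> {0..e}" for s
      using TA that by (cases "s \<le> T") (simp_all add: A_def)
    then have "e \<in> A" using e b T by (simp add: A_def)
    then have "e \<le> T" unfolding T_def by (rule cSup_upper[OF _ bdd])
    then show False using e by simp
  qed
  then show ?thesis using TA t by (auto simp: A_def)
qed

lemma geodesic_from_scale:
  assumes \<gamma>: "geodesic_from M x v \<gamma>" and t: "t \<in> {0..1}"
  shows "geodesic_from M x (t *\<^sub>R v) (\<lambda>s. \<gamma> (t * s))"
proof -
  have g: "geodesic M \<gamma>" "\<gamma> 0 = x" "((chart_map (chart_at M x) \<circ> \<gamma>) has_vector_derivative v) (at 0 within {0..1})"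
    using \<gamma> by (simp_all add: geodesic_from_def)
  have "((\<lambda>s. (chart_map (chart_at M x) \<circ> \<gamma>) (0 + t * s)) has_vector_derivative t *\<^sub>R v) (at 0 within {0..1})"
    by (rule has_vector_derivative_affine) (use g(3) affine_unit_interval[of 0 t] t in \<open>auto simp: o_def\<close>)
  then show ?thesis
    using geodesic_affine[OF g(1), of 0 t] t g(2) by (simp add: geodesic_from_def o_def)
qed

text \<open>Uniqueness of geodesics is what gives the definite description \<open>riem_exp\<close>
  its value; rescaling the parameter then identifies a whole radial segment with one
  geodesic.\<close>

lemma riem_exp_geodesic:
  assumes x: "x \<in> points M" and \<gamma>: "geodesic_from M x v \<gamma>" and t: "t \<in> {0..1}"
  shows "riem_exp M x (t *\<^sub>R v) = \<gamma> t"
  unfolding riem_exp_def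
proof (rule the_equality)
  note s = geodesic_from_scale[OF \<gamma> t]
  show "\<exists>\<gamma>'. geodesic_from M x (t *\<^sub>R v) \<gamma>' \<and> \<gamma>' 1 = \<gamma> t" using s by force
  fix y assume "\<exists>\<gamma>'. geodesic_from M x (t *\<^sub>R v) \<gamma>' \<and> \<gamma>' 1 = y"
  then show "y = \<gamma> t" using geodesic_unique[OF x s, of _ 1] by force
qed

end

section \<open>Jacobi fields\<close>

text \<open>
  Here \<open>q\<close> is the square of a function \<open>f\<close> with \<open>f'' \<ge> -m f\<close>, compared with \<open>u(t) = t - m t\<^sup>3/6\<close>, which
  satisfies \<open>u'' \<le> -m u\<close> and is at least \<open>5t/6\<close>. The Wronskian \<open>\<phi> = f' u - f u'\<close> is nondecreasing; if it were
  negative somewhere, then \<open>f/u\<close>, whose derivative is \<open>\<phi>/u\<^sup>2\<close>, would be unbounded at \<open>0\<close>. So \<open>f/u\<close> is nondecreasing.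
\<close>

lemma sturm_comparison:
  fixes q p :: "real \<Rightarrow> real"
  assumes m: "0 \<le> m" "m \<le> 1"
    and q: "\<And>t. 0 < t \<Longrightarrow> t < 1 \<Longrightarrow> 0 < q t"
    and dq: "\<And>t. 0 < t \<Longrightarrow> t < 1 \<Longrightarrow> (q has_real_derivative 2 * p t) (at t)"
    and dp: "\<And>t. 0 < t \<Longrightarrow> t < 1 \<Longrightarrow> \<exists>p'. (p has_real_derivative p') (at t) \<and> (p t)\<^sup>2 - m * (q t)\<^sup>2 \<le> p' * q t"
    and lim0: "((\<lambda>t. q t / t\<^sup>2) \<longlongrightarrow> l) (at_right 0)" and l: "0 \<le> l"
    and lim1: "(q \<longlongrightarrow> q1) (at_left 1)"
  shows "25 / 36 * l \<le> q1"
proof -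
  \<comment> \<open>With q = f^2 one has p = f f' and p' q - p^2 = f^3 f'', so the hypothesis on p'
    is the inequality f'' \<ge> -m f multiplied by f^3, which makes it free of square roots.\<close>
  define f where "f t = sqrt (q t)" for t
  define u where "u t = t - m * t^3 / 6" for t
  define \<phi> where "\<phi> t = p t / f t * u t - f t * (1 - m * t\<^sup>2 / 2)" for t
  define h where "h t = f t / u t" for t
  have f: "0 < f t" "(f t)\<^sup>2 = q t" if "0 < t" "t < 1" for t
    using q[OF that] by (simp_all add: f_def)
  have u: "5 / 6 * t \<le> u t" "u t \<le> t" "0 < u t" if t: "0 < t" "t < 1" for t
  proof -
    have "t^3 \<le> t" using power_decreasing[of 1 3 t] t by simp
    then have "m * t^3 \<le> 1 * t" using m t by (intro mult_mono) auto
    then show 1: "5 / 6 * t \<le> u t" by (simp add: u_def)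
    show "u t \<le> t" using m t by (simp add: u_def)
    show "0 < u t" using 1 t by linarith
  qed
  have du: "(u has_real_derivative 1 - m * t\<^sup>2 / 2) (at t)" for t
    unfolding u_def by (auto intro!: derivative_eq_intros simp: power2_eq_square)
  have df: "(f has_real_derivative p t / f t) (at t)" if t: "0 < t" "t < 1" for t
  proof -
    have "(f has_real_derivative (inverse (sqrt (q t)) / 2) * (2 * p t)) (at t)"
      unfolding f_def by (rule DERIV_chain2[OF DERIV_real_sqrt[OF q[OF t]] dq[OF t]])
    then show ?thesis by (rule DERIV_cong) (simp add: f_def field_simps)
  qed
  have d\<phi>: "\<exists>d\<ge>0. (\<phi> has_real_derivative d) (at t)" if t: "0 < t" "t < 1" for t
  proof -
    obtain p' where p': "(p has_real_derivative p') (at t)" "(p t)\<^sup>2 - m * (q t)\<^sup>2 \<le> p' * q t"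
      using dp[OF t] by blast
    have ft: "f t \<noteq> 0" using f[OF t] by simp
    have "(\<phi> has_real_derivative ((p' * f t - p t * (p t / f t)) / (f t * f t) * u t + (1 - m * t\<^sup>2 / 2) * (p t / f t)
        - ((p t / f t) * (1 - m * t\<^sup>2 / 2) + (- m * t) * f t))) (at t)"
      unfolding \<phi>_def
    proof (intro DERIV_diff DERIV_mult' DERIV_mult DERIV_divide[OF p'(1) df[OF t] ft] du df[OF t])
      show "((\<lambda>t. 1 - m * t\<^sup>2 / 2) has_real_derivative - m * t) (at t)"
        by (auto intro!: derivative_eq_intros)
    qed
    moreover have "(p' * f t - p t * (p t / f t)) / (f t * f t) * u t + (1 - m * t\<^sup>2 / 2) * (p t / f t)
        - ((p t / f t) * (1 - m * t\<^sup>2 / 2) + (- m * t) * f t) = (p' * q t - (p t)\<^sup>2) / (f t)^3 * u t + m * t * f t"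
    proof -
      have "(p' * f t - p t * (p t / f t)) / (f t * f t) = (p' * q t - (p t)\<^sup>2) / (f t)^3"
        using ft by (simp add: f(2)[OF t, symmetric] field_simps power2_eq_square power3_eq_cube)
      then show ?thesis by (simp add: algebra_simps)
    qed
    moreover have "0 \<le> (p' * q t - (p t)\<^sup>2) / (f t)^3 * u t + m * t * f t"
    proof -
      have "- m * f t = - (m * (q t)\<^sup>2) / (f t)^3"
        using ft by (simp add: f(2)[OF t, symmetric] field_simps power2_eq_square power3_eq_cube)
      also have "\<dots> \<le> (p' * q t - (p t)\<^sup>2) / (f t)^3"
        using p'(2) f[OF t] by (intro divide_right_mono) auto
      finally have "- m * f t * u t \<le> (p' * q t - (p t)\<^sup>2) / (f t)^3 * u t"
        using u[OF t] by (intro mult_right_mono) auto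
      moreover have "m * f t * u t \<le> m * f t * t"
        using u[OF t] f[OF t] m by (intro mult_left_mono) auto
      ultimately show ?thesis by (simp add: mult_ac)
    qed
    ultimately show ?thesis by metis
  qed
  have \<phi>_mono: "\<phi> s \<le> \<phi> t" if "0 < s" "s \<le> t" "t < 1" for s t
  proof (rule DERIV_nonneg_imp_nondecreasing[OF that(2)])
    fix \<tau> assume "s \<le> \<tau>" "\<tau> \<le> t"
    then show "\<exists>y. (\<phi> has_real_derivative y) (at \<tau>) \<and> 0 \<le> y" using d\<phi>[of \<tau>] that by force
  qed
  have dh: "(h has_real_derivative \<phi> t / (u t)\<^sup>2) (at t)" if t: "0 < t" "t < 1" for t
  proof -
    have "u t \<noteq> 0" using u(3)[OF t] by simp
    from DERIV_divide[OF df[OF t] du this]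
    show ?thesis unfolding h_def by (rule DERIV_cong) (simp add: \<phi>_def power2_eq_square)
  qed
  have hlim: "(h \<longlongrightarrow> sqrt l) (at_right 0)"
  proof -
    have "((\<lambda>t. sqrt (q t / t\<^sup>2) / (1 - m * t\<^sup>2 / 6)) \<longlongrightarrow> sqrt l / (1 - m * 0\<^sup>2 / 6)) (at_right 0)"
      by (intro tendsto_intros lim0) auto
    then have "((\<lambda>t. sqrt (q t / t\<^sup>2) / (1 - m * t\<^sup>2 / 6)) \<longlongrightarrow> sqrt l) (at_right 0)" by simp
    then show ?thesis
    proof (rule Lim_transform_eventually)
      show "\<forall>\<^sub>F t in at_right 0. sqrt (q t / t\<^sup>2) / (1 - m * t\<^sup>2 / 6) = h t"
      proof (rule eventually_mono[OF eventually_at_right_real[of 0 1]])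
        fix t :: real assume "t \<in> {0<..<1}"
        then show "sqrt (q t / t\<^sup>2) / (1 - m * t\<^sup>2 / 6) = h t"
          by (simp add: h_def f_def u_def real_sqrt_divide field_simps power2_eq_square power3_eq_cube)
      qed simp
    qed
  qed
  have \<phi>_nonneg: "0 \<le> \<phi> t1" if t1: "0 < t1" "t1 < 1" for t1
  proof (rule ccontr)
    assume "\<not> 0 \<le> \<phi> t1"
    define \<eta> where "\<eta> = - \<phi> t1"
    have \<eta>: "0 < \<eta>" using \<open>\<not> 0 \<le> \<phi> t1\<close> by (simp add: \<eta>_def)
    define k where "k = h t1 - \<eta> / t1"
    \<comment> \<open>As u t \<le> t, the derivative \<phi>/u^2 of \<open>h\<close> is at most
      -\<eta>/t^2, the derivative of \<eta>/t; thus \<open>h\<close> grows towards 0 at least as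
      fast as \<eta>/t.\<close>
    have low: "\<eta> / t + k \<le> h t" if t: "0 < t" "t \<le> t1" for t
    proof -
      have "(\<lambda>t. h t - \<eta> / t) t1 \<le> (\<lambda>t. h t - \<eta> / t) t"
      proof (rule DERIV_nonpos_imp_nonincreasing[OF t(2)])
        fix s assume s: "t \<le> s" "s \<le> t1"
        then have s': "0 < s" "s < 1" using t t1 by auto
        have "((\<lambda>t. h t - \<eta> / t) has_real_derivative \<phi> s / (u s)\<^sup>2 + \<eta> / s\<^sup>2) (at s)"
          using s' by (auto intro!: derivative_eq_intros dh simp: power2_eq_square)
        moreover have "\<phi> s / (u s)\<^sup>2 \<le> - \<eta> / (u s)\<^sup>2"
          using \<phi>_mono[of s t1] s s' t1 by (intro divide_right_mono) (auto simp: \<eta>_def)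
        moreover have "\<eta> / s\<^sup>2 \<le> \<eta> / (u s)\<^sup>2"
          using u[OF s'] \<eta> s' by (intro divide_left_mono power_mono) auto
        ultimately show "\<exists>y. ((\<lambda>t. h t - \<eta> / t) has_real_derivative y) (at s) \<and> y \<le> 0"
          by (intro exI[of _ "\<phi> s / (u s)\<^sup>2 + \<eta> / s\<^sup>2"]) auto
      qed
      then show ?thesis by (simp add: k_def)
    qed
    define B where "B = sqrt l + 1 + \<bar>k\<bar>"
    have B: "0 < B" using l by (simp add: B_def add_nonneg_pos add_pos_nonneg)
    have "\<forall>\<^sub>F t in at_right 0. h t < sqrt l + 1"
      by (rule order_tendstoD(2)[OF hlim]) simp
    moreover have "\<forall>\<^sub>F t in at_right 0. t \<in> {0<..<min t1 (\<eta> / B)}"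
      by (rule eventually_at_right_real) (use t1 \<eta> B in simp)
    ultimately have "\<forall>\<^sub>F t::real in at_right 0. False"
    proof eventually_elim
      case (elim t)
      then have t: "0 < t" "t \<le> t1" "t < \<eta> / B" by auto
      then have "B < \<eta> / t" using B by (simp add: field_simps)
      then show False using low[OF t(1,2)] elim(1) by (simp add: B_def)
    qed
    then show False by simp
  qed
  have h_mono: "h s \<le> h t" if "0 < s" "s \<le> t" "t < 1" for s t
  proof (rule DERIV_nonneg_imp_nondecreasing[OF that(2)])
    fix \<tau> assume "s \<le> \<tau>" "\<tau> \<le> t"
    then have "0 < \<tau>" "\<tau> < 1" using that by auto
    then show "\<exists>y. (h has_real_derivative y) (at \<tau>) \<and> 0 \<le> y"
      using dh[of \<tau>] \<phi>_nonneg[of \<tau>] by (intro exI[of _ "\<phi> \<tau> / (u \<tau>)\<^sup>2"]) simp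
  qed
  have lower: "l * (25 / 36 * t\<^sup>2) \<le> q t" if t: "0 < t" "t < 1" for t
  proof -
    have "sqrt l \<le> h t"
    proof (rule tendsto_upperbound[OF hlim])
      show "\<forall>\<^sub>F s in at_right 0. h s \<le> h t"
        by (rule eventually_mono[OF eventually_at_right_real[OF t(1)]]) (use h_mono t in auto)
    qed simp
    then have "sqrt l * u t \<le> f t" using u(3)[OF t] by (simp add: h_def pos_le_divide_eq)
    moreover have "sqrt l * (5 / 6 * t) \<le> sqrt l * u t"
      using u(1)[OF t] l by (intro mult_left_mono) auto
    ultimately have "sqrt l * (5 / 6 * t) \<le> f t" by simp
    then have "(sqrt l * (5 / 6 * t))\<^sup>2 \<le> (f t)\<^sup>2"
      using l t by (intro power_mono) auto
    then show ?thesis using l f(2)[OF t] by (simp add: power_mult_distrib power_divide)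
  qed
  show ?thesis
  proof (rule tendsto_le[OF _ lim1])
    show "((\<lambda>t. l * (25 / 36 * t\<^sup>2)) \<longlongrightarrow> 25 / 36 * l) (at_left 1)"
      by (auto intro!: tendsto_eq_intros)
    show "\<forall>\<^sub>F t in at_left 1. l * (25 / 36 * t\<^sup>2) \<le> q t"
      by (rule eventually_mono[OF eventually_at_left_real[of 0 1]]) (use lower in auto)
  qed simp
qed

section \<open>Continuity of the connection and of the metric\<close>

lemma isCont_on_open: "open S \<Longrightarrow> continuous_on S f \<Longrightarrow> y \<in> S \<Longrightarrow> isCont f y"
  by (simp add: continuous_on_eq_continuous_at)

lemma (in metric_chart) d\<Gamma>_expand:
  assumes y: "y \<in> S"
  shows "d\<Gamma> y a u v = (\<Sum>i\<in>UNIV. \<Sum>j\<in>UNIV. (u $ i * v $ j) *\<^sub>R (\<Sum>k\<in>UNIV. a $ k *\<^sub>R partial k (chris i j) y))"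
proof -
  have "frechet_derivative (chris i j) (at y) a = (\<Sum>k\<in>UNIV. a $ k *\<^sub>R partial k (chris i j) y)" for i j
    using has_derivative_unique[OF chris_has_derivative[OF y]
        has_derivative_partial[OF differentiableI[OF chris_has_derivative[OF y]]]]
    by metis
  then show ?thesis by (simp add: d\<Gamma>_def)
qed

lemma (in metric_chart) \<Gamma>_tendsto:
  assumes "(y \<longlongrightarrow> y0) F" "(u \<longlongrightarrow> u0) F" "(v \<longlongrightarrow> v0) F" and y0: "y0 \<in> S"
  shows "((\<lambda>p. \<Gamma> (y p) (u p) (v p)) \<longlongrightarrow> \<Gamma> y0 u0 v0) F"
proof -
  have "isCont (chris i j) y0" for i j
    by (rule isCont_on_open[OF open_img C1_onD(3)[OF chris_C1] y0])
  from isCont_tendsto_compose[OF this assms(1)] show ?thesis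
    unfolding \<Gamma>_def by (intro tendsto_intros assms(2,3))
qed

lemma (in metric_chart) d\<Gamma>_tendsto:
  assumes "(y \<longlongrightarrow> y0) F" "(a \<longlongrightarrow> a0) F" "(u \<longlongrightarrow> u0) F" "(v \<longlongrightarrow> v0) F" and y0: "y0 \<in> S"
  shows "((\<lambda>p. d\<Gamma> (y p) (a p) (u p) (v p)) \<longlongrightarrow> d\<Gamma> y0 a0 u0 v0) F"
proof -
  have p: "continuous_on S (partial k (chris i j))" for i j k
    using chris_C1[of i j] by simp
  have "isCont (partial k (chris i j)) y0" for i j k
    by (rule isCont_on_open[OF open_img p y0])
  note t = isCont_tendsto_compose[OF this assms(1)]
  have "((\<lambda>p. \<Sum>i\<in>UNIV. \<Sum>j\<in>UNIV. (u p $ i * v p $ j) *\<^sub>R (\<Sum>k\<in>UNIV. a p $ k *\<^sub>R partial k (chris i j) (y p)))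
      \<longlongrightarrow> (\<Sum>i\<in>UNIV. \<Sum>j\<in>UNIV. (u0 $ i * v0 $ j) *\<^sub>R (\<Sum>k\<in>UNIV. a0 $ k *\<^sub>R partial k (chris i j) y0))) F"
    by (intro tendsto_intros assms(2-4) t)
  then have "((\<lambda>p. \<Sum>i\<in>UNIV. \<Sum>j\<in>UNIV. (u p $ i * v p $ j) *\<^sub>R (\<Sum>k\<in>UNIV. a p $ k *\<^sub>R partial k (chris i j) (y p)))
      \<longlongrightarrow> d\<Gamma> y0 a0 u0 v0) F"
    by (simp only: d\<Gamma>_expand[OF y0])
  moreover have "\<forall>\<^sub>F p in F. (\<Sum>i\<in>UNIV. \<Sum>j\<in>UNIV. (u p $ i * v p $ j) *\<^sub>R (\<Sum>k\<in>UNIV. a p $ k *\<^sub>R partial k (chris i j) (y p)))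
      = d\<Gamma> (y p) (a p) (u p) (v p)"
    using topological_tendstoD[OF assms(1) open_img y0]
    by (rule eventually_mono) (simp only: d\<Gamma>_expand)
  ultimately show ?thesis by (rule Lim_transform_eventually)
qed

lemma (in metric_chart) inn_tendsto:
  assumes "(y \<longlongrightarrow> y0) F" "(u \<longlongrightarrow> u0) F" "(v \<longlongrightarrow> v0) F" and y0: "y0 \<in> S"
  shows "((\<lambda>p. inn (y p) (u p) (v p)) \<longlongrightarrow> inn y0 u0 v0) F"
proof -
  have "isCont (gcoeff M c) y0"
    by (rule isCont_on_open[OF open_img smooth_onD(3)[OF smooth_g] y0])
  from isCont_tendsto_compose[OF this assms(1)] show ?thesis
    unfolding inn_def
    by (intro tendsto_inner assms(2) bounded_bilinear.tendsto[OF bounded_bilinear_matrix_vector] assms(3))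
qed

text \<open>A point together with one of the radii competing in the supremum that defines the
  injectivity radius there. The radius may depend on the point, while the later estimates use a
  smaller uniform one.\<close>

locale expball = riem M for M :: "('a, 'n::finite) riemannian" +
  fixes x :: 'a and r :: real
  assumes x: "x \<in> points M" and r: "0 < r"
    and geo: "\<And>v. tangent_norm M x v < r \<Longrightarrow> \<exists>\<gamma>. geodesic_from M x v \<gamma>"
    and diffeo: "diffeo_onto_open_image M {v. tangent_norm M x v < r} (riem_exp M x)"
begin

abbreviation "ex \<equiv> riem_exp M x"
abbreviation "U \<equiv> {v. tangent_norm M x v < r}"

definition F :: "('a, 'n) chart \<Rightarrow> real^'n \<Rightarrow> real^'n" where "F c v = chart_map c (ex v)"
definition V :: "('a, 'n) chart \<Rightarrow> (real^'n) set" where "V c = {v \<in> U. ex v \<in> chart_dom c}"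
text \<open>The differential of \<open>F c\<close>, written with partial derivatives so that joint
  continuity in base point and vector is visible; \<open>D2\<close> below is in the same way the
  derivative of \<open>DF c v u\<close> in \<open>v\<close> along \<open>a\<close>.\<close>

definition DF :: "('a, 'n) chart \<Rightarrow> real^'n \<Rightarrow> real^'n \<Rightarrow> real^'n" where
  "DF c v u = (\<Sum>i\<in>UNIV. u $ i *\<^sub>R partial i (F c) v)"
definition D2 :: "('a, 'n) chart \<Rightarrow> real^'n \<Rightarrow> real^'n \<Rightarrow> real^'n \<Rightarrow> real^'n" where
  "D2 c v a u = (\<Sum>i\<in>UNIV. u $ i *\<^sub>R (\<Sum>j\<in>UNIV. a $ j *\<^sub>R partial j (partial i (F c)) v))"
text \<open>The squared length of the image of \<open>u\<close> under the differential of the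
  exponential map at \<open>v\<close>. At the point tv it is |J(t)|^2 for u = tw, and the squared
  speed of the radial geodesic for u = v.\<close>

definition Q :: "real^'n \<Rightarrow> real^'n \<Rightarrow> real" where
  "Q v u = (let c = chart_at M (ex v) in Inn c (F c v) (DF c v u) (DF c v u))"

lemma tangent_norm_scale: "tangent_norm M x (a *\<^sub>R v) = \<bar>a\<bar> * tangent_norm M x v"
proof -
  have "metric_at M x (a *\<^sub>R v) (a *\<^sub>R v) = a\<^sup>2 * metric_at M x v v"
    by (simp add: metric_at_def matrix_vector_mult_scaleR power2_eq_square)
  then show ?thesis by (simp add: tangent_norm_def real_sqrt_mult)
qed

lemma tangent_norm_nonneg: "0 \<le> tangent_norm M x v"
  by (simp add: tangent_norm_def metric_at_nonneg[OF x])

lemma tangent_norm_sq: "(tangent_norm M x v)\<^sup>2 = metric_at M x v v"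
  by (simp add: tangent_norm_def metric_at_nonneg[OF x])

lemma continuous_tangent_norm: "continuous_on A (tangent_norm M x)"
  unfolding tangent_norm_def metric_at_def
  by (intro continuous_intros linear_continuous_on linear_linear[THEN iffD2] matrix_vector_mul_linear)

lemma open_U: "open U"
  by (rule open_Collect_less[OF continuous_tangent_norm]) (intro continuous_intros)

lemma zero_U: "0 \<in> U" using tangent_norm_scale[of 0 0] r by simp

lemma scale_U: "v \<in> U \<Longrightarrow> \<bar>t\<bar> \<le> 1 \<Longrightarrow> t *\<^sub>R v \<in> U"
  using mult_right_mono[of "\<bar>t\<bar>" 1 "tangent_norm M x v"] tangent_norm_nonneg[of v] by (simp add: tangent_norm_scale)

lemma ex_homeo: "homeomorphic_map (top_of_set U) (subtopology (top_of M) (ex ` U)) ex"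
  and ex_open: "openin (top_of M) (ex ` U)"
  using diffeo by (simp_all add: diffeo_onto_open_image_def)

lemma ex_inj: "inj_on ex U"
  using homeomorphic_imp_injective_map[OF ex_homeo] by simp

lemma ex_continuous: "continuous_map (top_of_set U) (top_of M) ex"
  using homeomorphic_imp_continuous_map[OF ex_homeo] by (simp add: continuous_map_in_subtopology)

lemma ex_points: "v \<in> U \<Longrightarrow> ex v \<in> points M"
  using openin_subset[OF ex_open] by blast

lemma ex_preimage_open: "openin (top_of M) W \<Longrightarrow> open {v \<in> U. ex v \<in> W}"
  using openin_continuous_map_preimage[OF ex_continuous, of W] openin_open_trans[OF _ open_U] by simp

lemma ex_image_open: "open W \<Longrightarrow> W \<subseteq> U \<Longrightarrow> openin (top_of M) (ex ` W)"
proof -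
  assume W: "open W" "W \<subseteq> U"
  have "openin (top_of_set U) W" using W by (simp add: open_subset)
  then have "openin (subtopology (top_of M) (ex ` U)) (ex ` W)"
    using homeomorphic_imp_open_map[OF ex_homeo] by (simp add: open_map_def)
  then show ?thesis by (simp add: openin_open_subtopology ex_open)
qed

lemma V_open: "c \<in> atlas M \<Longrightarrow> open (V c)"
  unfolding V_def by (rule ex_preimage_open[OF dom_open])

lemma V_U: "v \<in> V c \<Longrightarrow> v \<in> U" and V_dom: "v \<in> V c \<Longrightarrow> ex v \<in> chart_dom c"
  and F_img: "v \<in> V c \<Longrightarrow> F c v \<in> chart_map c ` chart_dom c"
  by (simp_all add: V_def F_def)

lemma V_chart_at: "v \<in> U \<Longrightarrow> v \<in> V (chart_at M (ex v))" "v \<in> U \<Longrightarrow> chart_at M (ex v) \<in> atlas M"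
  using chart_at[OF ex_points] by (simp_all add: V_def)

lemma F_smooth: "c \<in> atlas M \<Longrightarrow> smooth_on (V c) (F c)"
proof -
  assume "c \<in> atlas M"
  then have "smooth_on {v\<in>U. ex v \<in> chart_dom c} (chart_map c \<circ> ex)"
    using diffeo unfolding diffeo_onto_open_image_def by blast
  moreover have "F c = chart_map c \<circ> ex" by (simp add: fun_eq_iff F_def)
  ultimately show ?thesis by (simp add: V_def)
qed

lemma F_has_derivative: "c \<in> atlas M \<Longrightarrow> v \<in> V c \<Longrightarrow> (F c has_derivative DF c v) (at v)"
  using has_derivative_partial[OF smooth_onD(1)[OF F_smooth]] by (simp add: DF_def[abs_def])

lemma DF_linear: "c \<in> atlas M \<Longrightarrow> v \<in> V c \<Longrightarrow> linear (DF c v)"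
  by (rule has_derivative_linear[OF F_has_derivative])

lemma F_tendsto:
  assumes c: "c \<in> atlas M" "z0 \<in> V c" and "(z \<longlongrightarrow> z0) G"
  shows "((\<lambda>p. F c (z p)) \<longlongrightarrow> F c z0) G"
  by (rule isCont_tendsto_compose[OF _ assms(3)])
    (use has_derivative_continuous[OF F_has_derivative[OF c]] in simp)

lemma DF_tendsto:
  assumes c: "c \<in> atlas M" "z0 \<in> V c" and z: "(z \<longlongrightarrow> z0) G" and u: "(u \<longlongrightarrow> u0) G"
  shows "((\<lambda>p. DF c (z p) (u p)) \<longlongrightarrow> DF c z0 u0) G"
proof -
  have "isCont (partial i (F c)) z0" for i
    by (rule isCont_on_open[OF V_open[OF c(1)] smooth_onD(3)[OF smooth_onD(2)[OF F_smooth[OF c(1)]]] c(2)])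
  from isCont_tendsto_compose[OF this z] show ?thesis
    unfolding DF_def by (intro tendsto_intros u)
qed

lemma D2_tendsto:
  assumes c: "c \<in> atlas M" "z0 \<in> V c" and z: "(z \<longlongrightarrow> z0) G" and a: "(a \<longlongrightarrow> a0) G" and u: "(u \<longlongrightarrow> u0) G"
  shows "((\<lambda>p. D2 c (z p) (a p) (u p)) \<longlongrightarrow> D2 c z0 a0 u0) G"
proof -
  have "isCont (partial j (partial i (F c))) z0" for i j
    by (rule isCont_on_open[OF V_open[OF c(1)]
        smooth_onD(3)[OF smooth_onD(2)[OF smooth_onD(2)[OF F_smooth[OF c(1)]]]] c(2)])
  from isCont_tendsto_compose[OF this z] show ?thesis
    unfolding D2_def by (intro tendsto_intros u a)
qed

lemma DF_change:
  assumes c: "c \<in> atlas M" "c' \<in> atlas M" and v: "v \<in> V c" "v \<in> V c'"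
  shows "DF c' v u = frechet_derivative (transition c c') (at (F c v)) (DF c v u)"
proof -
  have "(transition c c' has_derivative frechet_derivative (transition c c') (at (F c v))) (at (F c v))"
    using transition_derivative[OF c V_dom[OF v(1)] V_dom[OF v(2)]] by (simp add: F_def)
  from has_derivative_compose[OF F_has_derivative[OF c(1) v(1)] this]
  have 1: "((\<lambda>z. transition c c' (F c z)) has_derivative
    (\<lambda>u. frechet_derivative (transition c c') (at (F c v)) (DF c v u))) (at v)" .
  have "(F c' has_derivative (\<lambda>u. frechet_derivative (transition c c') (at (F c v)) (DF c v u))) (at v)"
  proof (rule has_derivative_transform_within_open[OF 1 open_Int[OF V_open[OF c(1)] V_open[OF c(2)]]])
    show "v \<in> V c \<inter> V c'" using v by simp
    show "transition c c' (F c z) = F c' z" if "z \<in> V c \<inter> V c'" for z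
      using that V_dom[of z c] chart_inv_left[OF c(1), of "ex z"] by (simp add: transition_def F_def)
  qed
  from has_derivative_unique[OF F_has_derivative[OF c(2) v(2)] this] show ?thesis by (rule fun_cong)
qed

text \<open>Frees \<open>Q\<close> from the preferred chart, which may jump from point to point:
  near a given \<open>v\<close> one fixed chart computes it, so it can be differentiated.\<close>

lemma Q_eq:
  assumes c: "c \<in> atlas M" and v: "v \<in> V c"
  shows "Q v u = Inn c (F c v) (DF c v u) (DF c v u)"
proof -
  let ?c = "chart_at M (ex v)"
  note d = V_chart_at[OF V_U[OF v]]
  have "Inn ?c (F ?c v) (DF ?c v u) (DF ?c v u) = Inn c (F c v) (DF c v u) (DF c v u)"
    using inn_change[OF d(2) c V_dom[OF d(1)] V_dom[OF v], of "DF ?c v u" "DF ?c v u"]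
    by (simp add: F_def[symmetric] DF_change[OF d(2) c d(1) v, of u])
  then show ?thesis by (simp add: Q_def)
qed

text \<open>The smooth inverse of the exponential map is differentiated here: composed with
  \<open>F c\<close> it is the identity near \<open>v\<close>, so its differential is a left inverse
  of \<open>DF c v\<close>.\<close>

lemma DF_inj:
  assumes c: "c \<in> atlas M" and v: "v \<in> V c" and z: "DF c v u = 0"
  shows "u = 0"
proof -
  let ?G = "inv_into U ex \<circ> chart_inv c"
  have "smooth_on (chart_map c ` (chart_dom c \<inter> ex ` U)) ?G"
    using diffeo c unfolding diffeo_onto_open_image_def by blast
  moreover have "F c v \<in> chart_map c ` (chart_dom c \<inter> ex ` U)"
    using V_dom[OF v] V_U[OF v] by (auto simp: F_def)
  ultimately have "(?G has_derivative frechet_derivative ?G (at (F c v))) (at (F c v))"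
    by (simp add: smooth_onD(1) frechet_derivative_works[symmetric])
  from has_derivative_compose[OF F_has_derivative[OF c v] this]
  have 1: "((\<lambda>z. ?G (F c z)) has_derivative (\<lambda>u. frechet_derivative ?G (at (F c v)) (DF c v u))) (at v)" .
  have 2: "((\<lambda>z. z) has_derivative (\<lambda>u. frechet_derivative ?G (at (F c v)) (DF c v u))) (at v)"
  proof (rule has_derivative_transform_within_open[OF 1 V_open[OF c] v])
    show "?G (F c z) = z" if "z \<in> V c" for z
      using V_dom[OF that] V_U[OF that] chart_inv_left[OF c, of "ex z"] ex_inj by (simp add: F_def)
  qed
  have "u = frechet_derivative ?G (at (F c v)) (DF c v u)"
    using has_derivative_unique[OF has_derivative_ident 2] by (rule fun_cong)
  also have "\<dots> = 0"
    unfolding z using linear_0[OF has_derivative_linear[OF \<open>(?G has_derivative frechet_derivative ?G (at (F c v))) (at (F c v))\<close>]] .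
  finally show ?thesis .
qed

lemma Q_pos:
  assumes v: "v \<in> U" and u: "u \<noteq> 0"
  shows "0 < Q v u"
proof -
  note c = V_chart_at(2)[OF v] V_chart_at(1)[OF v]
  have "DF (chart_at M (ex v)) v u \<noteq> 0" using DF_inj[OF c] u by blast
  from metric_chart.inn_pos[OF metric_chart[OF c(1)] F_img[OF c(2)] this]
  show ?thesis unfolding Q_eq[OF c] .
qed

lemma Q_scale:
  assumes v: "v \<in> U"
  shows "Q v (a *\<^sub>R u) = a\<^sup>2 * Q v u"
proof -
  note c = V_chart_at(2)[OF v] V_chart_at(1)[OF v]
  show ?thesis
    unfolding Q_eq[OF c] linear_scale[OF DF_linear[OF c]] metric_chart.inn_bilinear[OF metric_chart[OF c(1)]]
    by (simp add: power2_eq_square)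
qed

lemma Q_tendsto:
  assumes z0: "z0 \<in> U" and z: "(z \<longlongrightarrow> z0) G" and u: "(u \<longlongrightarrow> u0) G"
  shows "((\<lambda>p. Q (z p) (u p)) \<longlongrightarrow> Q z0 u0) G"
proof -
  define c where "c = chart_at M (ex z0)"
  have c: "c \<in> atlas M" "z0 \<in> V c" using V_chart_at[OF z0] by (simp_all add: c_def)
  note t = metric_chart.inn_tendsto[OF metric_chart[OF c(1)] F_tendsto[OF c z] DF_tendsto[OF c z u] DF_tendsto[OF c z u] F_img[OF c(2)]]
  have "\<forall>\<^sub>F p in G. Inn c (F c (z p)) (DF c (z p) (u p)) (DF c (z p) (u p)) = Q (z p) (u p)"
    using topological_tendstoD[OF z V_open[OF c(1)] c(2)]
    by (rule eventually_mono) (simp add: Q_eq[OF c(1)])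
  from Lim_transform_eventually[OF t this] show ?thesis by (simp add: Q_eq[OF c])
qed

lemma ex_geodesic:
  assumes "v \<in> U"
  obtains \<gamma> where "geodesic M \<gamma>" "\<And>t. t \<in> {0..1} \<Longrightarrow> ex (t *\<^sub>R v) = \<gamma> t"
    "((chart_map (chart_at M x) \<circ> \<gamma>) has_vector_derivative v) (at 0 within {0..1})" "\<gamma> 0 = x"
proof -
  obtain \<gamma> where \<gamma>: "geodesic_from M x v \<gamma>" using geo assms by blast
  show ?thesis
    by (rule that[of \<gamma>]) (use \<gamma> riem_exp_geodesic[OF x \<gamma>] in \<open>auto simp: geodesic_from_def\<close>)
qed

lemma ex_0: "ex 0 = x"
proof -
  obtain \<gamma> where "\<And>t. t \<in> {0..1} \<Longrightarrow> ex (t *\<^sub>R 0) = \<gamma> t" "\<gamma> 0 = x"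
    using ex_geodesic[OF zero_U] by blast
  from this(1)[of 0] this(2) show ?thesis by simp
qed

lemma scale_has_derivative: "((\<lambda>t. t *\<^sub>R v) has_vector_derivative v) (at t within A)" for v :: "real^'n"
  by (auto intro!: derivative_eq_intros)

lemma F_curve: 
  assumes "c \<in> atlas M" "t *\<^sub>R v \<in> V c"
  shows "((\<lambda>t. F c (t *\<^sub>R v)) has_vector_derivative DF c (t *\<^sub>R v) v) (at t within A)"
  by (rule has_vector_derivative_compose[OF scale_has_derivative F_has_derivative[OF assms]])

text \<open>The differential of the exponential map at the origin is the identity. For vectors in
  the ball this is the initial velocity of the corresponding geodesic; any other vector is first
  scaled into the ball.\<close>

lemma Q_0: "Q 0 w = metric_at M x w w"
proof -
  let ?c = "chart_at M x"
  have c: "?c \<in> atlas M" "0 \<in> V ?c" using V_chart_at[OF zero_U] by (simp_all add: ex_0)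
  have D: "DF ?c 0 v = v" if v: "v \<in> U" for v
  proof -
    obtain \<gamma> where \<gamma>: "\<And>t. t \<in> {0..1} \<Longrightarrow> ex (t *\<^sub>R v) = \<gamma> t"
      "((chart_map ?c \<circ> \<gamma>) has_vector_derivative v) (at 0 within {0..1})"
      using ex_geodesic[OF v] by blast
    have 1: "((\<lambda>t. F ?c (t *\<^sub>R v)) has_vector_derivative DF ?c 0 v) (at 0 within {0..1})"
      using F_curve[OF c(1), of 0 v] c(2) by simp
    have 2: "((\<lambda>t. F ?c (t *\<^sub>R v)) has_vector_derivative v) (at 0 within {0..1})"
      by (rule has_vector_derivative_transform[OF _ _ \<gamma>(2)]) (simp_all add: F_def \<gamma>(1))
    show ?thesis by (rule vector_derivative_unique_Icc[OF zero_less_one _ 1 2]) simp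
  qed
  have "DF ?c 0 w = w"
  proof -
    define s where "s = r / (2 * (tangent_norm M x w + 1))"
    have nn: "0 \<le> tangent_norm M x w" by (rule tangent_norm_nonneg)
    then have s: "0 < s" using r by (simp add: s_def)
    have "r * tangent_norm M x w < r * (2 * (tangent_norm M x w + 1))"
      using nn r by (intro mult_strict_left_mono) auto
    then have "s * tangent_norm M x w < r"
      using nn by (simp add: s_def pos_divide_less_eq)
    with s have "s *\<^sub>R w \<in> U" by (simp add: tangent_norm_scale)
    from D[OF this] show ?thesis using s by (simp add: linear_scale[OF DF_linear[OF c]])
  qed
  then show ?thesis
    unfolding Q_eq[OF c] metric_at_eq[OF x] by (simp add: F_def ex_0)
qed

text \<open>The definition of a geodesic only provides some velocity \<open>w\<close> in each chart.
  On the open set of times spent in the chart it must be the derivative of the radial curve, and the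
  equation for \<open>w\<close> transfers to \<open>DF\<close>.\<close>

lemma geodesic_equation:
  assumes c: "c \<in> atlas M" and v: "v \<in> U" and t: "0 < t" "t < 1" "t *\<^sub>R v \<in> V c"
  shows "((\<lambda>t. DF c (t *\<^sub>R v) v) has_vector_derivative
    - Chr c (F c (t *\<^sub>R v)) (DF c (t *\<^sub>R v) v) (DF c (t *\<^sub>R v) v)) (at t)"
proof -
  obtain \<gamma> where \<gamma>: "geodesic M \<gamma>" "\<And>t. t \<in> {0..1} \<Longrightarrow> ex (t *\<^sub>R v) = \<gamma> t"
    using ex_geodesic[OF v] by blast
  obtain w where w: "\<And>t. t \<in> {0..1} \<Longrightarrow> \<gamma> t \<in> chart_dom c \<Longrightarrow>
      ((\<lambda>t. chart_map c (\<gamma> t)) has_vector_derivative w t) (at t within {0..1})"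
    "\<And>t. t \<in> {0..1} \<Longrightarrow> \<gamma> t \<in> chart_dom c \<Longrightarrow>
      (w has_vector_derivative - Chr c (chart_map c (\<gamma> t)) (w t) (w t)) (at t within {0..1})"
    using geodesicD[OF \<gamma>(1) c] by blast
  define T where "T = {0<..<1} \<inter> (\<lambda>t. t *\<^sub>R v) -` V c"
  have "open T" unfolding T_def
    by (intro open_Int open_greaterThanLessThan open_vimage V_open[OF c] continuous_intros)
  have \<gamma>T: "s \<in> {0..1}" "\<gamma> s \<in> chart_dom c" "F c (s *\<^sub>R v) = chart_map c (\<gamma> s)" if "s \<in> T" for s
    using that \<gamma>(2)[of s] V_dom[of "s *\<^sub>R v" c] by (auto simp: T_def F_def)
  have eq: "w s = DF c (s *\<^sub>R v) v" if s: "s \<in> T" for s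
  proof (rule vector_derivative_unique_Icc[OF zero_less_one \<gamma>T(1)[OF s] w(1)[OF \<gamma>T(1,2)[OF s]]])
    have "s *\<^sub>R v \<in> V c" using s by (simp add: T_def)
    note d = F_curve[OF c this]
    show "((\<lambda>t. chart_map c (\<gamma> t)) has_vector_derivative DF c (s *\<^sub>R v) v) (at s within {0..1})"
      by (rule has_vector_derivative_transform[OF \<gamma>T(1)[OF s] _ d]) (simp add: F_def \<gamma>(2))
  qed
  have tT: "t \<in> T" using t by (simp add: T_def)
  have "(w has_vector_derivative - Chr c (chart_map c (\<gamma> t)) (w t) (w t)) (at t)"
    using w(2)[OF \<gamma>T(1,2)[OF tT]] at_within_Icc_at[of 0 t 1] t by simp
  then have "(w has_vector_derivative - Chr c (F c (t *\<^sub>R v)) (DF c (t *\<^sub>R v) v) (DF c (t *\<^sub>R v) v)) (at t)"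
    by (simp only: \<gamma>T(3)[OF tT] eq[OF tT])
  then show ?thesis
    by (rule has_vector_derivative_transform_within_open[OF _ \<open>open T\<close> tT eq])
qed

end

section \<open>Jacobi fields as variations of radial geodesics\<close>

context expball
begin

text \<open>J is the variation field of the family exp (\<tau> (v + s w)) of geodesics at s = 0.
  Both claims exchange the derivatives in s and \<tau>: once for the position, which gives J' = P,
  and once for the velocity, whose \<tau>-derivative is known from the geodesic equation;
  differentiating that equation in s linearizes it.\<close>

lemma jacobi_fields:
  fixes w :: "real^'n"
  assumes c: "c \<in> atlas M" and v: "v \<in> U" and t: "0 < t" "t < 1" "t *\<^sub>R v \<in> V c"
  defines "J \<equiv> \<lambda>\<tau>. DF c (\<tau> *\<^sub>R v) (\<tau> *\<^sub>R w)"
    and "P \<equiv> \<lambda>\<tau>. D2 c (\<tau> *\<^sub>R v) (\<tau> *\<^sub>R w) v + DF c (\<tau> *\<^sub>R v) w"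
    and "W \<equiv> \<lambda>\<tau>. DF c (\<tau> *\<^sub>R v) v" and "y \<equiv> \<lambda>\<tau>. F c (\<tau> *\<^sub>R v)"
  shows "(J has_vector_derivative P t) (at t)"
    and "(P has_vector_derivative
      - (metric_chart.d\<Gamma> M c (y t) (J t) (W t) (W t) + Chr c (y t) (P t) (W t) + Chr c (y t) (W t) (P t))) (at t)"
proof -
  \<comment> \<open>In coordinates, \<open>h\<close> is the position, \<open>b\<close> and
    \<open>j\<close> are its derivatives in \<tau> and s, \<open>B\<close> is the s-derivative of
    \<open>b\<close>, \<open>b2\<close> the \<tau>-derivative of \<open>b\<close> and
    \<open>B2\<close> the s-derivative of \<open>b2\<close>.\<close>
  define z where "z s \<tau> = \<tau> *\<^sub>R (v + s *\<^sub>R w)" for s \<tau> :: real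
  define h where "h s \<tau> = F c (z s \<tau>)" for s \<tau>
  define b where "b s \<tau> = DF c (z s \<tau>) (v + s *\<^sub>R w)" for s \<tau>
  define j where "j s \<tau> = DF c (z s \<tau>) (\<tau> *\<^sub>R w)" for s \<tau>
  define B where "B s \<tau> = D2 c (z s \<tau>) (\<tau> *\<^sub>R w) (v + s *\<^sub>R w) + DF c (z s \<tau>) w" for s \<tau>
  define b2 where "b2 s \<tau> = - Chr c (h s \<tau>) (b s \<tau>) (b s \<tau>)" for s \<tau>
  define B2 where "B2 s \<tau> = - (metric_chart.d\<Gamma> M c (h s \<tau>) (j s \<tau>) (b s \<tau>) (b s \<tau>)
    + Chr c (h s \<tau>) (B s \<tau>) (b s \<tau>) + Chr c (h s \<tau>) (b s \<tau>) (B s \<tau>))" for s \<tau>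
  note mc = metric_chart[OF c]
  \<comment> \<open>The parameters for which the time is interior, the initial vector is admissible
    and the point is seen by the chart. Half of the radius \<open>e\<close> suffices later since the
    distance in the plane is at most |s| + |\<tau> - t|.\<close>
  define O' where "O' = {p::real \<times> real. 0 < snd p} \<inter> {p. snd p < 1} \<inter> (\<lambda>p. v + fst p *\<^sub>R w) -` U \<inter> (\<lambda>p. z (fst p) (snd p)) -` V c"
  have "open O'"
    unfolding O'_def z_def
    by (intro open_Int open_Collect_less open_vimage open_U V_open[OF c] continuous_intros)
  moreover have "(0, t) \<in> O'" using v t by (simp add: O'_def z_def)
  ultimately obtain e where e: "0 < e" "\<And>p. dist p (0, t) < e \<Longrightarrow> p \<in> O'"
    unfolding open_dist by blast
  define \<delta> where "\<delta> = e / 2"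
  have \<delta>: "0 < \<delta>" using e by (simp add: \<delta>_def)
  have box: "0 < \<tau>" "\<tau> < 1" "v + s *\<^sub>R w \<in> U" "z s \<tau> \<in> V c" if "\<bar>s\<bar> < \<delta>" "\<bar>\<tau> - t\<bar> < \<delta>" for s \<tau>
  proof -
    have "dist (s, \<tau>) (0, t) \<le> \<bar>s\<bar> + \<bar>\<tau> - t\<bar>"
      unfolding dist_Pair_Pair by (rule order_trans[OF sqrt_sum_squares_le_sum]) (auto simp: dist_real_def)
    also have "\<dots> < e" using that by (simp add: \<delta>_def)
    finally have "(s, \<tau>) \<in> O'" by (rule e(2))
    then show "0 < \<tau>" "\<tau> < 1" "v + s *\<^sub>R w \<in> U" "z s \<tau> \<in> V c" by (simp_all add: O'_def)
  qed
  have zs: "((\<lambda>s. z s \<tau>) has_vector_derivative \<tau> *\<^sub>R w) (at s)" for s \<tau>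
    unfolding z_def by (auto intro!: derivative_eq_intros)
  have us: "((\<lambda>s. v + s *\<^sub>R w) has_vector_derivative w) (at s)" for s
    by (auto intro!: derivative_eq_intros)
  have h\<tau>: "(h s has_vector_derivative b s \<tau>) (at \<tau>)" if "\<bar>s\<bar> < \<delta>" "\<bar>\<tau> - t\<bar> < \<delta>" for s \<tau>
    using F_curve[OF c, of \<tau> "v + s *\<^sub>R w" UNIV] box(4)[OF that] by (simp add: h_def[abs_def] b_def z_def)
  have hs: "((\<lambda>s. h s \<tau>) has_vector_derivative j s \<tau>) (at s)" if "\<bar>s\<bar> < \<delta>" "\<bar>\<tau> - t\<bar> < \<delta>" for s \<tau>
    unfolding h_def j_def by (rule has_vector_derivative_compose[OF zs F_has_derivative[OF c box(4)[OF that]]])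
  have bs: "((\<lambda>s. b s \<tau>) has_vector_derivative B s \<tau>) (at s)" if "\<bar>s\<bar> < \<delta>" "\<bar>\<tau> - t\<bar> < \<delta>" for s \<tau>
  proof -
    have p: "((\<lambda>s. partial i (F c) (z s \<tau>)) has_vector_derivative
        (\<Sum>k\<in>UNIV. (\<tau> *\<^sub>R w) $ k *\<^sub>R partial k (partial i (F c)) (z s \<tau>))) (at s)" for i
      by (rule has_vector_derivative_compose[OF zs has_derivative_partial
            [OF smooth_onD(1)[OF smooth_onD(2)[OF F_smooth[OF c]] box(4)[OF that]]]])
    have u: "((\<lambda>s. (v + s *\<^sub>R w) $ i) has_real_derivative w $ i) (at s)" for i
      unfolding has_real_derivative_iff_has_vector_derivative
      by (rule bounded_linear.has_vector_derivative[OF bounded_linear_vec_nth us])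
    show ?thesis
      unfolding b_def DF_def B_def D2_def sum.distrib[symmetric]
      by (intro has_vector_derivative_sum has_vector_derivative_scaleR u p)
  qed
  have b\<tau>: "(b s has_vector_derivative b2 s \<tau>) (at \<tau>)" if "\<bar>s\<bar> < \<delta>" "\<bar>\<tau> - t\<bar> < \<delta>" for s \<tau>
    using geodesic_equation[OF c box(3,1,2)[OF that]] box(4)[OF that]
    by (simp add: b_def[abs_def] b2_def h_def z_def)
  have b2s: "((\<lambda>s. b2 s \<tau>) has_vector_derivative B2 s \<tau>) (at s)" if "\<bar>s\<bar> < \<delta>" "\<bar>\<tau> - t\<bar> < \<delta>" for s \<tau>
  proof -
    have "h s \<tau> \<in> chart_map c ` chart_dom c" unfolding h_def by (rule F_img[OF box(4)[OF that]])
    from has_vector_derivative_minus[OF metric_chart.\<Gamma>_has_derivative[OF mc hs[OF that] this bs[OF that] bs[OF that]]]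
    show ?thesis unfolding b2_def B2_def by (simp add: add.assoc)
  qed
  have zt: "((\<lambda>p. z (fst p) (snd p)) \<longlongrightarrow> z 0 \<tau>) (at (0, \<tau>))" for \<tau>
    unfolding z_def by (auto intro!: tendsto_eq_intros)
  have ut: "((\<lambda>p. v + fst p *\<^sub>R w) \<longlongrightarrow> v + 0 *\<^sub>R w) (at (0, \<tau>))" for \<tau> :: real
    by (auto intro!: tendsto_eq_intros)
  have wt: "((\<lambda>p. snd p *\<^sub>R w) \<longlongrightarrow> \<tau> *\<^sub>R w) (at (0::real, \<tau>))" for \<tau> :: real
    by (auto intro!: tendsto_eq_intros)
  have z0: "z 0 \<tau> \<in> V c" if "\<bar>\<tau> - t\<bar> < \<delta>" for \<tau> using box(4)[of 0 \<tau>] that \<delta> by simp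
  have Bt: "((\<lambda>p. B (fst p) (snd p)) \<longlongrightarrow> B 0 \<tau>) (at (0, \<tau>))" if "\<bar>\<tau> - t\<bar> < \<delta>" for \<tau>
    unfolding B_def
    by (intro tendsto_add D2_tendsto[OF c z0[OF that] zt wt ut] DF_tendsto[OF c z0[OF that] zt tendsto_const])
  have jt: "((\<lambda>p. j (fst p) (snd p)) \<longlongrightarrow> j 0 \<tau>) (at (0, \<tau>))" if "\<bar>\<tau> - t\<bar> < \<delta>" for \<tau>
    unfolding j_def by (intro DF_tendsto[OF c z0[OF that] zt wt])
  have bt: "((\<lambda>p. b (fst p) (snd p)) \<longlongrightarrow> b 0 \<tau>) (at (0, \<tau>))" if "\<bar>\<tau> - t\<bar> < \<delta>" for \<tau>
    unfolding b_def by (rule DF_tendsto[OF c z0[OF that] zt ut])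
  have ht: "((\<lambda>p. h (fst p) (snd p)) \<longlongrightarrow> h 0 \<tau>) (at (0, \<tau>))" if "\<bar>\<tau> - t\<bar> < \<delta>" for \<tau>
    unfolding h_def by (rule F_tendsto[OF c z0[OF that] zt])
  have tt: "\<bar>t - t\<bar> < \<delta>" using \<delta> by simp
  have h0: "h 0 t \<in> chart_map c ` chart_dom c" unfolding h_def by (rule F_img[OF z0[OF tt]])
  have B2t: "((\<lambda>p. B2 (fst p) (snd p)) \<longlongrightarrow> B2 0 t) (at (0, t))"
    unfolding B2_def
    by (intro tendsto_minus tendsto_add metric_chart.d\<Gamma>_tendsto[OF mc ht[OF tt] jt[OF tt] bt[OF tt] bt[OF tt] h0]
        metric_chart.\<Gamma>_tendsto[OF mc ht[OF tt] Bt[OF tt] bt[OF tt] h0]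
        metric_chart.\<Gamma>_tendsto[OF mc ht[OF tt] bt[OF tt] Bt[OF tt] h0])
  \<comment> \<open>In \<open>mixed_vector_derivative\<close> the roles of a, b, \<alpha>, \<beta>
    are played by \<open>h\<close>, \<open>b\<close>, \<open>j 0\<close>, \<open>B\<close> and then
    by \<open>b\<close>, \<open>b2\<close>, \<open>B 0\<close>, \<open>B2\<close>.\<close>
  have "(j 0 has_vector_derivative B 0 t) (at t)"
    by (rule mixed_vector_derivative[OF \<delta> h\<tau> hs bs]) (use \<delta> Bt[OF tt] in \<open>auto simp: isCont_def case_prod_unfold\<close>)
  then show "(J has_vector_derivative P t) (at t)"
    by (simp add: J_def P_def j_def[abs_def] B_def z_def)
  have "(B 0 has_vector_derivative B2 0 t) (at t)"
    by (rule mixed_vector_derivative[OF \<delta> b\<tau> bs b2s]) (use \<delta> B2t in \<open>auto simp: isCont_def case_prod_unfold\<close>)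
  then show "(P has_vector_derivative
      - (metric_chart.d\<Gamma> M c (y t) (J t) (W t) (W t) + Chr c (y t) (P t) (W t) + Chr c (y t) (W t) (P t))) (at t)"
    by (simp add: J_def P_def W_def y_def j_def b_def h_def B_def[abs_def] B2_def z_def)
qed

lemma radial_open: "c \<in> atlas M \<Longrightarrow> open ({0<..<1} \<inter> (\<lambda>t::real. t *\<^sub>R v) -` V c)"
  by (intro open_Int open_greaterThanLessThan open_vimage V_open continuous_intros)

text \<open>Geodesics have constant speed: the covariant derivative of the velocity is zero, so both
  terms of the product rule vanish.\<close>

lemma radial_energy_deriv:
  assumes v: "v \<in> U" and t: "0 < t" "t < 1"
  shows "((\<lambda>t. Q (t *\<^sub>R v) v) has_real_derivative 0) (at t)"
proof -
  define c where "c = chart_at M (ex (t *\<^sub>R v))"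
  have "t *\<^sub>R v \<in> U" using scale_U[OF v] t by simp
  then have c: "c \<in> atlas M" "t *\<^sub>R v \<in> V c" using V_chart_at by (simp_all add: c_def)
  let ?T = "{0<..<1} \<inter> (\<lambda>t::real. t *\<^sub>R v) -` V c"
  have "((\<lambda>t. Inn c (F c (t *\<^sub>R v)) (DF c (t *\<^sub>R v) v) (DF c (t *\<^sub>R v) v)) has_real_derivative 0) (at t)"
    by (rule DERIV_cong[OF metric_chart.inn_has_derivative[OF metric_chart[OF c(1)] F_curve[OF c] F_img[OF c(2)]
          geodesic_equation[OF c(1) v t c(2)] geodesic_equation[OF c(1) v t c(2)]]])
      (simp add: metric_chart.inn_bilinear[OF metric_chart[OF c(1)]])
  then show ?thesis
    by (rule has_field_derivative_transform_within_open[OF _ radial_open[OF c(1), of v]])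
      (use c t in \<open>auto simp: Q_eq[OF c(1)]\<close>)
qed

lemma radial_energy:
  assumes v: "v \<in> U" and t: "0 \<le> t" "t < 1"
  shows "Q (t *\<^sub>R v) v = metric_at M x v v"
proof (cases "t = 0")
  case False
  have "Q (t *\<^sub>R v) v = Q (0 *\<^sub>R v) v"
  proof (rule DERIV_isconst2[where f="\<lambda>t. Q (t *\<^sub>R v) v" and a=0 and b=t])
    show "continuous_on {0..t} (\<lambda>t. Q (t *\<^sub>R v) v)"
      unfolding continuous_on_def
    proof
      fix s assume "s \<in> {0..t}"
      then have "s *\<^sub>R v \<in> U" using scale_U[OF v, of s] t by simp
      then show "((\<lambda>t. Q (t *\<^sub>R v) v) \<longlongrightarrow> Q (s *\<^sub>R v) v) (at s within {0..t})"
        by (intro Q_tendsto tendsto_intros)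
    qed
    show "((\<lambda>t. Q (t *\<^sub>R v) v) has_real_derivative 0) (at s)" if "0 < s" "s < t" for s
      using radial_energy_deriv[OF v, of s] that t by simp
  qed (use False t in auto)
  then show ?thesis by (simp add: Q_0)
qed (simp add: Q_0)

text \<open>In the preferred chart of \<open>z\<close> the expressions \<open>curvature_op\<close>
  and \<open>curv\<close> coincide literally, so the hypothesis on sectional curvature can be fed
  into \<open>curv_bound\<close>.\<close>

lemma curvature_bound_chart:
  assumes K: "0 \<le> K" and sec: "\<And>u v. u \<noteq> v \<Longrightarrow> independent {u, v} \<Longrightarrow> sectional_curvature M z u v \<le> K"
    and z: "z \<in> points M"
  defines "c \<equiv> chart_at M z"
  shows "Inn c (chart_map c z) (metric_chart.curv M c (chart_map c z) u v v) u
    \<le> K * (Inn c (chart_map c z) u u * Inn c (chart_map c z) v v)"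
proof (rule metric_chart.curv_bound[OF metric_chart _ K])
  show c: "c \<in> atlas M" using chart_at[OF z] by (simp add: c_def)
  show "chart_map c z \<in> chart_map c ` chart_dom c" using chart_at[OF z] by (simp add: c_def)
  have curv: "metric_chart.curv M c (chart_map c z) u v w = curvature_op M z u v w" for u v w
    unfolding curvature_op_def metric_chart.curv_def[OF metric_chart[OF c]] by (simp only: c_def)
  show "Inn c (chart_map c z) (metric_chart.curv M c (chart_map c z) u v v) u /
      (Inn c (chart_map c z) u u * Inn c (chart_map c z) v v - (Inn c (chart_map c z) u v)\<^sup>2) \<le> K"
    if "u \<noteq> v" "independent {u, v}" for u v
    using sec[OF that] by (simp add: curv sectional_curvature_def metric_at_eq[OF z] c_def[symmetric])
qed

text \<open>Sturm comparison with q = |J|^2 and m = K |v|^2. If D is the covariant derivative of J,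
  then p = <D, J>, and Jacobi's equation gives p' = |D|^2 - <R(J, W) W, J>. Cauchy-Schwarz bounds
  p^2 by |D|^2 q, and the curvature bound together with |W| = |v| handles the other term.\<close>

lemma Q_lower:
  assumes v: "v \<in> U" and K: "0 \<le> K" "K * metric_at M x v v \<le> 1"
    and sec: "\<And>z u v. z \<in> points M \<Longrightarrow> u \<noteq> v \<Longrightarrow> independent {u, v} \<Longrightarrow> sectional_curvature M z u v \<le> K"
  shows "25 / 36 * metric_at M x w w \<le> Q v w"
proof (cases "w = 0")
  case True
  then show ?thesis using Q_scale[OF v, of 0 0] by (simp add: metric_at_def)
next
  case False
  define q where "q t = Q (t *\<^sub>R v) (t *\<^sub>R w)" for t
  \<comment> \<open>Defining \<open>p\<close> from \<open>q\<close> alone makes it independent of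
    the chart; \<open>pT\<close> identifies it locally with the pairing of J and its covariant
    derivative.\<close>
  define p where "p t = deriv q t / 2" for t
  let ?e = "metric_at M x v v"
  have tU: "t *\<^sub>R v \<in> U" if "0 \<le> t" "t \<le> 1" for t using scale_U[OF v, of t] that by simp
  have main: "(q has_real_derivative 2 * p t) (at t) \<and>
      (\<exists>p'. (p has_real_derivative p') (at t) \<and> (p t)\<^sup>2 - K * ?e * (q t)\<^sup>2 \<le> p' * q t)" if t: "0 < t" "t < 1" for t
  proof -
    define c where "c = chart_at M (ex (t *\<^sub>R v))"
    have c: "c \<in> atlas M" "t *\<^sub>R v \<in> V c" using V_chart_at[OF tU, of t] t by (simp_all add: c_def)
    note mc = metric_chart[OF c(1)]
    let ?J = "\<lambda>\<tau>. DF c (\<tau> *\<^sub>R v) (\<tau> *\<^sub>R w)" and ?W = "\<lambda>\<tau>. DF c (\<tau> *\<^sub>R v) v" and ?y = "\<lambda>\<tau>. F c (\<tau> *\<^sub>R v)"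
    let ?P = "\<lambda>\<tau>. D2 c (\<tau> *\<^sub>R v) (\<tau> *\<^sub>R w) v + DF c (\<tau> *\<^sub>R v) w"
    let ?D = "\<lambda>\<tau>. ?P \<tau> + Chr c (?y \<tau>) (?W \<tau>) (?J \<tau>)"
    define T where "T = {0<..<1} \<inter> (\<lambda>t::real. t *\<^sub>R v) -` V c"
    have T: "open T" "t \<in> T" using radial_open[OF c(1)] c t by (simp_all add: T_def)
    have qT: "q \<tau> = Inn c (?y \<tau>) (?J \<tau>) (?J \<tau>)" if "\<tau> \<in> T" for \<tau>
      using that by (simp add: q_def T_def Q_eq[OF c(1)])
    have dq: "(q has_real_derivative 2 * Inn c (?y \<tau>) (?D \<tau>) (?J \<tau>)) (at \<tau>)" if \<tau>: "\<tau> \<in> T" for \<tau>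
    proof -
      have \<tau>': "0 < \<tau>" "\<tau> < 1" "\<tau> *\<^sub>R v \<in> V c" using \<tau> by (simp_all add: T_def)
      note J = jacobi_fields(1)[OF c(1) v \<tau>', of w]
      have "((\<lambda>\<tau>. Inn c (?y \<tau>) (?J \<tau>) (?J \<tau>)) has_real_derivative 2 * Inn c (?y \<tau>) (?D \<tau>) (?J \<tau>)) (at \<tau>)"
        by (rule DERIV_cong[OF metric_chart.inn_has_derivative[OF mc F_curve[OF c(1) \<tau>'(3)] F_img[OF \<tau>'(3)] J J]])
          (simp add: metric_chart.inn_sym[OF mc F_img[OF \<tau>'(3)], of "?J \<tau>"])
      then show ?thesis by (rule has_field_derivative_transform_within_open[OF _ T(1) \<tau>]) (simp add: qT)
    qed
    have pT: "p \<tau> = Inn c (?y \<tau>) (?D \<tau>) (?J \<tau>)" if "\<tau> \<in> T" for \<tau>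
      using DERIV_imp_deriv[OF dq[OF that]] by (simp add: p_def)
    let ?R = "metric_chart.curv M c (?y t) (?J t) (?W t) (?W t)"
    note J = jacobi_fields[OF c(1) v t c(2), of w]
    note im = F_img[OF c(2)]
    have dD: "(?D has_vector_derivative - ?R - Chr c (?y t) (?W t) (?D t)) (at t)"
      by (rule metric_chart.jacobi_equation[OF mc F_curve[OF c] im geodesic_equation[OF c(1) v t c(2)] J])
    have "((\<lambda>\<tau>. Inn c (?y \<tau>) (?D \<tau>) (?J \<tau>)) has_real_derivative
        Inn c (?y t) (?D t) (?D t) - Inn c (?y t) ?R (?J t)) (at t)"
      by (rule DERIV_cong[OF metric_chart.inn_has_derivative[OF mc F_curve[OF c] im dD J(1)]])
        (simp add: metric_chart.inn_bilinear[OF mc])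
    then have dp: "(p has_real_derivative Inn c (?y t) (?D t) (?D t) - Inn c (?y t) ?R (?J t)) (at t)"
      by (rule has_field_derivative_transform_within_open[OF _ T]) (simp add: pT)
    have "ex (t *\<^sub>R v) \<in> points M" by (rule ex_points[OF tU]) (use t in simp_all)
    from curvature_bound_chart[OF K(1) sec[OF this] this]
    have R: "Inn c (?y t) ?R (?J t) \<le> K * (q t * Inn c (?y t) (?W t) (?W t))"
      unfolding qT[OF T(2)] by (simp add: c_def[symmetric] F_def)
    have We: "Inn c (?y t) (?W t) (?W t) = ?e"
      using radial_energy[OF v, of t] t by (simp add: Q_eq[OF c])
    have cs: "(p t)\<^sup>2 \<le> Inn c (?y t) (?D t) (?D t) * q t"
      unfolding pT[OF T(2)] qT[OF T(2)] by (rule metric_chart.inn_cauchy_schwarz[OF mc im])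
    have q0: "0 \<le> q t" unfolding qT[OF T(2)] by (rule metric_chart.inn_nonneg[OF mc im])
    have "Inn c (?y t) ?R (?J t) * q t \<le> K * (q t * ?e) * q t"
      using mult_right_mono[OF R q0] by (simp only: We)
    then have "(p t)\<^sup>2 - K * ?e * (q t)\<^sup>2 \<le> (Inn c (?y t) (?D t) (?D t) - Inn c (?y t) ?R (?J t)) * q t"
      using cs by (simp add: algebra_simps power2_eq_square)
    with dp dq[OF T(2)] show ?thesis unfolding pT[OF T(2), symmetric] by blast
  qed
  have nn: "0 \<le> ?e" by (rule metric_at_nonneg[OF x])
  show ?thesis
  proof (rule sturm_comparison[where q=q and p=p and m="K * ?e"])
    show "0 < q t" if "0 < t" "t < 1" for t
      unfolding q_def by (rule Q_pos[OF tU]) (use that False in auto)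
    \<comment> \<open>By homogeneity q t / t^2 is the value of \<open>Q\<close> at tv on the fixed
      vector \<open>w\<close>, which is continuous down to t = 0.\<close>
    show "((\<lambda>t. q t / t\<^sup>2) \<longlongrightarrow> metric_at M x w w) (at_right 0)"
    proof (rule Lim_transform_eventually)
      have "((\<lambda>t. Q (t *\<^sub>R v) w) \<longlongrightarrow> Q 0 w) (at_right 0)"
        by (rule Q_tendsto[OF zero_U]) (auto intro!: tendsto_eq_intros)
      then show "((\<lambda>t. Q (t *\<^sub>R v) w) \<longlongrightarrow> metric_at M x w w) (at_right 0)" by (simp add: Q_0)
      show "\<forall>\<^sub>F t in at_right 0. Q (t *\<^sub>R v) w = q t / t\<^sup>2"
        by (rule eventually_mono[OF eventually_at_right_real[of 0 1]])
          (use tU in \<open>auto simp: q_def Q_scale\<close>)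
    qed
    have "((\<lambda>t. Q (t *\<^sub>R v) (t *\<^sub>R w)) \<longlongrightarrow> Q v w) (at_left 1)"
      by (rule Q_tendsto[OF v]) (auto intro!: tendsto_eq_intros)
    then show "(q \<longlongrightarrow> Q v w) (at_left 1)" by (simp add: q_def[abs_def])
  qed (use main K nn metric_at_nonneg[OF x] in auto)
qed

end

section \<open>The Riemannian measure\<close>

lemma det_frame:
  fixes G C :: "real^'n^'n"
  assumes "transpose C ** G ** C = mat 1"
  shows "det C \<noteq> 0" "sqrt (det G) * \<bar>det C\<bar> = 1"
proof -
  have 1: "det G * (det C)\<^sup>2 = 1"
    using arg_cong[OF assms, of det] by (simp add: det_mul det_transpose power2_eq_square mult_ac)
  then show "det C \<noteq> 0" by auto
  have "sqrt (det G) * \<bar>det C\<bar> = sqrt (det G * (det C)\<^sup>2)" by (simp add: real_sqrt_mult)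
  then show "sqrt (det G) * \<bar>det C\<bar> = 1" using 1 by simp
qed

lemma suminf_swap_ennreal: "(\<Sum>i. \<Sum>k. f i k) = (\<Sum>k. \<Sum>i. f i k)" for f :: "nat \<Rightarrow> nat \<Rightarrow> ennreal"
proof -
  have "(\<Sum>i. \<Sum>k. f i k) = (\<integral>\<^sup>+i. (\<Sum>k. f i k) \<partial>count_space UNIV)"
    by (simp add: nn_integral_count_space_nat)
  also have "\<dots> = (\<Sum>k. \<integral>\<^sup>+i. f i k \<partial>count_space UNIV)"
    by (rule nn_integral_suminf) simp
  finally show ?thesis by (simp add: nn_integral_count_space_nat)
qed

section \<open>Gluing chart volumes to the Riemannian measure\<close>

context riem
begin

abbreviation "borel_sets \<equiv> sigma_sets (points M) {U. openin (top_of M) U}"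

lemma opens_Pow: "{U. openin (top_of M) U} \<subseteq> Pow (points M)"
  using openin_subset by blast

interpretation borel: sigma_algebra "points M" borel_sets
  by (rule sigma_algebra_sigma_sets[OF opens_Pow])

lemma open_borel: "openin (top_of M) W \<Longrightarrow> W \<in> borel_sets"
  by (rule sigma_sets.Basic) simp

definition vdens :: "('a, 'n) chart \<Rightarrow> real^'n \<Rightarrow> ennreal" where
  "vdens c y = ennreal (sqrt (det (gcoeff M c y)))"

definition vol :: "('a, 'n) chart \<Rightarrow> 'a set \<Rightarrow> ennreal" where
  "vol c A = (\<integral>\<^sup>+y\<in>chart_map c ` A. vdens c y \<partial>lborel)"

text \<open>Stated with the intersection because the class of such sets is then stable under
  complements, as induction over the generated sigma-algebra requires; injectivity of the chart
  handles the complement.\<close>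

lemma chart_image_Int_borel:
  assumes c: "c \<in> atlas M"
  shows "A \<in> borel_sets \<Longrightarrow> chart_map c ` (A \<inter> chart_dom c) \<in> sets borel"
proof (induction rule: sigma_sets.induct)
  case (Basic W)
  then have "openin (top_of M) (W \<inter> chart_dom c)" using dom_open[OF c] by blast
  then show ?case using chart_image_open[OF c] by simp
next
  case (Compl A)
  have "chart_map c ` ((points M - A) \<inter> chart_dom c) = chart_map c ` chart_dom c - chart_map c ` (A \<inter> chart_dom c)"
  proof -
    have "(points M - A) \<inter> chart_dom c = chart_dom c - A \<inter> chart_dom c" using dom_sub[OF c] by blast
    then show ?thesis by (simp add: inj_on_image_set_diff[OF chart_inj[OF c] Diff_subset Int_lower2])
  qed
  then show ?case using Compl img_open[OF c] by simp
next
  case (Union A)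
  have "chart_map c ` (\<Union> (range A) \<inter> chart_dom c) = (\<Union>i. chart_map c ` (A i \<inter> chart_dom c))" by blast
  then show ?case using Union by simp
qed simp

lemma chart_image_borel:
  "c \<in> atlas M \<Longrightarrow> A \<in> borel_sets \<Longrightarrow> A \<subseteq> chart_dom c \<Longrightarrow> chart_map c ` A \<in> sets borel"
  using chart_image_Int_borel[of c A] by (simp add: Int_absorb2)

lemma vdens_measurable:
  assumes c: "c \<in> atlas M"
  shows "(\<lambda>y. vdens c y * indicator (chart_map c ` chart_dom c) y) \<in> borel_measurable borel"
proof -
  have g: "continuous_on (chart_map c ` chart_dom c) (gcoeff M c)"
    by (rule smooth_onD(3)[OF metric_chart.smooth_g[OF metric_chart[OF c]]])
  have "continuous_on (chart_map c ` chart_dom c) (\<lambda>y. sqrt (det (gcoeff M c y)))"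
    unfolding det_def
    by (intro continuous_on_real_sqrt continuous_on_sum continuous_on_mult continuous_on_const continuous_on_prod
        bounded_linear.continuous_on[OF bounded_linear_vec_nth bounded_linear.continuous_on[OF bounded_linear_vec_nth g]])
  then have "(\<lambda>y. indicator (chart_map c ` chart_dom c) y *\<^sub>R sqrt (det (gcoeff M c y))) \<in> borel_measurable borel"
    by (intro borel_measurable_continuous_on_indicator) (simp_all add: img_open[OF c])
  then have "(\<lambda>y. ennreal (indicator (chart_map c ` chart_dom c) y *\<^sub>R sqrt (det (gcoeff M c y)))) \<in> borel_measurable borel"
    by simp
  also have "(\<lambda>y. ennreal (indicator (chart_map c ` chart_dom c) y *\<^sub>R sqrt (det (gcoeff M c y))))
      = (\<lambda>y. vdens c y * indicator (chart_map c ` chart_dom c) y)"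
    by (auto simp: vdens_def fun_eq_iff indicator_def)
  finally show ?thesis .
qed

lemma vol_countably_additive:
  fixes A :: "nat \<Rightarrow> 'a set"
  assumes c: "c \<in> atlas M" and A: "\<And>k. A k \<in> borel_sets" "\<And>k. A k \<subseteq> chart_dom c" "disjoint_family A"
  shows "vol c (\<Union>k. A k) = (\<Sum>k. vol c (A k))"
proof -
  have disj: "disjoint_family (\<lambda>k. chart_map c ` A k)"
    unfolding disjoint_family_on_def
  proof (intro ballI impI)
    fix i j :: nat assume "i \<noteq> j"
    then have "A i \<inter> A j = {}" using A(3) by (simp add: disjoint_family_on_def)
    then show "chart_map c ` A i \<inter> chart_map c ` A j = {}"
      using inj_on_image_Int[OF chart_inj[OF c] A(2) A(2), of i j] by simp
  qed
  have "vol c (\<Union>k. A k) = (\<integral>\<^sup>+y. (\<Sum>k. vdens c y * indicator (chart_map c ` A k) y) \<partial>lborel)"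
    unfolding vol_def
  proof (rule nn_integral_cong)
    fix y :: "real^'n"
    have "vdens c y * indicator (chart_map c ` (\<Union>k. A k)) y = vdens c y * (\<Sum>k. indicator (chart_map c ` A k) y)"
      using suminf_indicator[OF disj, of y] by (simp add: image_UN)
    then show "vdens c y * indicator (chart_map c ` (\<Union>k. A k)) y = (\<Sum>k. vdens c y * indicator (chart_map c ` A k) y)"
      by simp
  qed
  also have "\<dots> = (\<Sum>k. vol c (A k))"
    unfolding vol_def
  proof (rule nn_integral_suminf)
    fix k
    have [measurable]: "chart_map c ` A k \<in> sets borel" by (rule chart_image_borel[OF c A(1,2)])
    have "(\<lambda>y. (vdens c y * indicator (chart_map c ` chart_dom c) y) * indicator (chart_map c ` A k) y) \<in> borel_measurable lborel"
      using vdens_measurable[OF c] by measurable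
    also have "(\<lambda>y. (vdens c y * indicator (chart_map c ` chart_dom c) y) * indicator (chart_map c ` A k) y)
      = (\<lambda>y. vdens c y * indicator (chart_map c ` A k) y)"
      using A(2)[of k] by (auto simp: fun_eq_iff indicator_def)
    finally show "(\<lambda>y. vdens c y * indicator (chart_map c ` A k) y) \<in> borel_measurable lborel" .
  qed
  finally show ?thesis .
qed

text \<open>By the transformation law of the metric, sqrt (det g) changes by the absolute Jacobian
  determinant of the transition map, exactly the factor in the change of variables.\<close>

lemma vol_change:
  assumes c: "c \<in> atlas M" "c' \<in> atlas M" and B: "B \<in> borel_sets" "B \<subseteq> chart_dom c" "B \<subseteq> chart_dom c'"
  shows "vol c' B = vol c B"
proof -
  let ?f = "transition c c'" and ?g = "transition c' c"
  define D where "D = chart_dom c \<inter> chart_dom c'"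
  have Dop: "openin (top_of M) D" unfolding D_def by (intro openin_Int dom_open c)
  have f: "?f (chart_map c x) = chart_map c' x" if "x \<in> D" for x
    using that c by (simp add: transition_def D_def chart_inv_left)
  have g: "?g (chart_map c' x) = chart_map c x" if "x \<in> D" for x
    using that c by (simp add: transition_def D_def chart_inv_left)
  have sm: "smooth_on (chart_map c ` D) ?f" "smooth_on (chart_map c' ` D) ?g"
  proof -
    have "smooth_on (chart_map a ` (chart_dom a \<inter> chart_dom b)) (transition a b)" if "a \<in> atlas M" "b \<in> atlas M" for a b
      using manifold that unfolding smooth_manifold_def by blast
    from this[OF c] this[OF c(2,1)] show "smooth_on (chart_map c ` D) ?f" "smooth_on (chart_map c' ` D) ?g"
      by (simp_all only: D_def Int_commute)
  qed
  have hom: "homeomorphism (chart_map c ` D) (chart_map c' ` D) ?f ?g"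
    unfolding homeomorphism_def
    using smooth_onD(3)[OF sm(1)] smooth_onD(3)[OF sm(2)] by (simp add: f g image_image cong: image_cong)
  have der: "(?f has_derivative frechet_derivative ?f (at y)) (at y)" if "y \<in> chart_map c ` D" for y
    using smooth_onD(1)[OF sm(1) that] by (simp add: frechet_derivative_works)
  have cont: "continuous_on (chart_map c ` D) (\<lambda>y. det (matrix (frechet_derivative ?f (at y))))"
  proof -
    have "continuous_on (chart_map c ` D) (\<lambda>y. matrix (frechet_derivative ?f (at y)) $ i $ j)" for i j
      using bounded_linear.continuous_on[OF bounded_linear_vec_nth smooth_onD(3)[OF smooth_onD(2)[OF sm(1)]], of j i]
      by (simp add: matrix_def partial_def)
    then show ?thesis
      unfolding det_def by (intro continuous_on_sum continuous_on_mult continuous_on_const continuous_on_prod)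
  qed
  have BD: "B \<subseteq> D" using B by (simp add: D_def)
  have img: "?f ` (chart_map c ` B) = chart_map c' ` B"
    unfolding image_image by (rule image_cong[OF refl f]) (use BD in blast)
  have "(\<lambda>y. (vdens c' y * indicator (chart_map c' ` chart_dom c') y) * indicator (chart_map c' ` D) y) \<in> borel_measurable borel"
  proof (rule borel_measurable_times_ennreal[OF vdens_measurable[OF c(2)]])
    show "indicator (chart_map c' ` D) \<in> borel_measurable borel"
      by (rule borel_measurable_indicator) (use chart_image_open[OF c(2) Dop] in \<open>simp add: D_def\<close>)
  qed
  also have "(\<lambda>y. (vdens c' y * indicator (chart_map c' ` chart_dom c') y) * indicator (chart_map c' ` D) y)
     = (\<lambda>y. vdens c' y * indicator (chart_map c' ` D) y)"
    by (auto simp: fun_eq_iff indicator_def D_def)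
  finally have meas: "(\<lambda>y. vdens c' y * indicator (chart_map c' ` D) y) \<in> borel_measurable borel" .
  have "vol c' B = (\<integral>\<^sup>+y\<in>?f ` (chart_map c ` B). vdens c' y \<partial>lborel)"
    by (simp add: vol_def img)
  also have "\<dots> = (\<integral>\<^sup>+y\<in>chart_map c ` B. vdens c' (?f y) * ennreal \<bar>det (matrix (frechet_derivative ?f (at y)))\<bar> \<partial>lborel)"
    by (rule nn_integral_differentiable_image[OF hom _ _ der cont _ _ meas])
      (use chart_image_open[OF c(1) Dop] chart_image_open[OF c(2) Dop] chart_image_borel[OF c(1) B(1,2)] BD in
        \<open>auto simp: D_def\<close>)
  also have "\<dots> = vol c B"
    unfolding vol_def
  proof (rule nn_integral_cong)
    fix y :: "real^'n"
    show "vdens c' (?f y) * ennreal \<bar>det (matrix (frechet_derivative ?f (at y)))\<bar> * indicator (chart_map c ` B) y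
      = vdens c y * indicator (chart_map c ` B) y"
    proof (cases "y \<in> chart_map c ` B")
      case True
      then obtain x where x: "x \<in> B" "y = chart_map c x" by blast
      then have xD: "x \<in> D" using BD by blast
      let ?J = "jacobian_matrix ?f y"
      have "det (gcoeff M c y) = (det ?J)\<^sup>2 * det (gcoeff M c' (?f y))"
        using gcoeff_change[OF c, of x] xD x(2) f[OF xD]
        by (simp add: D_def det_mul det_transpose power2_eq_square)
      then have "sqrt (det (gcoeff M c y)) = \<bar>det ?J\<bar> * sqrt (det (gcoeff M c' (?f y)))"
        by (simp add: real_sqrt_mult)
      then have "vdens c y = vdens c' (?f y) * ennreal \<bar>det ?J\<bar>"
        by (simp add: vdens_def ennreal_mult' mult.commute)
      then show ?thesis by (simp add: jacobian_matrix_def)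
    qed simp
  qed
  finally show ?thesis .
qed

text \<open>Second countability yields the Lindelof property, hence a countable subfamily of chart
  domains covers. It is enumerated with possible repetitions, so finite subcovers are included;
  nonemptiness makes the enumeration possible.\<close>

lemma countable_atlas:
  assumes "points M \<noteq> {}"
  obtains cs :: "nat \<Rightarrow> ('a, 'n) chart" where "\<And>i. cs i \<in> atlas M" "(\<Union>i. chart_dom (cs i)) = points M"
proof -
  have L: "Lindelof_space (top_of M)"
    by (rule second_countable_imp_Lindelof_space[OF second_countable])
  have op: "\<forall>W\<in>chart_dom ` atlas M. openin (top_of M) W" using dom_open by blast
  have cov: "\<Union> (chart_dom ` atlas M) = points M"
    using manifold unfolding smooth_manifold_def by blast
  obtain \<V> where V: "countable \<V>" "\<V> \<subseteq> chart_dom ` atlas M" "\<Union> \<V> = points M"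
    using mp[OF spec[OF L[unfolded Lindelof_space_def]] conjI[OF op cov]] by (elim exE conjE)
  have "\<V> \<noteq> {}" using V(3) assms by blast
  define cs where "cs i = (SOME c. c \<in> atlas M \<and> chart_dom c = from_nat_into \<V> i)" for i
  have cs: "cs i \<in> atlas M \<and> chart_dom (cs i) = from_nat_into \<V> i" for i
  proof -
    have "from_nat_into \<V> i \<in> chart_dom ` atlas M" using from_nat_into[OF \<open>\<V> \<noteq> {}\<close>] V(2) by blast
    then have "\<exists>c. c \<in> atlas M \<and> chart_dom c = from_nat_into \<V> i" by (elim imageE) (rule exI, simp)
    from someI_ex[OF this] show ?thesis unfolding cs_def .
  qed
  have "(\<Union>i. chart_dom (cs i)) = \<Union> (range (from_nat_into \<V>))" using cs by simp
  also have "\<dots> = points M" using range_from_nat_into[OF \<open>\<V> \<noteq> {}\<close> V(1)] V(3) by simp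
  finally show ?thesis by (rule that[rotated]) (simp add: cs)
qed

text \<open>The device for passing from one chart to the whole manifold: existence and uniqueness of
  the measure, and the volume of a geodesic ball, are all reduced to Borel pieces lying in single
  charts.\<close>

definition is_partition :: "(nat \<Rightarrow> ('a, 'n) chart) \<Rightarrow> (nat \<Rightarrow> 'a set) \<Rightarrow> bool" where
  "is_partition cs D \<longleftrightarrow> (\<forall>i. cs i \<in> atlas M \<and> D i \<subseteq> chart_dom (cs i) \<and> D i \<in> borel_sets) \<and>
     disjoint_family D \<and> (\<Union>i. D i) = points M"

lemma ex_partition:
  assumes "points M \<noteq> {}"
  shows "\<exists>cs D. is_partition cs D"
proof -
  obtain cs :: "nat \<Rightarrow> ('a, 'n) chart" where cs: "\<And>i. cs i \<in> atlas M" "(\<Union>i. chart_dom (cs i)) = points M"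
    using countable_atlas[OF assms] by blast
  let ?D = "disjointed (\<lambda>i. chart_dom (cs i))"
  have "range (\<lambda>i. chart_dom (cs i)) \<subseteq> borel_sets" using open_borel[OF dom_open[OF cs(1)]] by blast
  then have "range ?D \<subseteq> borel_sets" by (rule borel.range_disjointed_sets)
  then have "?D i \<in> borel_sets" for i by blast
  then have "is_partition cs ?D"
    unfolding is_partition_def UN_disjointed_eq
    by (intro conjI allI cs disjoint_family_disjointed disjointed_subset)
  then show ?thesis by blast
qed

definition is_riem_measure :: "'a measure \<Rightarrow> bool" where
  "is_riem_measure \<mu> \<longleftrightarrow> space \<mu> = points M \<and> sets \<mu> = borel_sets \<and>
     (\<forall>c\<in>atlas M. \<forall>A\<in>sets \<mu>. A \<subseteq> chart_dom c \<longrightarrow> emeasure \<mu> A = vol c A)"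

lemma emeasure_partition:
  assumes \<mu>: "is_riem_measure \<mu>" and P: "is_partition cs D" and A: "A \<in> borel_sets"
  shows "emeasure \<mu> A = (\<Sum>i. emeasure \<mu> (A \<inter> D i))"
proof -
  have AD: "A \<inter> D i \<in> borel_sets" for i using A P by (simp add: is_partition_def borel.Int)
  have "A = (\<Union>i. A \<inter> D i)" using borel.sets_into_space[OF A] P by (auto simp: is_partition_def)
  then have "emeasure \<mu> A = emeasure \<mu> (\<Union>i. A \<inter> D i)" by simp
  also have "\<dots> = (\<Sum>i. emeasure \<mu> (A \<inter> D i))"
  proof (rule suminf_emeasure[symmetric])
    show "range (\<lambda>i. A \<inter> D i) \<subseteq> sets \<mu>" using AD \<mu> by (auto simp: is_riem_measure_def)
    show "disjoint_family (\<lambda>i. A \<inter> D i)"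
      using P unfolding is_partition_def disjoint_family_on_def by blast
  qed
  finally show ?thesis .
qed

lemma riem_measure_unique:
  assumes ne: "points M \<noteq> {}" and "is_riem_measure \<mu>" "is_riem_measure \<nu>"
  shows "\<mu> = \<nu>"
proof (rule measure_eqI)
  show "sets \<mu> = sets \<nu>" using assms by (simp add: is_riem_measure_def)
  fix A assume "A \<in> sets \<mu>"
  then have A: "A \<in> borel_sets" using assms by (simp add: is_riem_measure_def)
  obtain cs D where P: "is_partition cs D" using ex_partition[OF ne] by blast
  have "emeasure \<mu> (A \<inter> D i) = emeasure \<nu> (A \<inter> D i)" for i
  proof -
    have "A \<inter> D i \<in> borel_sets" "A \<inter> D i \<subseteq> chart_dom (cs i)" "cs i \<in> atlas M"
      using A P by (auto simp: is_partition_def borel.Int)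
    then show ?thesis using assms(2,3) by (simp add: is_riem_measure_def)
  qed
  then show "emeasure \<mu> A = emeasure \<nu> A"
    unfolding emeasure_partition[OF assms(2) P A] emeasure_partition[OF assms(3) P A] by simp
qed

text \<open>The measure sums chart volumes over the pieces of a partition. On a set inside some
  other chart each summand can be recomputed in that chart by \<open>vol_change\<close>, and
  countable additivity there reassembles the volume.\<close>

lemma riem_measure_exists:
  assumes ne: "points M \<noteq> {}"
  shows "\<exists>\<mu>. is_riem_measure \<mu>"
proof -
  obtain cs D where P: "is_partition cs D" using ex_partition[OF ne] by blast
  then have cs: "cs i \<in> atlas M" "D i \<subseteq> chart_dom (cs i)" "D i \<in> borel_sets" for i
    by (simp_all add: is_partition_def)
  have Dd: "disjoint_family D" and DU: "(\<Union>i. D i) = points M" using P by (simp_all add: is_partition_def)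
  define m where "m A = (\<Sum>i. vol (cs i) (A \<inter> D i))" for A
  have ca: "countably_additive borel_sets m"
    unfolding countably_additive_def
  proof (intro allI impI)
    fix A :: "nat \<Rightarrow> 'a set" assume A: "range A \<subseteq> borel_sets" "disjoint_family A" "\<Union> (range A) \<in> borel_sets"
    have "m (\<Union> (range A)) = (\<Sum>i. \<Sum>k. vol (cs i) (A k \<inter> D i))"
    proof -
      have "vol (cs i) (\<Union> (range A) \<inter> D i) = (\<Sum>k. vol (cs i) (A k \<inter> D i))" for i
      proof -
        have "vol (cs i) (\<Union>k. A k \<inter> D i) = (\<Sum>k. vol (cs i) (A k \<inter> D i))"
        proof (rule vol_countably_additive[OF cs(1)])
          show "A k \<inter> D i \<in> borel_sets" for k using A(1) cs(3) by (intro borel.Int) auto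
          show "A k \<inter> D i \<subseteq> chart_dom (cs i)" for k using cs(2) by blast
          show "disjoint_family (\<lambda>k. A k \<inter> D i)" using A(2) unfolding disjoint_family_on_def by blast
        qed
        then show ?thesis by (simp only: Int_UN_distrib2 UN_extend_simps(4))
      qed
      then show ?thesis by (simp add: m_def)
    qed
    also have "\<dots> = (\<Sum>k. m (A k))" unfolding m_def by (rule suminf_swap_ennreal)
    finally show "(\<Sum>k. m (A k)) = m (\<Union> (range A))" by simp
  qed
  have pos: "positive borel_sets m" by (simp add: positive_def m_def vol_def)
  define \<mu> where "\<mu> = measure_of (points M) {U. openin (top_of M) U} m"
  have sp: "space \<mu> = points M" "sets \<mu> = borel_sets"
    by (simp_all add: \<mu>_def space_measure_of[OF opens_Pow] sets_measure_of[OF opens_Pow])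
  have em: "emeasure \<mu> A = m A" if "A \<in> borel_sets" for A
    by (rule emeasure_measure_of[OF \<mu>_def opens_Pow]) (use pos ca sp that in simp_all)
  have "emeasure \<mu> A = vol c A" if c: "c \<in> atlas M" and A: "A \<in> borel_sets" "A \<subseteq> chart_dom c" for c A
  proof -
    have AD: "A \<inter> D i \<in> borel_sets" for i using A cs(3) by (intro borel.Int)
    have "vol (cs i) (A \<inter> D i) = vol c (A \<inter> D i)" for i
      by (rule vol_change[OF c cs(1) AD]) (use A(2) cs(2) in blast)+
    then have "m A = (\<Sum>i. vol c (A \<inter> D i))" by (simp add: m_def)
    also have "\<dots> = vol c (\<Union>i. A \<inter> D i)"
      by (rule vol_countably_additive[symmetric, OF c AD])
        (use A Dd in \<open>auto simp: disjoint_family_on_def\<close>)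
    also have "(\<Union>i. A \<inter> D i) = A" using DU borel.sets_into_space[OF A(1)] by blast
    finally show ?thesis using em[OF A(1)] by simp
  qed
  then have "is_riem_measure \<mu>" using sp by (simp add: is_riem_measure_def)
  then show ?thesis by blast
qed

lemma riem_measure: "points M \<noteq> {} \<Longrightarrow> is_riem_measure (riem_measure M)"
proof -
  assume ne: "points M \<noteq> {}"
  have "riem_measure M = (THE \<mu>. is_riem_measure \<mu>)"
    by (simp add: riem_measure_def is_riem_measure_def vol_def vdens_def)
  moreover have "\<exists>!\<mu>. is_riem_measure \<mu>"
    using riem_measure_exists[OF ne] riem_measure_unique[OF ne] by blast
  ultimately show ?thesis using theI'[of is_riem_measure] by simp
qed

end

section \<open>Volume of geodesic balls\<close>

lemma frame_inner:
  fixes C G :: "real^'n^'n"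
  assumes "transpose C ** G ** C = mat 1"
  shows "(C *v u) \<bullet> (G *v (C *v w)) = u \<bullet> w"
proof -
  have "(C *v u) \<bullet> (G *v (C *v w)) = u \<bullet> (transpose C *v (G *v (C *v w)))"
    by (metis dot_lmul_matrix vector_transpose_matrix)
  also have "transpose C *v (G *v (C *v w)) = w"
    using assms by (simp add: matrix_vector_mul_assoc matrix_mul_assoc)
  finally show ?thesis .
qed

context expball
begin

lemma borel_sets_Int:
  assumes "A \<in> borel_sets" "B \<in> borel_sets"
  shows "A \<inter> B \<in> borel_sets"
proof -
  interpret sigma_algebra "points M" borel_sets by (rule sigma_algebra_sigma_sets[OF opens_Pow])
  show ?thesis by (rule Int[OF assms])
qed

lemma preimage_borel: "A \<in> borel_sets \<Longrightarrow> {v \<in> U. ex v \<in> A} \<in> sets borel"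
proof (induction rule: sigma_sets.induct)
  case (Basic W)
  then show ?case using ex_preimage_open[of W] by simp
next
  case (Compl A)
  have "{v \<in> U. ex v \<in> points M - A} = U - {v \<in> U. ex v \<in> A}" using ex_points by blast
  then show ?case using Compl open_U by (simp only: sets.Diff borel_open)
next
  case (Union A)
  have "{v \<in> U. ex v \<in> \<Union> (range A)} = (\<Union>i. {v \<in> U. ex v \<in> A i})" by blast
  then show ?case using Union by (metis (no_types, lifting) sets.countable_nat_UN image_subsetI)
qed simp

text \<open>\<open>C\<close> is an orthonormal frame at \<open>x\<close> and \<open>Cy\<close> one
  at the image point. Between these frames the differential becomes \<open>?T\<close>, which
  stretches Euclidean norms by at least 5/6, the root of 25/36; \<open>det_lower_bound\<close>
  applies, and undoing the frame at the image point contributes the factor sqrt (det g).\<close>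

lemma jacobian_lower:
  fixes C :: "real^'n^'n"
  assumes C: "\<And>u w. metric_at M x (C *v u) (C *v w) = u \<bullet> w"
    and c: "c \<in> atlas M" and u: "C *v u \<in> V c"
    and low: "\<And>w. 25 / 36 * metric_at M x w w \<le> Q (C *v u) w"
  shows "(5/6) ^ CARD('n) \<le> sqrt (det (gcoeff M c (F c (C *v u)))) * \<bar>det (matrix (\<lambda>w. DF c (C *v u) (C *v w)))\<bar>"
proof -
  let ?y = "F c (C *v u)" and ?A = "\<lambda>w. DF c (C *v u) (C *v w)"
  note mc = metric_chart[OF c]
  have y: "?y \<in> chart_map c ` chart_dom c" by (rule F_img[OF u])
  obtain Cy :: "real^'n^'n" where Cy: "transpose Cy ** gcoeff M c ?y ** Cy = mat 1"
    using orthonormal_frame[OF metric_chart.sym_g[OF mc y] metric_chart.pos_g[OF mc y]] by blast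
  note d = det_frame[OF Cy]
  let ?T = "\<lambda>w. matrix_inv Cy *v ?A w"
  have linA: "linear ?A"
    using linear_compose[OF matrix_vector_mul_linear DF_linear[OF c u]] by (simp add: o_def)
  have linT: "linear ?T"
    using linear_compose[OF linA matrix_vector_mul_linear, of "matrix_inv Cy"] by (simp add: o_def)
  have "5/6 * norm w \<le> norm (?T w)" for w
  proof (rule power2_le_imp_le)
    have CT: "Cy *v ?T w = ?A w"
      by (simp add: matrix_vector_mul_assoc matrix_inv_inverse[OF d(1)])
    have "(norm (?T w))\<^sup>2 = ?T w \<bullet> ?T w" by (simp add: dot_square_norm)
    also have "\<dots> = (Cy *v ?T w) \<bullet> (gcoeff M c ?y *v (Cy *v ?T w))" by (rule frame_inner[OF Cy, symmetric])
    also have "\<dots> = Q (C *v u) (C *v w)"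
      unfolding CT by (simp add: Q_eq[OF c u] inn_def[OF c])
    finally show "(5/6 * norm w)\<^sup>2 \<le> (norm (?T w))\<^sup>2"
      using low[of "C *v w"] by (simp add: C dot_square_norm power_mult_distrib power_divide)
  qed simp
  then have "(5/6) ^ CARD('n) \<le> \<bar>det (matrix ?T)\<bar>"
    by (intro det_lower_bound[OF linT]) auto
  also have "matrix ?T = matrix_inv Cy ** matrix ?A"
    using matrix_compose[OF linA matrix_vector_mul_linear, of "matrix_inv Cy"] by (simp add: o_def)
  also have "\<bar>det (matrix_inv Cy ** matrix ?A)\<bar> = sqrt (det (gcoeff M c ?y)) * \<bar>det (matrix ?A)\<bar>"
  proof -
    have "det (matrix_inv Cy) * det Cy = 1"
      using arg_cong[OF matrix_inv_inverse(2)[OF d(1)], of det] by (simp add: det_mul)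
    then have "\<bar>det (matrix_inv Cy)\<bar> * \<bar>det Cy\<bar> = sqrt (det (gcoeff M c ?y)) * \<bar>det Cy\<bar>"
      using d(2) by (simp add: abs_mult[symmetric])
    then show ?thesis using d(1) by (simp add: det_mul abs_mult)
  qed
  finally show ?thesis .
qed

text \<open>The part of the ball that lands in one chart: a change of variables in Euclidean
  coordinates, with the pointwise bound of \<open>jacobian_lower\<close> under the integral.\<close>

lemma exp_piece_volume:
  fixes C :: "real^'n^'n"
  assumes C: "\<And>u w. metric_at M x (C *v u) (C *v w) = u \<bullet> w" and detC: "det C \<noteq> 0"
    and c: "c \<in> atlas M" and W: "open W" "\<And>u. u \<in> W \<Longrightarrow> C *v u \<in> U"
    and low: "\<And>u w. u \<in> W \<Longrightarrow> 25 / 36 * metric_at M x w w \<le> Q (C *v u) w"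
    and A: "A \<in> sets borel" "A \<subseteq> W" "\<And>u. u \<in> A \<Longrightarrow> ex (C *v u) \<in> chart_dom c"
  shows "ennreal ((5/6) ^ CARD('n)) * emeasure lborel A \<le> vol c ((\<lambda>u. ex (C *v u)) ` A)"
proof -
  let ?f = "\<lambda>u. F c (C *v u)" and ?g = "\<lambda>y. matrix_inv C *v (inv_into U ex \<circ> chart_inv c) y"
  let ?f' = "\<lambda>u w. DF c (C *v u) (C *v w)"
  note inv = matrix_inv_inverse[OF detC]
  \<comment> \<open>\<open>A\<close> is only Borel, being later the preimage of a piece of a
    partition; the change of variables takes place on this open set around it.\<close>
  define D where "D = W \<inter> (*v) C -` V c"
  have contC: "continuous_on X ((*v) C)" for X
    by (intro linear_continuous_on linear_linear[THEN iffD2] matrix_vector_mul_linear)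
  have Dop: "open D" unfolding D_def by (intro open_Int W open_vimage V_open[OF c] contC)
  have DV: "C *v u \<in> V c" if "u \<in> D" for u using that by (simp add: D_def)
  have AD: "A \<subseteq> D" using A W(2) by (auto simp: D_def V_def)
  have imgC: "open ((*v) C ` D)"
  proof (rule open_surjective_linear_image[OF Dop matrix_vector_mul_linear])
    show "surj ((*v) C)"
      by (rule surjI[of _ "(*v) (matrix_inv C)"]) (simp add: matrix_vector_mul_assoc inv)
  qed
  have Vop: "open (?f ` D)"
  proof -
    have "openin (top_of M) (ex ` ((*v) C ` D))"
      by (rule ex_image_open[OF imgC]) (use DV V_U in blast)
    then have "open (chart_map c ` (ex ` ((*v) C ` D)))"
      by (rule chart_image_open[OF c]) (use DV V_dom in blast)
    then show ?thesis by (simp add: image_image F_def)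
  qed
  have gf: "?g (?f u) = u" if "u \<in> D" for u
    using V_dom[OF DV[OF that]] V_U[OF DV[OF that]] ex_inj
    by (simp add: F_def chart_inv_left[OF c] matrix_vector_mul_assoc inv)
  have der: "(?f has_derivative ?f' u) (at u)" if "u \<in> D" for u
    by (rule has_derivative_compose[OF linear_imp_has_derivative[OF matrix_vector_mul_linear]
          F_has_derivative[OF c DV[OF that]]])
  have hom: "homeomorphism D (?f ` D) ?f ?g"
  proof (rule homeomorphismI)
    show "continuous_on D ?f"
      by (rule has_derivative_continuous_on[OF has_derivative_at_withinI[OF der]])
    have "smooth_on (chart_map c ` (chart_dom c \<inter> ex ` U)) (inv_into U ex \<circ> chart_inv c)"
      using diffeo c unfolding diffeo_onto_open_image_def by blast
    then have "continuous_on (?f ` D) (inv_into U ex \<circ> chart_inv c)"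
    proof (rule continuous_on_subset[OF smooth_onD(3)])
      show "?f ` D \<subseteq> chart_map c ` (chart_dom c \<inter> ex ` U)"
      proof
        fix y assume "y \<in> ?f ` D"
        then obtain u where u: "u \<in> D" "y = chart_map c (ex (C *v u))" by (auto simp: F_def)
        then show "y \<in> chart_map c ` (chart_dom c \<inter> ex ` U)"
          using V_dom[OF DV[OF u(1)]] V_U[OF DV[OF u(1)]] by blast
      qed
    qed
    from continuous_on_compose2[OF linear_continuous_on[OF linear_linear[THEN iffD2, OF matrix_vector_mul_linear]] this]
    show "continuous_on (?f ` D) ?g" by blast
    show "?f ` D \<subseteq> ?f ` D" by simp
    show "?g ` ?f ` D \<subseteq> D" using gf by (simp add: image_subset_iff)
    show "?g (?f u) = u" if "u \<in> D" for u by (rule gf[OF that])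
    show "?f (?g y) = y" if "y \<in> ?f ` D" for y using that gf by auto
  qed
  have cont: "continuous_on D (\<lambda>u. det (matrix (?f' u)))"
  proof -
    have "continuous_on D (\<lambda>u. ?f' u (axis j 1))" for j
      unfolding continuous_on_def
    proof
      fix u assume u: "u \<in> D"
      have "((*v) C \<longlongrightarrow> C *v u) (at u within D)"
        using contC[of D] u by (simp add: continuous_on_def)
      from DF_tendsto[OF c DV[OF u] this tendsto_const]
      show "((\<lambda>u. ?f' u (axis j 1)) \<longlongrightarrow> ?f' u (axis j 1)) (at u within D)" .
    qed
    from bounded_linear.continuous_on[OF bounded_linear_vec_nth this]
    show ?thesis
      unfolding det_def matrix_def vec_lambda_beta
      by (intro continuous_on_sum continuous_on_mult continuous_on_const continuous_on_prod)
  qed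
  have img: "?f ` A = chart_map c ` ((\<lambda>u. ex (C *v u)) ` A)" by (simp add: image_image F_def)
  have Vsub: "?f ` D \<subseteq> chart_map c ` chart_dom c" using F_img[OF DV] by blast
  have "(\<lambda>y. (vdens c y * indicator (chart_map c ` chart_dom c) y) * indicator (?f ` D) y) \<in> borel_measurable borel"
    by (rule borel_measurable_times_ennreal[OF vdens_measurable[OF c]]) (use Vop in \<open>simp add: borel_measurable_indicator\<close>)
  also have "(\<lambda>y. (vdens c y * indicator (chart_map c ` chart_dom c) y) * indicator (?f ` D) y)
     = (\<lambda>y. vdens c y * indicator (?f ` D) y)"
    using Vsub by (auto simp: fun_eq_iff indicator_def)
  finally have meas: "(\<lambda>y. vdens c y * indicator (?f ` D) y) \<in> borel_measurable borel" .
  have "ennreal ((5/6) ^ CARD('n)) * emeasure lborel A = (\<integral>\<^sup>+u\<in>A. ennreal ((5/6) ^ CARD('n)) \<partial>lborel)"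
    using A(1) by (simp add: nn_integral_cmult_indicator)
  also have "\<dots> \<le> (\<integral>\<^sup>+u\<in>A. vdens c (?f u) * ennreal \<bar>det (matrix (?f' u))\<bar> \<partial>lborel)"
  proof (rule nn_integral_mono)
    fix u :: "real^'n"
    show "ennreal ((5/6) ^ CARD('n)) * indicator A u \<le> vdens c (?f u) * ennreal \<bar>det (matrix (?f' u))\<bar> * indicator A u"
    proof (cases "u \<in> A")
      case True
      then have u: "u \<in> D" "u \<in> W" using AD A(2) by auto
      have "vdens c (?f u) * ennreal \<bar>det (matrix (?f' u))\<bar> = ennreal (sqrt (det (gcoeff M c (?f u))) * \<bar>det (matrix (?f' u))\<bar>)"
        by (simp add: vdens_def ennreal_mult'')
      then show ?thesis
        using jacobian_lower[OF C c DV[OF u(1)] low[OF u(2)]] True by (simp add: ennreal_leI)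
    qed simp
  qed
  also have "\<dots> = (\<integral>\<^sup>+y\<in>?f ` A. vdens c y \<partial>lborel)"
    by (rule nn_integral_differentiable_image[symmetric, OF hom Dop Vop der cont A(1) AD meas])
  finally show ?thesis by (simp add: vol_def img)
qed

text \<open>An orthonormal frame at \<open>x\<close> turns the tangent ball into the Euclidean ball
  of the same radius. Its image may spread over many charts, so the ball is cut into the preimages
  of a partition and the estimates for the pieces are summed.\<close>

lemma exp_ball_volume:
  assumes \<rho>: "\<rho> \<le> r" and K: "0 \<le> K" "K * \<rho>\<^sup>2 \<le> 1"
    and sec: "\<And>z u v. z \<in> points M \<Longrightarrow> u \<noteq> v \<Longrightarrow> independent {u, v} \<Longrightarrow> sectional_curvature M z u v \<le> K"
  shows "ennreal ((5/6) ^ CARD('n)) * emeasure lborel (ball (0::real^'n) \<rho>)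
    \<le> emeasure (riem_measure M) (ex ` {v. tangent_norm M x v < \<rho>})"
proof -
  let ?k = "ennreal ((5/6) ^ CARD('n))"
  have ne: "points M \<noteq> {}" using x by blast
  note \<mu> = riem_measure[OF ne]
  obtain cs D where P: "is_partition cs D" using ex_partition[OF ne] by blast
  then have cs: "cs i \<in> atlas M" "D i \<subseteq> chart_dom (cs i)" "D i \<in> borel_sets" for i
    by (simp_all add: is_partition_def)
  have Dd: "disjoint_family D" and DU: "(\<Union>i. D i) = points M" using P by (simp_all add: is_partition_def)
  let ?c = "chart_at M x"
  have c0: "?c \<in> atlas M" "chart_map ?c x \<in> chart_map ?c ` chart_dom ?c" using chart_at[OF x] by simp_all
  obtain C :: "real^'n^'n" where C: "transpose C ** gcoeff M ?c (chart_map ?c x) ** C = mat 1"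
    using orthonormal_frame[OF metric_chart.sym_g[OF metric_chart[OF c0(1)] c0(2)]
        metric_chart.pos_g[OF metric_chart[OF c0(1)] c0(2)]] by blast
  note dC = det_frame(1)[OF C]
  have iso: "metric_at M x (C *v u) (C *v w) = u \<bullet> w" for u w
    unfolding metric_at_def by (rule frame_inner[OF C])
  have tn: "tangent_norm M x (C *v u) = norm u" for u
    unfolding tangent_norm_def iso by (simp add: norm_eq_sqrt_inner)
  let ?B = "ball (0::real^'n) \<rho>" and ?e = "\<lambda>u. ex (C *v u)"
  have ball: "{v. tangent_norm M x v < \<rho>} = (*v) C ` ?B"
  proof (intro set_eqI iffI)
    fix v assume v: "v \<in> {v. tangent_norm M x v < \<rho>}"
    have "v = C *v (matrix_inv C *v v)" by (simp add: matrix_vector_mul_assoc matrix_inv_inverse[OF dC])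
    then show "v \<in> (*v) C ` ?B" using v tn[of "matrix_inv C *v v"] by (intro image_eqI) auto
  qed (auto simp: tn)
  have BU: "C *v u \<in> U" if "u \<in> ?B" for u using that \<rho> by (simp add: tn)
  have low: "25 / 36 * metric_at M x w w \<le> Q (C *v u) w" if u: "u \<in> ?B" for u w
  proof (rule Q_lower[OF BU[OF u] K(1) _ sec])
    have "(norm u)\<^sup>2 \<le> \<rho>\<^sup>2" using u by (intro power_mono) auto
    then have "K * (norm u)\<^sup>2 \<le> K * \<rho>\<^sup>2" using K(1) by (rule mult_left_mono)
    then show "K * metric_at M x (C *v u) (C *v u) \<le> 1" using K(2) by (simp add: iso dot_square_norm)
  qed
  define A where "A i = {u \<in> ?B. ?e u \<in> D i}" for i
  have Ab: "A i \<in> sets borel" for i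
  proof -
    have "(*v) C \<in> borel_measurable borel"
      by (intro borel_measurable_continuous_onI linear_continuous_on linear_linear[THEN iffD2] matrix_vector_mul_linear)
    from measurable_sets[OF this preimage_borel[OF cs(3)[of i]]]
    have "(*v) C -` {v \<in> U. ex v \<in> D i} \<in> sets borel" by simp
    then have "?B \<inter> (*v) C -` {v \<in> U. ex v \<in> D i} \<in> sets borel" by (intro sets.Int) simp_all
    also have "?B \<inter> (*v) C -` {v \<in> U. ex v \<in> D i} = A i" using BU by (auto simp: A_def)
    finally show ?thesis .
  qed
  have eB: "ex ` {v. tangent_norm M x v < \<rho>} = ?e ` ?B" unfolding ball by (simp add: image_image)
  have eBb: "?e ` ?B \<in> borel_sets"
  proof -
    have "open {v. tangent_norm M x v < \<rho>}"
      by (rule open_Collect_less[OF continuous_tangent_norm]) (intro continuous_intros)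
    then have "openin (top_of M) (ex ` {v. tangent_norm M x v < \<rho>})"
      by (rule ex_image_open) (use \<rho> in auto)
    then show ?thesis unfolding eB by (rule open_borel)
  qed
  have eA: "?e ` ?B \<inter> D i = ?e ` A i" for i by (auto simp: A_def)
  have piece: "?k * emeasure lborel (A i) \<le> emeasure (riem_measure M) (?e ` ?B \<inter> D i)" for i
  proof -
    have "?k * emeasure lborel (A i) \<le> vol (cs i) (?e ` A i)"
      by (rule exp_piece_volume[OF iso dC cs(1) open_ball[of "0::real^'n" \<rho>] BU low Ab]) (use cs(2) in \<open>auto simp: A_def\<close>)
    also have "\<dots> = emeasure (riem_measure M) (?e ` A i)"
    proof -
      have "?e ` A i \<in> borel_sets"
        unfolding eA[symmetric] by (rule borel_sets_Int[OF eBb cs(3)])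
      moreover have "?e ` A i \<subseteq> chart_dom (cs i)" using cs(2) by (auto simp: A_def)
      moreover have "sets (riem_measure M) = borel_sets" using \<mu> by (simp add: is_riem_measure_def)
      ultimately have "emeasure (riem_measure M) (?e ` A i) = vol (cs i) (?e ` A i)"
        using \<mu> cs(1)[of i] unfolding is_riem_measure_def by blast
      then show ?thesis by simp
    qed
    finally show ?thesis by (simp add: eA)
  qed
  have "emeasure lborel ?B = emeasure lborel (\<Union>i. A i)"
  proof -
    have "\<exists>i. ?e u \<in> D i" if "u \<in> ?B" for u
      using ex_points[OF BU[OF that]] unfolding DU[symmetric] by blast
    then have "?B = (\<Union>i. A i)" by (auto simp: A_def)
    then show ?thesis by (simp only:)
  qed
  also have "\<dots> = (\<Sum>i. emeasure lborel (A i))"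
    by (rule suminf_emeasure[symmetric]) (use Ab Dd in \<open>auto simp: disjoint_family_on_def A_def\<close>)
  finally have "?k * emeasure lborel ?B = (\<Sum>i. ?k * emeasure lborel (A i))" by simp
  also have "\<dots> \<le> (\<Sum>i. emeasure (riem_measure M) (?e ` ?B \<inter> D i))"
    by (intro suminf_le piece) auto
  also have "\<dots> = emeasure (riem_measure M) (?e ` ?B)"
    by (rule emeasure_partition[OF \<mu> P eBb, symmetric])
  finally show ?thesis unfolding eB .
qed

end

section \<open>The distance along geodesics\<close>

context riem
begin

section \<open>Reparametrized and concatenated paths\<close>

lemma C1_curve_affine:
  assumes \<sigma>: "C1_curve_on M (p + q * a) (p + q * b) \<sigma>" and q: "0 < q"
    and \<rho>: "\<And>t. t \<in> {a..b} \<Longrightarrow> \<rho> t = \<sigma> (p + q * t)"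
  shows "C1_curve_on M a b \<rho>"
  unfolding C1_curve_on_def
proof
  fix c assume c: "c \<in> atlas M"
  obtain w where w: "continuous_on {t\<in>{p + q * a..p + q * b}. \<sigma> t \<in> chart_dom c} w"
    "\<And>t. t\<in>{p + q * a..p + q * b} \<Longrightarrow> \<sigma> t \<in> chart_dom c \<Longrightarrow>
      ((chart_map c \<circ> \<sigma>) has_vector_derivative w t) (at t within {p + q * a..p + q * b})"
    using \<sigma> c unfolding C1_curve_on_def by blast
  have im: "p + q * t \<in> {p + q * a..p + q * b}" if "t \<in> {a..b}" for t
    using that q by simp
  show "\<exists>w. continuous_on {t\<in>{a..b}. \<rho> t \<in> chart_dom c} w \<and>
      (\<forall>t\<in>{a..b}. \<rho> t \<in> chart_dom c \<longrightarrow> ((chart_map c \<circ> \<rho>) has_vector_derivative w t) (at t within {a..b}))"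
  proof (intro exI[of _ "\<lambda>t. q *\<^sub>R w (p + q * t)"] conjI ballI impI)
    show "continuous_on {t\<in>{a..b}. \<rho> t \<in> chart_dom c} (\<lambda>t. q *\<^sub>R w (p + q * t))"
      by (intro continuous_on_scaleR continuous_on_const continuous_on_compose2[OF w(1)] continuous_intros)
        (use im \<rho> in auto)
    fix t assume t: "t \<in> {a..b}" "\<rho> t \<in> chart_dom c"
    have 1: "((\<lambda>t. p + q * t) has_vector_derivative q) (at t within {a..b})"
      by (auto intro!: derivative_eq_intros)
    have "((chart_map c \<circ> \<sigma>) has_vector_derivative w (p + q * t)) (at (p + q * t) within (\<lambda>t. p + q * t) ` {a..b})"
      by (rule has_vector_derivative_within_subset[OF w(2)[OF im[OF t(1)]]]) (use im t \<rho> in auto)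
    from vector_diff_chain_within[OF 1 this]
    have 2: "((\<lambda>t. chart_map c (\<sigma> (p + q * t))) has_vector_derivative q *\<^sub>R w (p + q * t)) (at t within {a..b})"
      by (simp add: o_def)
    show "((chart_map c \<circ> \<rho>) has_vector_derivative q *\<^sub>R w (p + q * t)) (at t within {a..b})"
      by (rule has_vector_derivative_transform[OF t(1) _ 2]) (simp add: \<rho>)
  qed
qed

lemma piecewise_path: "piecewise_C1_path M \<sigma> \<Longrightarrow> pathin (top_of M) \<sigma>"
  by (simp add: piecewise_C1_path_def)

lemma tangent_norm_scaleR: "z \<in> points M \<Longrightarrow> tangent_norm M z (a *\<^sub>R v) = \<bar>a\<bar> * tangent_norm M z v"
proof -
  assume z: "z \<in> points M"
  have "metric_at M z (a *\<^sub>R v) (a *\<^sub>R v) = a\<^sup>2 * metric_at M z v v"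
    by (simp add: metric_at_def matrix_vector_mult_scaleR power2_eq_square)
  then show ?thesis by (simp add: tangent_norm_def real_sqrt_mult)
qed

lemma speed_nonneg: "pathin (top_of M) \<sigma> \<Longrightarrow> t \<in> {0..1} \<Longrightarrow> 0 \<le> speed M \<sigma> t"
  using metric_at_nonneg[OF path_points] by (simp add: speed_def tangent_norm_def)

text \<open>This bounds the infimum in \<open>riem_dist\<close> from below. A path of nonintegrable
  speed has length 0 by convention and satisfies the inequality as well.\<close>

lemma curve_length_nonneg: "piecewise_C1_path M \<sigma> \<Longrightarrow> 0 \<le> curve_length M \<sigma>"
proof (cases "speed M \<sigma> integrable_on {0..1}")
  case True
  assume "piecewise_C1_path M \<sigma>"
  then show ?thesis
    unfolding curve_length_def using speed_nonneg[OF piecewise_path] by (intro integral_nonneg True) auto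
next
  case False
  then show ?thesis by (simp add: curve_length_def not_integrable_integral)
qed

lemma piecewise_derivative:
  assumes "piecewise_C1_path M \<sigma>"
  obtains X where "finite X" "\<And>t. t \<in> {0<..<1} - X \<Longrightarrow>
    \<exists>D. ((chart_map (chart_at M (\<sigma> t)) \<circ> \<sigma>) has_vector_derivative D) (at t)"
proof -
  obtain X where X: "finite X" "\<And>a b. 0 \<le> a \<Longrightarrow> a < b \<Longrightarrow> b \<le> 1 \<Longrightarrow> {a<..<b} \<inter> X = {} \<Longrightarrow> C1_curve_on M a b \<sigma>"
    using assms unfolding piecewise_C1_path_def by blast
  have "\<exists>D. ((chart_map (chart_at M (\<sigma> t)) \<circ> \<sigma>) has_vector_derivative D) (at t)" if t: "t \<in> {0<..<1} - X" for t
  proof -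
    have "open ({0<..<1} - X)" using X(1) by (intro open_Diff finite_imp_closed) auto
    then obtain e where e: "e > 0" "ball t e \<subseteq> {0<..<1} - X" using t open_contains_ball by blast
    define a b where "a = t - e / 2" and "b = t + e / 2"
    have "{a..b} \<subseteq> ball t e" using e by (auto simp: a_def b_def dist_real_def abs_less_iff)
    then have ab: "{a..b} \<subseteq> {0<..<1} - X" using e by blast
    have lt: "a < t" "t < b" using e by (auto simp: a_def b_def)
    then have "a \<in> {a..b}" "b \<in> {a..b}" by auto
    then have "a \<in> {0<..<1}" "b \<in> {0<..<1}" using ab by blast+
    moreover have "{a<..<b} \<subseteq> {a..b}" by auto
    then have "{a<..<b} \<inter> X = {}" using ab by blast
    ultimately have "C1_curve_on M a b \<sigma>"
      using lt by (intro X(2)) auto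
    moreover have pt: "\<sigma> t \<in> points M" using path_points[OF piecewise_path[OF assms]] t by simp
    ultimately obtain w where "((chart_map (chart_at M (\<sigma> t)) \<circ> \<sigma>) has_vector_derivative w t) (at t within {a..b})"
      unfolding C1_curve_on_def using chart_at[OF pt] lt by (meson atLeastAtMost_iff less_imp_le)
    then show ?thesis using at_within_Icc_at[OF lt] by auto
  qed
  then show ?thesis using that X(1) by blast
qed

lemma speed_affine:
  assumes D: "((chart_map (chart_at M (\<sigma> (p + q * t))) \<circ> \<sigma>) has_vector_derivative D) (at (p + q * t))"
    and pt: "\<sigma> (p + q * t) \<in> points M" and O: "open X" "t \<in> X" "\<And>t. t \<in> X \<Longrightarrow> \<rho> t = \<sigma> (p + q * t)"
  shows "speed M \<rho> t = \<bar>q\<bar> * speed M \<sigma> (p + q * t)"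
proof -
  let ?c = "chart_at M (\<sigma> (p + q * t))"
  have 1: "((\<lambda>t. p + q * t) has_vector_derivative q) (at t)"
    by (auto intro!: derivative_eq_intros)
  from vector_diff_chain_at[OF 1 D]
  have 2: "((\<lambda>t. chart_map ?c (\<sigma> (p + q * t))) has_vector_derivative q *\<^sub>R D) (at t)" by (simp add: o_def)
  have "((chart_map ?c \<circ> \<rho>) has_vector_derivative q *\<^sub>R D) (at t)"
    by (rule has_vector_derivative_transform_within_open[OF 2 O(1,2)]) (simp add: O(3))
  then have "vector_derivative (chart_map ?c \<circ> \<rho>) (at t) = q *\<^sub>R D" by (rule vector_derivative_at)
  moreover have "vector_derivative (chart_map ?c \<circ> \<sigma>) (at (p + q * t)) = D" using D by (rule vector_derivative_at)
  ultimately show ?thesis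
    by (simp add: speed_def O(3)[OF O(2)] tangent_norm_scaleR[OF pt])
qed

lemma has_integral_affine_Icc:
  fixes f :: "real \<Rightarrow> real"
  assumes "(f has_integral I) {0..1}"
  shows "((\<lambda>t. 2 * f (2 * t)) has_integral I) {0..1/2}" "((\<lambda>t. 2 * f (2 * t - 1)) has_integral I) {1/2..1}"
proof -
  have "((\<lambda>t. f (2 * t + 0)) has_integral (1 / \<bar>2\<bar>) *\<^sub>R I) ((\<lambda>t. (1 / 2) * t + - ((1 / 2) * 0)) ` cbox 0 1)"
    using has_integral_affinity[of f I 0 1 2 0] assms by simp
  moreover have "(\<lambda>t. (1 / 2) * t + - ((1 / 2) * 0)) ` cbox 0 1 = {0..1/2::real}"
    using image_mult_atLeastAtMost[of "1/2" 0 "1::real"] by simp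
  ultimately show "((\<lambda>t. 2 * f (2 * t)) has_integral I) {0..1/2}"
    using has_integral_mult_right[of "\<lambda>t. f (2 * t)" "I / 2" "{0..1/2}" 2] by simp
  have "((\<lambda>t. f (2 * t + - 1)) has_integral (1 / \<bar>2\<bar>) *\<^sub>R I) ((\<lambda>t. (1 / 2) * t + - ((1 / 2) * - 1)) ` cbox 0 1)"
    using has_integral_affinity[of f I 0 1 2 "-1"] assms by simp
  moreover have "(\<lambda>t. (1 / 2) * t + - ((1 / 2) * - 1)) ` cbox 0 1 = {1/2..1::real}"
    using image_affinity_atLeastAtMost[of "1/2" "1/2" 0 "1::real"] by simp
  ultimately show "((\<lambda>t. 2 * f (2 * t - 1)) has_integral I) {1/2..1}"
    using has_integral_mult_right[of "\<lambda>t. f (2 * t - 1)" "I / 2" "{1/2..1}" 2] by simp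
qed

text \<open>Integrability of the second half of a concatenation returns to the original path; its
  contrapositive shows that a nonintegrable speed stays nonintegrable after joining.\<close>

lemma integrable_affine_Icc:
  fixes f :: "real \<Rightarrow> real"
  assumes "(\<lambda>t. 2 * f (2 * t - 1)) integrable_on {1/2..1}"
  shows "f integrable_on {0..1}"
proof -
  let ?g = "\<lambda>t. 2 * f (2 * t - 1)"
  obtain I where "(?g has_integral I) (cbox (1/2) 1)" using assms by (auto simp: integrable_on_def)
  from has_integral_affinity[OF this, of "1/2" "1/2"]
  have "((\<lambda>t. 2 * f t) has_integral 2 * I) ((\<lambda>t. 2 * t + - 1) ` cbox (1/2) 1)"
    by (simp add: algebra_simps)
  moreover have "(\<lambda>t. 2 * t + - 1) ` cbox (1/2) 1 = {0..1::real}"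
    using image_affinity_atLeastAtMost[of 2 "-1" "1/2" "1::real"] by simp
  ultimately have "((\<lambda>t. 2 * f t) has_integral 2 * I) {0..1}" by simp
  from has_integral_mult_right[OF this, of "1/2"] show ?thesis by (auto simp: integrable_on_def)
qed

text \<open>
  The speed of \<open>\<tau>\<close> is not assumed integrable: otherwise its length is the junk value \<open>0\<close>, and so is that
  of the concatenation.
\<close>

lemma join_paths:
  assumes \<sigma>: "piecewise_C1_path M \<sigma>" "(speed M \<sigma> has_integral L) {0..1}"
    and \<tau>: "piecewise_C1_path M \<tau>" and st: "\<sigma> 1 = \<tau> 0"
  shows "\<exists>\<rho>. piecewise_C1_path M \<rho> \<and> \<rho> 0 = \<sigma> 0 \<and> \<rho> 1 = \<tau> 1 \<and> curve_length M \<rho> \<le> L + curve_length M \<tau>"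
proof -
  \<comment> \<open>The summand 0 keeps both halves in the shape p + q * t of
    \<open>C1_curve_affine\<close> and \<open>speed_affine\<close>.\<close>
  define \<rho> where "\<rho> t = (if t \<le> 1/2 then \<sigma> (0 + 2 * t) else \<tau> (-1 + 2 * t))" for t :: real
  have \<rho>1: "\<rho> t = \<sigma> (0 + 2 * t)" if "t \<le> 1/2" for t using that by (simp add: \<rho>_def)
  have \<rho>2: "\<rho> t = \<tau> (-1 + 2 * t)" if "1/2 \<le> t" for t
  proof (cases "t = 1/2")
    case True
    show ?thesis unfolding True using st by (simp add: \<rho>_def)
  qed (use that in \<open>simp add: \<rho>_def\<close>)
  note p\<sigma> = piecewise_path[OF \<sigma>(1)] and p\<tau> = piecewise_path[OF \<tau>]
  have path: "pathin (top_of M) \<rho>"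
  proof -
    have 1: "continuous_map (top_of_set {0..1/2}) (top_of M) (\<lambda>t. \<sigma> (0 + 2 * t))"
    proof -
      have "continuous_map (top_of_set {0..1/2}) (top_of_set {0..1}) (\<lambda>t::real. 0 + 2 * t)"
        by (auto simp: continuous_map_in_subtopology intro!: continuous_intros)
      from continuous_map_compose[OF this p\<sigma>[unfolded pathin_def]] show ?thesis by (simp add: o_def)
    qed
    have 2: "continuous_map (top_of_set {1/2..1}) (top_of M) (\<lambda>t. \<tau> (-1 + 2 * t))"
    proof -
      have "continuous_map (top_of_set {1/2..1}) (top_of_set {0..1}) (\<lambda>t::real. -1 + 2 * t)"
        by (auto simp: continuous_map_in_subtopology intro!: continuous_intros)
      from continuous_map_compose[OF this p\<tau>[unfolded pathin_def]] show ?thesis by (simp add: o_def)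
    qed
    have s1: "subtopology (top_of_set {0..1}) {t \<in> topspace (top_of_set {0..1}). t \<le> 1/2} = top_of_set {0..1/2::real}"
      and s2: "subtopology (top_of_set {0..1}) {t \<in> topspace (top_of_set {0..1}). 1/2 \<le> t} = top_of_set {1/2..1::real}"
      unfolding subtopology_subtopology by (rule arg_cong[where f=top_of_set], auto)+
    have "continuous_map (top_of_set {0..1}) (top_of M) (\<lambda>t. if t \<le> 1/2 then \<sigma> (0 + 2 * t) else \<tau> (-1 + 2 * t))"
    proof (rule continuous_map_cases_le, unfold s1 s2)
      show "\<sigma> (0 + 2 * t) = \<tau> (- 1 + 2 * t)" if "t = 1/2" for t :: real
        unfolding that using st by simp
    qed (use 1 2 in \<open>auto intro!: continuous_intros\<close>)
    then show ?thesis by (simp add: pathin_def \<rho>_def[abs_def])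
  qed
  obtain X where X: "finite X" "\<And>a b. 0 \<le> a \<Longrightarrow> a < b \<Longrightarrow> b \<le> 1 \<Longrightarrow> {a<..<b} \<inter> X = {} \<Longrightarrow> C1_curve_on M a b \<sigma>"
    using \<sigma>(1) unfolding piecewise_C1_path_def by blast
  obtain Y where Y: "finite Y" "\<And>a b. 0 \<le> a \<Longrightarrow> a < b \<Longrightarrow> b \<le> 1 \<Longrightarrow> {a<..<b} \<inter> Y = {} \<Longrightarrow> C1_curve_on M a b \<tau>"
    using \<tau> unfolding piecewise_C1_path_def by blast
  let ?Z = "insert (1/2) ((\<lambda>s. s / 2) ` X \<union> (\<lambda>s. (s + 1) / 2) ` Y)"
  have C1: "C1_curve_on M a b \<rho>" if ab: "0 \<le> a" "a < b" "b \<le> 1" "{a<..<b} \<inter> ?Z = {}" for a b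
  proof -
    have "1/2 \<notin> {a<..<b}" using ab(4) by blast
    then consider "b \<le> 1/2" | "1/2 \<le> a" by (force simp: not_less)
    then show ?thesis
    proof cases
      case 1
      have "{0 + 2 * a<..<0 + 2 * b} \<inter> X = {}"
      proof (rule ccontr)
        assume "{0 + 2 * a<..<0 + 2 * b} \<inter> X \<noteq> {}"
        then obtain s where s: "s \<in> X" "2 * a < s" "s < 2 * b" by auto
        then have "s / 2 \<in> {a<..<b} \<inter> ?Z" by auto
        then show False using ab(4) by blast
      qed
      then have "C1_curve_on M (0 + 2 * a) (0 + 2 * b) \<sigma>" using ab 1 by (intro X(2)) auto
      then show ?thesis by (rule C1_curve_affine) (use 1 \<rho>1 in auto)
    next
      case 2
      have "{-1 + 2 * a<..<-1 + 2 * b} \<inter> Y = {}"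
      proof (rule ccontr)
        assume "{-1 + 2 * a<..<-1 + 2 * b} \<inter> Y \<noteq> {}"
        then obtain s where s: "s \<in> Y" "-1 + 2 * a < s" "s < -1 + 2 * b" by auto
        then have "(s + 1) / 2 \<in> {a<..<b} \<inter> ?Z" by auto
        then show False using ab(4) by blast
      qed
      then have "C1_curve_on M (-1 + 2 * a) (-1 + 2 * b) \<tau>" using ab 2 by (intro Y(2)) auto
      then show ?thesis by (rule C1_curve_affine) (use 2 \<rho>2 in auto)
    qed
  qed
  have "finite ?Z" using X(1) Y(1) by simp
  then have pw: "piecewise_C1_path M \<rho>" unfolding piecewise_C1_path_def using path C1 by blast
  obtain A where A: "finite A" "\<And>t. t \<in> {0<..<1} - A \<Longrightarrow>
    \<exists>D. ((chart_map (chart_at M (\<sigma> t)) \<circ> \<sigma>) has_vector_derivative D) (at t)"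
    using piecewise_derivative[OF \<sigma>(1)] by blast
  obtain B where B: "finite B" "\<And>t. t \<in> {0<..<1} - B \<Longrightarrow>
    \<exists>D. ((chart_map (chart_at M (\<tau> t)) \<circ> \<tau>) has_vector_derivative D) (at t)"
    using piecewise_derivative[OF \<tau>] by blast
  \<comment> \<open>Finite sets outside which the speeds of the halves are known: the endpoints, the
    junction and the rescaled times without a derivative. They do not affect the integrals.\<close>
  let ?A = "insert 0 (insert (1/2) ((\<lambda>s. s / 2) ` A))" and ?B = "insert 1 (insert (1/2) ((\<lambda>s. (s + 1) / 2) ` B))"
  have sp1: "speed M \<rho> t = 2 * speed M \<sigma> (2 * t)" if t: "t \<in> {0..1/2} - ?A" for t
  proof -
    have "2 * t \<in> {0<..<1} - A" using t imageI[of "2 * t" A "\<lambda>s. s / 2"] by auto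
    then obtain D where D: "((chart_map (chart_at M (\<sigma> (0 + 2 * t))) \<circ> \<sigma>) has_vector_derivative D) (at (0 + 2 * t))"
      using A(2)[of "2 * t"] by auto
    show ?thesis
      using speed_affine[OF D path_points[OF p\<sigma>], of "{..<1/2}" \<rho>] t \<rho>1 by auto
  qed
  have sp2: "speed M \<rho> t = 2 * speed M \<tau> (2 * t - 1)" if t: "t \<in> {1/2..1} - ?B" for t
  proof -
    have "2 * t - 1 \<in> {0<..<1} - B" using t imageI[of "2 * t - 1" B "\<lambda>s. (s + 1) / 2"] by auto
    then obtain D where D: "((chart_map (chart_at M (\<tau> (-1 + 2 * t))) \<circ> \<tau>) has_vector_derivative D) (at (-1 + 2 * t))"
      using B(2)[of "2 * t - 1"] by auto
    have "t \<in> {1/2<..}" using t by auto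
    then show ?thesis
      using speed_affine[OF D path_points[OF p\<tau>], of "{1/2<..}" \<rho>] t \<rho>2 by (simp add: algebra_simps)
  qed
  have I1: "(speed M \<rho> has_integral L) {0..1/2}"
    by (rule has_integral_spike_finite[where S="?A", OF _ _ has_integral_affine_Icc(1)[OF \<sigma>(2)]]) (use A(1) sp1 in simp_all)
  have L0: "0 \<le> L" using has_integral_nonneg[OF \<sigma>(2)] speed_nonneg[OF p\<sigma>] by blast
  have len: "curve_length M \<rho> \<le> L + curve_length M \<tau>"
  proof (cases "speed M \<tau> integrable_on {0..1}")
    case True
    then have I: "(speed M \<tau> has_integral curve_length M \<tau>) {0..1}"
      by (simp add: curve_length_def integrable_integral)
    have "(speed M \<rho> has_integral curve_length M \<tau>) {1/2..1}"
      by (rule has_integral_spike_finite[where S="?B", OF _ _ has_integral_affine_Icc(2)[OF I]]) (use B(1) sp2 in simp_all)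
    from has_integral_combine[OF _ _ I1 this] have "(speed M \<rho> has_integral L + curve_length M \<tau>) {0..1}" by simp
    then show ?thesis by (simp add: curve_length_def integral_unique)
  next
    case False
    have "\<not> speed M \<rho> integrable_on {0..1}"
    proof
      assume "speed M \<rho> integrable_on {0..1}"
      then have "speed M \<rho> integrable_on {1/2..1}" by (rule integrable_on_subinterval) auto
      then have "(\<lambda>t. 2 * speed M \<tau> (2 * t - 1)) integrable_on {1/2..1}"
        by (rule integrable_spike_finite[of ?B, rotated 2]) (use B(1) sp2 in auto)
      from integrable_affine_Icc[OF this] show False using False by simp
    qed
    then show ?thesis using False L0 by (simp add: curve_length_def not_integrable_integral)
  qed
  have "\<rho> 0 = \<sigma> 0" "\<rho> 1 = \<tau> 1" by (simp_all add: \<rho>_def)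
  then show ?thesis using pw len by blast
qed

text \<open>
  The path \<open>\<sigma>'\<close> in the opposite direction serves for the case that no path joins \<open>b\<close> to \<open>y\<close>: then none
  joins \<open>a\<close> to \<open>y\<close> either, and both distances are the infimum of the empty set.
\<close>

lemma dist_prepend:
  assumes \<sigma>: "piecewise_C1_path M \<sigma>" "(speed M \<sigma> has_integral L) {0..1}" "\<sigma> 0 = a" "\<sigma> 1 = b"
    and \<sigma>': "piecewise_C1_path M \<sigma>'" "(speed M \<sigma>' has_integral L') {0..1}" "\<sigma>' 0 = b" "\<sigma>' 1 = a"
  shows "riem_dist M a y \<le> L + riem_dist M b y"
proof -
  let ?P = "\<lambda>a. {\<gamma>. piecewise_C1_path M \<gamma> \<and> \<gamma> 0 = a \<and> \<gamma> 1 = y}"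
  have bdd: "bdd_below (curve_length M ` ?P a)" for a
    by (rule bdd_belowI[of _ 0]) (use curve_length_nonneg in auto)
  have L0: "0 \<le> L" using has_integral_nonneg[OF \<sigma>(2)] speed_nonneg[OF piecewise_path[OF \<sigma>(1)]] by blast
  show ?thesis
  proof (cases "?P b = {}")
    case True
    have Pa: "?P a = {}"
    proof (rule ccontr)
      assume "?P a \<noteq> {}"
      then obtain \<gamma> where \<gamma>: "piecewise_C1_path M \<gamma>" "\<gamma> 0 = a" "\<gamma> 1 = y" by blast
      obtain \<rho> where "piecewise_C1_path M \<rho>" "\<rho> 0 = b" "\<rho> 1 = y"
        using join_paths[OF \<sigma>'(1,2) \<gamma>(1)] \<sigma>'(3,4) \<gamma>(2,3) by auto
      then show False using True by blast
    qed
    then show ?thesis unfolding riem_dist_def True Pa using L0 by simp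
  next
    case False
    have "riem_dist M a y - L \<le> riem_dist M b y"
      unfolding riem_dist_def[of M b]
    proof (rule cINF_greatest[OF False])
      fix \<tau> assume \<tau>: "\<tau> \<in> ?P b"
      obtain \<rho> where \<rho>: "piecewise_C1_path M \<rho>" "\<rho> 0 = a" "\<rho> 1 = y" "curve_length M \<rho> \<le> L + curve_length M \<tau>"
        using join_paths[OF \<sigma>(1,2), of \<tau>] \<sigma>(3,4) \<tau> by auto
      have "riem_dist M a y \<le> curve_length M \<rho>"
        unfolding riem_dist_def by (rule cINF_lower[OF bdd]) (use \<rho> in simp)
      then show "riem_dist M a y - L \<le> curve_length M \<tau>" using \<rho>(4) by simp
    qed
    then show ?thesis by simp
  qed
qed

lemma geodesic_piecewise:
  assumes \<gamma>: "geodesic M \<gamma>"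
  shows "piecewise_C1_path M \<gamma>"
  unfolding piecewise_C1_path_def
proof (intro conjI exI[of _ "{}"] allI impI)
  show "pathin (top_of M) \<gamma>" by (rule geodesic_path[OF \<gamma>])
  fix a b :: real assume ab: "0 \<le> a \<and> a < b \<and> b \<le> 1 \<and> {a<..<b} \<inter> {} = {}"
  then have sub: "{a..b} \<subseteq> {0..1}" by auto
  show "C1_curve_on M a b \<gamma>"
    unfolding C1_curve_on_def
  proof
    fix c assume c: "c \<in> atlas M"
    obtain w where w: "\<And>t. t \<in> {0..1} \<Longrightarrow> \<gamma> t \<in> chart_dom c \<Longrightarrow>
        ((\<lambda>t. chart_map c (\<gamma> t)) has_vector_derivative w t) (at t within {0..1})"
      "\<And>t. t \<in> {0..1} \<Longrightarrow> \<gamma> t \<in> chart_dom c \<Longrightarrow>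
        (w has_vector_derivative - Chr c (chart_map c (\<gamma> t)) (w t) (w t)) (at t within {0..1})"
      using geodesicD[OF \<gamma> c] by blast
    show "\<exists>w. continuous_on {t\<in>{a..b}. \<gamma> t \<in> chart_dom c} w \<and>
      (\<forall>t\<in>{a..b}. \<gamma> t \<in> chart_dom c \<longrightarrow> ((chart_map c \<circ> \<gamma>) has_vector_derivative w t) (at t within {a..b}))"
    proof (intro exI[of _ w] conjI ballI impI)
      show "continuous_on {t\<in>{a..b}. \<gamma> t \<in> chart_dom c} w"
      proof (rule continuous_on_vector_derivative)
        fix t assume "t \<in> {t\<in>{a..b}. \<gamma> t \<in> chart_dom c}"
        then have t: "t \<in> {0..1}" "\<gamma> t \<in> chart_dom c" using sub by auto
        show "(w has_vector_derivative - Chr c (chart_map c (\<gamma> t)) (w t) (w t)) (at t within {t\<in>{a..b}. \<gamma> t \<in> chart_dom c})"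
          by (rule has_vector_derivative_within_subset[OF w(2)[OF t]]) (use sub in auto)
      qed
      fix t assume t: "t \<in> {a..b}" "\<gamma> t \<in> chart_dom c"
      show "((chart_map c \<circ> \<gamma>) has_vector_derivative w t) (at t within {a..b})"
        unfolding o_def by (rule has_vector_derivative_within_subset[OF w(1) sub]) (use t sub in auto)
    qed
  qed
qed simp

end

section \<open>Radial geodesics and the distance function\<close>

context expball
begin

text \<open>The radial geodesic has constant speed |v|, which is therefore its length, and its
  reversal is a geodesic of the same length. Prepending one or the other to paths towards
  \<open>y\<close> gives the two inequalities.\<close>

lemma dist_exp:
  assumes v: "v \<in> U"
  shows "\<bar>riem_dist M (ex v) y - riem_dist M x y\<bar> \<le> tangent_norm M x v"
proof -
  obtain \<gamma> where \<gamma>: "geodesic M \<gamma>" "\<And>t. t \<in> {0..1} \<Longrightarrow> ex (t *\<^sub>R v) = \<gamma> t" "\<gamma> 0 = x"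
    using ex_geodesic[OF v] by metis
  define \<gamma>' where "\<gamma>' s = \<gamma> (1 + - 1 * s)" for s
  have \<gamma>': "geodesic M \<gamma>'" unfolding \<gamma>'_def by (rule geodesic_affine[OF \<gamma>(1)]) auto
  let ?L = "tangent_norm M x v"
  have D: "((chart_map (chart_at M (\<gamma> t)) \<circ> \<gamma>) has_vector_derivative DF (chart_at M (\<gamma> t)) (t *\<^sub>R v) v) (at t)"
    and sp: "speed M \<gamma> t = ?L" if t: "t \<in> {0<..<1}" for t
  proof -
    let ?c = "chart_at M (\<gamma> t)"
    have "t *\<^sub>R v \<in> U" using scale_U[OF v, of t] t by simp
    moreover have ext: "ex (t *\<^sub>R v) = \<gamma> t" using \<gamma>(2) t by simp
    ultimately have c: "?c \<in> atlas M" "t *\<^sub>R v \<in> V ?c" and pt: "\<gamma> t \<in> points M"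
      using V_chart_at[of "t *\<^sub>R v"] ex_points[of "t *\<^sub>R v"] by simp_all
    show D: "((chart_map ?c \<circ> \<gamma>) has_vector_derivative DF ?c (t *\<^sub>R v) v) (at t)"
      by (rule has_vector_derivative_transform_within_open[OF F_curve[OF c] open_greaterThanLessThan[of 0 1] t])
        (simp add: F_def \<gamma>(2))
    have "metric_at M (\<gamma> t) (DF ?c (t *\<^sub>R v) v) (DF ?c (t *\<^sub>R v) v) = Q (t *\<^sub>R v) v"
      unfolding Q_eq[OF c] metric_at_eq[OF pt] by (simp add: F_def ext)
    also have "\<dots> = metric_at M x v v" using radial_energy[OF v] t by simp
    finally show "speed M \<gamma> t = ?L"
      using vector_derivative_at[OF D] by (simp add: speed_def tangent_norm_def)
  qed
  have sp': "speed M \<gamma>' s = ?L" if s: "s \<in> {0<..<1}" for s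
  proof -
    have t: "1 + - 1 * s \<in> {0<..<1}" using s by simp
    have "speed M \<gamma>' s = \<bar>- 1\<bar> * speed M \<gamma> (1 + - 1 * s)"
      by (rule speed_affine[OF D[OF t] _ open_UNIV UNIV_I])
        (use path_points[OF geodesic_path[OF \<gamma>(1)], of "1 - s"] s in \<open>simp_all add: \<gamma>'_def\<close>)
    then show ?thesis using sp[OF t] by simp
  qed
  have I: "((\<lambda>_. ?L) has_integral ?L) {0..1::real}" using has_integral_const_real[of ?L 0 1] by simp
  \<comment> \<open>\<open>speed\<close> uses two-sided derivatives and is controlled only at
    interior times; the two endpoints are negligible for the integral.\<close>
  have int: "(speed M \<gamma> has_integral ?L) {0..1}"
    by (rule has_integral_spike_finite[of "{0,1}", OF _ _ I]) (auto intro!: sp)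
  have int': "(speed M \<gamma>' has_integral ?L) {0..1}"
    by (rule has_integral_spike_finite[of "{0,1}", OF _ _ I]) (auto intro!: sp')
  have ends: "\<gamma> 1 = ex v" "\<gamma>' 0 = ex v" "\<gamma>' 1 = x" using \<gamma>(2)[of 1] \<gamma>(3) by (simp_all add: \<gamma>'_def)
  note g = geodesic_piecewise[OF \<gamma>(1)] int \<gamma>(3) ends(1) and g' = geodesic_piecewise[OF \<gamma>'] int' ends(2,3)
  have "riem_dist M x y \<le> ?L + riem_dist M (ex v) y" by (rule dist_prepend[OF g g'])
  moreover have "riem_dist M (ex v) y \<le> ?L + riem_dist M x y" by (rule dist_prepend[OF g' g])
  ultimately show ?thesis by simp
qed

end

section \<open>Decay at infinity\<close>

context expball
begin

text \<open>Along the radial geodesic the derivative of \<lambda> is its gradient paired with the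
  velocity, hence at least -\<kappa> |v| \<lambda> by Cauchy-Schwarz and constancy of the speed; so
  \<lambda> exp (\<kappa> |v| t) is nondecreasing in t.\<close>

lemma gradient_decay:
  assumes v: "v \<in> U" and E: "\<And>t. t \<in> {0..1} \<Longrightarrow> ex (t *\<^sub>R v) \<in> E"
    and C1: "C1_function_on M E lam"
    and grad: "\<And>z. z \<in> E \<Longrightarrow> tangent_norm M z (gradient M lam z) \<le> \<kappa> * lam z"
  shows "lam x * exp (- (\<kappa> * tangent_norm M x v)) \<le> lam (ex v)"
proof -
  define f where "f t = lam (ex (t *\<^sub>R v))" for t
  let ?L = "tangent_norm M x v"
  \<comment> \<open>Differentiability is needed up to t = 1 for continuity at the end, whereas the
    inequality is claimed only for t < 1, the range of \<open>radial_energy\<close>.\<close>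
  have df: "\<exists>D. (f has_real_derivative D) (at t) \<and> (t < 1 \<longrightarrow> - (\<kappa> * ?L) * f t \<le> D)" if t: "t \<in> {0..1}" for t
  proof -
    define z where "z = ex (t *\<^sub>R v)"
    define c where "c = chart_at M z"
    have tU: "t *\<^sub>R v \<in> U" using scale_U[OF v, of t] t by simp
    have c: "c \<in> atlas M" "t *\<^sub>R v \<in> V c" using V_chart_at[OF tU] by (simp_all add: c_def z_def)
    have z: "z \<in> E" "z \<in> points M" using E[OF t] ex_points[OF tU] by (simp_all add: z_def)
    let ?h = "lam \<circ> chart_inv c" and ?y = "chart_map c z" and ?W = "DF c (t *\<^sub>R v) v"
    have y: "F c (t *\<^sub>R v) = ?y" by (simp add: F_def z_def)
    have im: "?y \<in> chart_map c ` chart_dom c" using F_img[OF c(2)] y by simp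
    note mc = metric_chart[OF c(1)]
    have "z \<in> chart_dom c" using V_dom[OF c(2)] by (simp add: z_def)
    then have "?y \<in> chart_map c ` (chart_dom c \<inter> E)" using z by blast
    moreover have "\<forall>y\<in>chart_map c ` (chart_dom c \<inter> E). ?h differentiable (at y)"
      using C1 c(1) unfolding C1_function_on_def One_nat_def Ck_on.simps by blast
    ultimately have "?h differentiable (at ?y)" by blast
    then have "(?h has_derivative (\<lambda>a. \<Sum>i\<in>UNIV. a $ i *\<^sub>R partial i ?h ?y)) (at (F c (t *\<^sub>R v)))"
      unfolding y by (rule has_derivative_partial)
    from has_vector_derivative_compose[OF F_curve[OF c, of UNIV] this]
    have 1: "((\<lambda>t. ?h (F c (t *\<^sub>R v))) has_real_derivative (\<Sum>i\<in>UNIV. ?W $ i *\<^sub>R partial i ?h ?y)) (at t)"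
      by (simp add: has_real_derivative_iff_has_vector_derivative)
    have d: "(f has_real_derivative (\<Sum>i\<in>UNIV. ?W $ i *\<^sub>R partial i ?h ?y)) (at t)"
    proof (rule has_field_derivative_transform_within_open[OF 1])
      show "open ((\<lambda>t. t *\<^sub>R v) -` V c)" by (intro open_vimage V_open[OF c(1)] continuous_intros)
      show "t \<in> (\<lambda>t. t *\<^sub>R v) -` V c" using c by simp
      show "?h (F c (s *\<^sub>R v)) = f s" if "s \<in> (\<lambda>t. t *\<^sub>R v) -` V c" for s
        using V_dom[of "s *\<^sub>R v" c] that by (simp add: f_def F_def chart_inv_left[OF c(1)])
    qed
    let ?p = "\<chi> i. partial i ?h ?y"
    let ?G = "gradient M lam z"
    have G: "gcoeff M c ?y *v ?G = ?p"
      by (simp add: gradient_def Let_def c_def[symmetric] matrix_vector_mul_assoc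
          matrix_inv_inverse[OF metric_chart.det_g[OF mc im]])
    have "(\<Sum>i\<in>UNIV. ?W $ i *\<^sub>R partial i ?h ?y) = ?W \<bullet> ?p" by (simp add: inner_vec_def)
    also have "\<dots> = Inn c ?y ?W ?G" by (simp only: inn_def[OF c(1)] G)
    finally have dG: "(f has_real_derivative Inn c ?y ?W ?G) (at t)" using d by simp
    have "- (\<kappa> * ?L) * f t \<le> Inn c ?y ?W ?G" if "t < 1"
    proof -
      have W: "Inn c ?y ?W ?W = ?L\<^sup>2"
        using radial_energy[OF v, of t] t that by (simp add: Q_eq[OF c] y tangent_norm_sq)
      have GG: "Inn c ?y ?G ?G = (tangent_norm M z ?G)\<^sup>2"
        using metric_at_nonneg[OF z(2)] by (simp add: tangent_norm_def metric_at_eq[OF z(2)] c_def)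
      have "(Inn c ?y ?W ?G)\<^sup>2 \<le> (?L * tangent_norm M z ?G)\<^sup>2"
        using metric_chart.inn_cauchy_schwarz[OF mc im, of ?W ?G] by (simp add: W GG power_mult_distrib)
      moreover have tn: "0 \<le> tangent_norm M z ?G" using metric_at_nonneg[OF z(2)] by (simp add: tangent_norm_def)
      ultimately have "\<bar>Inn c ?y ?W ?G\<bar> \<le> ?L * tangent_norm M z ?G"
        using tangent_norm_nonneg[of v] by (metis abs_le_square_iff abs_of_nonneg mult_nonneg_nonneg)
      also have "\<dots> \<le> ?L * (\<kappa> * lam z)"
        by (rule mult_left_mono[OF grad[OF z(1)] tangent_norm_nonneg])
      finally show ?thesis by (simp add: f_def z_def mult_ac abs_le_iff)
    qed
    with dG show ?thesis by blast
  qed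
  let ?a = "\<kappa> * ?L"
  let ?g = "\<lambda>t. f t * exp (?a * t)"
  have contf: "isCont f t" if "t \<in> {0..1}" for t using df[OF that] DERIV_isCont by blast
  have "?g 0 \<le> ?g 1"
  proof (rule DERIV_nonneg_imp_increasing_open[where f="?g"])
    show "continuous_on {0..1} ?g"
      by (intro continuous_intros) (auto simp: contf intro!: continuous_at_imp_continuous_on)
    fix t :: real assume t: "0 < t" "t < 1"
    obtain D where D: "(f has_real_derivative D) (at t)" "- ?a * f t \<le> D" using df[of t] t by auto
    have "(?g has_real_derivative (D + ?a * f t) * exp (?a * t)) (at t)"
      by (rule derivative_eq_intros D refl | simp add: algebra_simps)+
    moreover have "0 \<le> (D + ?a * f t) * exp (?a * t)" using D(2) by simp
    ultimately show "\<exists>y. (?g has_real_derivative y) (at t) \<and> 0 \<le> y" by blast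
  qed simp
  then have "f 0 \<le> f 1 * exp ?a" by simp
  then have "f 0 * exp (- ?a) \<le> f 1 * exp ?a * exp (- ?a)" by (rule mult_right_mono) simp
  also have "\<dots> = f 1" by (simp add: mult.assoc exp_add[symmetric])
  finally show ?thesis by (simp add: f_def ex_0)
qed

end

section \<open>Geodesic balls of uniform radius\<close>

context riem
begin

text \<open>Defined as an image under the exponential map and not through \<open>riem_dist\<close>:
  openness, connectedness and volume are then inherited from the tangent ball.\<close>

definition geo_ball :: "real \<Rightarrow> 'a \<Rightarrow> 'a set" where
  "geo_ball \<rho> x = riem_exp M x ` {v. tangent_norm M x v < \<rho>}"

text \<open>The strict inequality leaves room: at each point some competing radius exceeds \<rho>,
  so the tangent ball of radius \<rho> lies inside a ball on which the exponential map is a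
  diffeomorphism.\<close>

lemma ex_expball:
  assumes \<rho>: "ereal \<rho> < injectivity_radius M" and x: "x \<in> points M"
  shows "\<exists>r>\<rho>. expball M x r"
proof -
  have "injectivity_radius M \<le> injectivity_radius_at M x"
    unfolding injectivity_radius_def by (rule INF_lower[OF x])
  then have "ereal \<rho> < injectivity_radius_at M x" using \<rho> by simp
  then obtain r where "0 < r" "\<forall>v. tangent_norm M x v < r \<longrightarrow> (\<exists>\<gamma>. geodesic_from M x v \<gamma>)"
    "diffeo_onto_open_image M {v. tangent_norm M x v < r} (riem_exp M x)" "\<rho> < r"
    unfolding injectivity_radius_at_def less_SUP_iff by auto
  then have "expball M x r" using x by unfold_locales auto
  then show ?thesis using \<open>\<rho> < r\<close> by blast
qed

text \<open>The exponential map is open and continuous on the larger ball, and the tangent ball is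
  open and starlike about 0, hence connected.\<close>

lemma geo_ball:
  assumes \<rho>: "0 < \<rho>" "ereal \<rho> < injectivity_radius M" and x: "x \<in> points M"
  shows "openin (top_of M) (geo_ball \<rho> x)" and "x \<in> geo_ball \<rho> x"
    and "connectedin (top_of M) (geo_ball \<rho> x)"
    and "z \<in> geo_ball \<rho> x \<Longrightarrow> \<bar>riem_dist M z y - riem_dist M x y\<bar> \<le> \<rho>"
proof -
  obtain r where \<rho>r: "\<rho> < r" "expball M x r" using ex_expball[OF \<rho>(2) x] by blast
  interpret expball M x r by (rule \<rho>r(2))
  let ?B = "{v. tangent_norm M x v < \<rho>}"
  have BU: "?B \<subseteq> U" using \<rho>r by auto
  have "open ?B" by (rule open_Collect_less[OF continuous_tangent_norm]) (intro continuous_intros)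
  then show "openin (top_of M) (geo_ball \<rho> x)" unfolding geo_ball_def by (rule ex_image_open[OF _ BU])
  have 0: "0 \<in> ?B" using tangent_norm_scale[of 0 0] \<rho> by simp
  then show "x \<in> geo_ball \<rho> x" unfolding geo_ball_def using ex_0 by (metis imageI)
  have "starlike ?B"
    unfolding starlike_def
  proof (intro bexI[OF _ 0] ballI subsetI)
    fix v w assume v: "v \<in> ?B" and "w \<in> closed_segment 0 v"
    then obtain t where t: "0 \<le> t" "t \<le> 1" "w = t *\<^sub>R v" by (auto simp: in_segment)
    then have "tangent_norm M x w \<le> tangent_norm M x v"
      using tangent_norm_nonneg[of v] by (simp add: tangent_norm_scale mult_left_le_one_le)
    then show "w \<in> ?B" using v by simp
  qed
  then have "connected ?B" by (rule starlike_imp_connected)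
  then have "connectedin (top_of_set U) ?B" using BU by (simp add: connectedin_subtopology)
  then show "connectedin (top_of M) (geo_ball \<rho> x)"
    unfolding geo_ball_def by (rule connectedin_continuous_map_image[OF ex_continuous])
  assume "z \<in> geo_ball \<rho> x"
  then obtain v where v: "v \<in> ?B" "z = ex v" by (auto simp: geo_ball_def)
  then have "v \<in> U" using BU by blast
  from dist_exp[OF this, of y] show "\<bar>riem_dist M z y - riem_dist M x y\<bar> \<le> \<rho>" using v by simp
qed

text \<open>A finite subcover by geodesic balls takes the place of continuity of the distance: on
  each ball the distance to \<open>y\<close> differs from its value at the centre by at most
  \<rho>.\<close>

lemma compact_dist_bounded:
  assumes \<rho>: "0 < \<rho>" "ereal \<rho> < injectivity_radius M" and \<Omega>: "compactin (top_of M) \<Omega>"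
  shows "\<exists>R. \<forall>z\<in>\<Omega>. riem_dist M z y \<le> R"
proof -
  have sub: "\<Omega> \<subseteq> points M" using \<Omega> by (rule compactin_subset_topspace)
  have "\<forall>W\<in>geo_ball \<rho> ` \<Omega>. openin (top_of M) W" using geo_ball(1)[OF \<rho>] sub by blast
  moreover have "\<Omega> \<subseteq> \<Union> (geo_ball \<rho> ` \<Omega>)" using geo_ball(2)[OF \<rho>] sub by blast
  ultimately obtain \<F> where F: "finite \<F>" "\<F> \<subseteq> geo_ball \<rho> ` \<Omega>" "\<Omega> \<subseteq> \<Union> \<F>"
    using \<Omega> unfolding compactin_def by meson
  obtain Y where Y: "finite Y" "Y \<subseteq> \<Omega>" "\<F> = geo_ball \<rho> ` Y"
    using finite_subset_image[OF F(1,2)] by blast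
  obtain R where R: "\<And>z. z \<in> Y \<Longrightarrow> riem_dist M z y \<le> R"
    using bdd_above_finite[OF finite_imageI[OF Y(1), of "\<lambda>z. riem_dist M z y"]] unfolding bdd_above_def by blast
  have "riem_dist M z y \<le> R + \<rho>" if z: "z \<in> \<Omega>" for z
  proof -
    obtain u where u: "u \<in> Y" "z \<in> geo_ball \<rho> u" using F(3) Y(3) z by blast
    then have "u \<in> points M" using Y(2) sub by blast
    from geo_ball(4)[OF \<rho> this u(2), of y] R[OF u(1)] show ?thesis by linarith
  qed
  then show ?thesis by blast
qed

lemma geo_ball_volume:
  assumes \<rho>: "0 < \<rho>" "ereal \<rho> < injectivity_radius M" and x: "x \<in> points M" and K: "0 \<le> K" "K * \<rho>\<^sup>2 \<le> 1"
    and sec: "\<And>z u v. z \<in> points M \<Longrightarrow> u \<noteq> v \<Longrightarrow> independent {u, v} \<Longrightarrow> sectional_curvature M z u v \<le> K"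
  shows "ennreal ((5/6) ^ CARD('n)) * emeasure lborel (ball (0::real^'n) \<rho>) \<le> emeasure (riem_measure M) (geo_ball \<rho> x)"
proof -
  obtain r where \<rho>r: "\<rho> < r" "expball M x r" using ex_expball[OF \<rho>(2) x] by blast
  interpret expball M x r by (rule \<rho>r(2))
  show ?thesis unfolding geo_ball_def by (rule exp_ball_volume[OF _ K sec]) (use \<rho>r in auto)
qed

lemma geo_ball_decay:
  assumes \<rho>: "0 < \<rho>" "ereal \<rho> < injectivity_radius M" and x: "x \<in> points M" and E: "geo_ball \<rho> x \<subseteq> E"
    and C1: "C1_function_on M E lam" and nn: "\<And>z. z \<in> E \<Longrightarrow> 0 \<le> lam z" and \<kappa>: "0 \<le> \<kappa>"
    and grad: "\<And>z. z \<in> E \<Longrightarrow> tangent_norm M z (gradient M lam z) \<le> \<kappa> * lam z" and z: "z \<in> geo_ball \<rho> x"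
  shows "lam x * exp (- (\<kappa> * \<rho>)) \<le> lam z"
proof -
  obtain r where \<rho>r: "\<rho> < r" "expball M x r" using ex_expball[OF \<rho>(2) x] by blast
  interpret expball M x r by (rule \<rho>r(2))
  obtain v where v: "tangent_norm M x v < \<rho>" "z = ex v" using z by (auto simp: geo_ball_def)
  have "lam x * exp (- (\<kappa> * tangent_norm M x v)) \<le> lam (ex v)"
  proof (rule gradient_decay[OF _ _ C1 grad])
    show "v \<in> U" using v \<rho>r by simp
    fix t :: real assume t: "t \<in> {0..1}"
    then have "tangent_norm M x (t *\<^sub>R v) \<le> tangent_norm M x v"
      using tangent_norm_nonneg[of v] by (simp add: tangent_norm_scale mult_left_le_one_le)
    then have "ex (t *\<^sub>R v) \<in> geo_ball \<rho> x" using v unfolding geo_ball_def by (intro imageI) simp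
    then show "ex (t *\<^sub>R v) \<in> E" using E by blast
  qed
  moreover have "lam x * exp (- (\<kappa> * \<rho>)) \<le> lam x * exp (- (\<kappa> * tangent_norm M x v))"
  proof (rule mult_left_mono)
    have "\<kappa> * tangent_norm M x v \<le> \<kappa> * \<rho>" using v(1) \<kappa> by (intro mult_left_mono) auto
    then show "exp (- (\<kappa> * \<rho>)) \<le> exp (- (\<kappa> * tangent_norm M x v))" by simp
    show "0 \<le> lam x" using nn E geo_ball(2)[OF \<rho> x] by blast
  qed
  ultimately show ?thesis using v(2) by simp
qed

lemma component_superset:
  assumes E: "E \<in> connected_components_of (subtopology (top_of M) (points M - \<Omega>))"
    and B: "connectedin (top_of M) B" "B \<inter> \<Omega> = {}" "x \<in> B" "x \<in> E"
  shows "B \<subseteq> E"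
proof (rule connected_components_of_maximal[OF E])
  have "B \<subseteq> points M" using B(1) by (rule connectedin_subset_topspace)
  then show "connectedin (subtopology (top_of M) (points M - \<Omega>)) B"
    using B(1,2) by (auto simp: connectedin_subtopology)
  show "\<not> disjnt E B" using B(3,4) by (auto simp: disjnt_def)
qed

end

text \<open>Since \<open>d\<close> is unbounded on \<open>A\<close>, each next point can be chosen
  with \<open>d\<close> larger by at least \<open>s\<close>; as \<open>s\<close> is nonnegative, the
  gap persists between nonconsecutive terms.\<close>

lemma separated_sequence:
  fixes d :: "'b \<Rightarrow> real"
  assumes "\<And>R. \<exists>z\<in>A. R \<le> d z" and s: "0 \<le> s"
  shows "\<exists>xs::nat \<Rightarrow> 'b. (\<forall>n. xs n \<in> A \<and> R0 \<le> d (xs n)) \<and> (\<forall>m n. m < n \<longrightarrow> d (xs m) + s \<le> d (xs n))"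
proof -
  obtain z where z: "\<And>R. z R \<in> A" "\<And>R. R \<le> d (z R)" using assms(1) by metis
  define xs where "xs = rec_nat (z R0) (\<lambda>_ x. z (d x + s))"
  have xs: "xs 0 = z R0" "xs (Suc n) = z (d (xs n) + s)" for n by (simp_all add: xs_def)
  have step: "d (xs n) + s \<le> d (xs (Suc n))" for n using z(2)[of "d (xs n) + s"] by (simp add: xs)
  have gap: "d (xs m) + s \<le> d (xs (m + Suc k))" for m k
  proof (induction k)
    case 0
    then show ?case using step[of m] by simp
  next
    case (Suc k)
    then show ?case using step[of "m + Suc k"] s by simp
  qed
  have mono: "d (xs m) + s \<le> d (xs n)" if "m < n" for m n
    using gap[of m "n - Suc m"] that by simp
  have "R0 \<le> d (xs n)" for n
  proof (cases n)
    case 0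
    then show ?thesis using z(2)[of R0] by (simp add: xs(1))
  next
    case (Suc k)
    then show ?thesis using z(2)[of R0] mono[of 0 n] s by (simp add: xs(1))
  qed
  moreover have "xs n \<in> A" for n by (cases n) (simp_all add: xs z)
  ultimately show ?thesis using mono by blast
qed

lemma suminf_const_ennreal:
  assumes "c \<noteq> (0::ennreal)"
  shows "(\<Sum>n::nat. c) = \<infinity>"
proof -
  have "(\<Sum>n::nat. c) = (\<integral>\<^sup>+n. c \<partial>count_space (UNIV::nat set))"
    by (rule nn_integral_count_space_nat[symmetric])
  also have "\<dots> = c * \<infinity>" by simp
  also have "\<dots> = \<infinity>" using assms by (simp add: ennreal_mult_top)
  finally show ?thesis .
qed

theorem corollary1p5:
  fixes M :: "('a, 'n::finite) riemannian"
    and E :: "'a set" and x\<^sub>0 :: 'a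
    and lam :: "'a \<Rightarrow> real" and \<kappa> :: real
  assumes "riemannian_manifold M"
    and "complete_manifold M"
    and "\<not> compact_space (top_of M)"
    and "bounded_geometry M"
    and "is_end M E"
    and "x\<^sub>0 \<in> points M"
    and "\<And>x. x \<in> E \<Longrightarrow> 0 \<le> lam x"
    and "C1_function_on M E lam"
    and "0 \<le> \<kappa>"
    and "\<And>x. x \<in> E \<Longrightarrow> tangent_norm M x (gradient M lam x) \<le> \<kappa> * lam x"
  shows "(lam \<longlongrightarrow> 0) (at_infinity_in M x\<^sub>0 E) \<or>
    (\<forall>p::real. 1 \<le> p \<longrightarrow> (\<integral>\<^sup>+x\<in>E. ennreal (lam x powr p) \<partial>riem_measure M) = \<infinity>)"
proof (subst disj_commute, intro disjCI allI impI)
  fix p :: real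
  assume nlim: "\<not> (lam \<longlongrightarrow> 0) (at_infinity_in M x\<^sub>0 E)" and p: "1 \<le> p"
  interpret riem M by unfold_locales (rule assms(1))
  let ?d = "\<lambda>z. riem_dist M z x\<^sub>0"
  obtain K0 where K0: "\<And>z u v. z \<in> points M \<Longrightarrow> u \<noteq> v \<Longrightarrow> independent {u, v} \<Longrightarrow> sectional_curvature M z u v \<le> K0"
    using assms(4) unfolding bounded_geometry_def by blast
  obtain i0 where i0: "0 < i0" "ereal i0 \<le> injectivity_radius M"
    using assms(4) unfolding bounded_geometry_def by blast
  \<comment> \<open>K \<ge> 1 makes the bound nonnegative, as the curvature estimate requires, and
    also forces \<rho> \<le> K \<rho> \<le> 1, whence K \<rho>^2 \<le> 1.\<close>
  define K where "K = max K0 1"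
  \<comment> \<open>Half of \<open>i0\<close> places \<rho> strictly below the injectivity radius;
    1/K normalizes the comparison.\<close>
  define \<rho> where "\<rho> = min (i0 / 2) (1 / K)"
  have K: "1 \<le> K" by (simp add: K_def)
  have sec: "sectional_curvature M z u v \<le> K" if "z \<in> points M" "u \<noteq> v" "independent {u, v}" for z u v
    using K0[OF that] by (simp add: K_def)
  have \<rho>0: "0 < \<rho>" using i0 K by (simp add: \<rho>_def)
  have "\<rho> < i0" using i0 by (simp add: \<rho>_def min_def)
  then have "ereal \<rho> < ereal i0" by simp
  then have \<rho>1: "ereal \<rho> < injectivity_radius M" using i0(2) by (rule less_le_trans)
  have K\<rho>: "K * \<rho>\<^sup>2 \<le> 1"
  proof -
    have "\<rho> \<le> 1 / K" by (simp add: \<rho>_def)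
    then have 1: "K * \<rho> \<le> 1" using K by (simp add: field_simps)
    have "\<rho> \<le> K * \<rho>" using mult_right_mono[OF K, of \<rho>] \<rho>0 by simp
    then have "\<rho> \<le> 1" using 1 by linarith
    then have "(K * \<rho>) * \<rho> \<le> 1 * 1" using 1 using \<rho>0 K by (intro mult_mono) auto
    then show ?thesis by (simp add: power2_eq_square mult.assoc)
  qed
  note \<rho> = \<rho>0 \<rho>1
  obtain \<Omega> where \<Omega>: "compactin (top_of M) \<Omega>" and
    Ecomp: "E \<in> connected_components_of (subtopology (top_of M) (points M - \<Omega>))"
    using assms(5) unfolding is_end_def by blast
  have Esub: "E \<subseteq> points M" using connected_components_of_subset[OF Ecomp] by auto
  obtain R where R: "\<And>z. z \<in> \<Omega> \<Longrightarrow> ?d z \<le> R" using compact_dist_bounded[OF \<rho> \<Omega>] by blast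
  obtain \<epsilon> where \<epsilon>: "0 < \<epsilon>" "\<And>N. \<exists>z\<in>E. N \<le> ?d z \<and> \<epsilon> \<le> lam z"
  proof -
    obtain \<epsilon> where e: "0 < \<epsilon>" "\<not> (\<forall>\<^sub>F z in at_infinity_in M x\<^sub>0 E. dist (lam z) 0 < \<epsilon>)"
      using nlim unfolding tendsto_iff by blast
    \<comment> \<open>If the claim failed for some \<open>N\<close>, then \<lambda> < \<epsilon>
      would hold on all of \<open>E\<close> at distance at least \<open>N\<close>, that is,
      eventually in the filter.\<close>
    have "\<exists>z\<in>E. N \<le> ?d z \<and> \<epsilon> \<le> lam z" for N
    proof (rule ccontr)
      assume c: "\<not> ?thesis"
      have "\<forall>z. N \<le> ?d z \<longrightarrow> z \<in> E \<longrightarrow> dist (lam z) 0 < \<epsilon>"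
      proof (intro allI impI)
        fix z assume "N \<le> ?d z" "z \<in> E"
        then have "lam z < \<epsilon>" using c by force
        then show "dist (lam z) 0 < \<epsilon>" using assms(7)[OF \<open>z \<in> E\<close>] by (simp add: dist_real_def)
      qed
      then have "\<forall>\<^sub>F z in at_infinity_in M x\<^sub>0 E. dist (lam z) 0 < \<epsilon>"
        unfolding at_infinity_in_def eventually_inf_principal eventually_filtercomap_at_top_linorder by blast
      then show False using e(2) by simp
    qed
    then show ?thesis using that e(1) by blast
  qed
  have far: "\<exists>z\<in>{z \<in> E. \<epsilon> \<le> lam z}. N \<le> ?d z" for N using \<epsilon>(2)[of N] by blast
  \<comment> \<open>On the ball about a point \<open>xs n\<close> the distance to x0 varies by at
    most \<rho>. Starting at R + \<rho> + 1 therefore keeps it above \<open>R\<close>, so the ball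
    misses \<Omega>, and gaps of 2 \<rho> + 1 make the ranges on different balls disjoint; the
    summands 1 provide strictness.\<close>
  obtain xs :: "nat \<Rightarrow> 'a" where xs: "\<And>n. xs n \<in> E" "\<And>n. \<epsilon> \<le> lam (xs n)" "\<And>n. R + \<rho> + 1 \<le> ?d (xs n)"
    and sep: "\<And>m n. m < n \<Longrightarrow> ?d (xs m) + (2 * \<rho> + 1) \<le> ?d (xs n)"
  proof -
    have "0 \<le> 2 * \<rho> + 1" using \<rho>0 by simp
    from separated_sequence[OF far this, of "R + \<rho> + 1"] obtain xs :: "nat \<Rightarrow> 'a"
      where 1: "\<forall>n. xs n \<in> {z \<in> E. \<epsilon> \<le> lam z} \<and> R + \<rho> + 1 \<le> ?d (xs n)"
        and 2: "\<forall>m n. m < n \<longrightarrow> ?d (xs m) + (2 * \<rho> + 1) \<le> ?d (xs n)" by blast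
    show ?thesis
    proof (rule that[of xs])
      show "xs n \<in> E" "\<epsilon> \<le> lam (xs n)" "R + \<rho> + 1 \<le> ?d (xs n)" for n using 1 by simp_all
      show "?d (xs m) + (2 * \<rho> + 1) \<le> ?d (xs n)" if "m < n" for m n using 2 that by simp
    qed
  qed
  have xp: "xs n \<in> points M" for n using xs(1) Esub by blast
  define B where "B n = geo_ball \<rho> (xs n)" for n
  have near: "\<bar>?d z - ?d (xs n)\<bar> \<le> \<rho>" if "z \<in> B n" for z n
    using geo_ball(4)[OF \<rho> xp] that by (simp add: B_def)
  have BE: "B n \<subseteq> E" for n
  proof (rule component_superset[OF Ecomp])
    show "connectedin (top_of M) (B n)" unfolding B_def by (rule geo_ball(3)[OF \<rho> xp])
    show "B n \<inter> \<Omega> = {}"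
    proof (rule ccontr)
      assume "B n \<inter> \<Omega> \<noteq> {}"
      then obtain z where "z \<in> B n" "z \<in> \<Omega>" by blast
      then show False using near[of z n] R[of z] xs(3)[of n] by (simp add: abs_le_iff)
    qed
    show "xs n \<in> B n" unfolding B_def by (rule geo_ball(2)[OF \<rho> xp])
  qed (rule xs(1))
  have Bdisj: "B m \<inter> B n = {}" if "m < n" for m n
  proof (rule ccontr)
    assume "B m \<inter> B n \<noteq> {}"
    then obtain z where "z \<in> B m" "z \<in> B n" by blast
    then show False using near[of z m] near[of z n] sep[OF that] by (simp add: abs_le_iff)
  qed
  have disj: "disjoint_family B"
    unfolding disjoint_family_on_def
  proof (intro ballI impI)
    fix m n :: nat assume "m \<noteq> n"
    then consider "m < n" | "n < m" by linarith
    then show "B m \<inter> B n = {}" by cases (use Bdisj[of m n] Bdisj[of n m] in blast)+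
  qed
  define \<delta> where "\<delta> = \<epsilon> * exp (- (\<kappa> * \<rho>))"
  have \<delta>: "0 < \<delta>" using \<epsilon>(1) by (simp add: \<delta>_def)
  have low: "\<delta> \<le> lam z" if "z \<in> B n" for z n
  proof -
    have "lam (xs n) * exp (- (\<kappa> * \<rho>)) \<le> lam z"
      by (rule geo_ball_decay[OF \<rho> xp _ assms(8,7,9,10)]) (use BE that in \<open>auto simp: B_def\<close>)
    moreover have "\<delta> \<le> lam (xs n) * exp (- (\<kappa> * \<rho>))" unfolding \<delta>_def using xs(2) by (intro mult_right_mono) auto
    ultimately show ?thesis by simp
  qed
  let ?\<mu> = "riem_measure M" and ?c = "ennreal ((5/6) ^ CARD('n)) * emeasure lborel (ball (0::real^'n) \<rho>)"
  have sets: "sets ?\<mu> = borel_sets" using riem_measure assms(6) unfolding is_riem_measure_def by blast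
  have Bs: "B n \<in> sets ?\<mu>" for n unfolding sets B_def by (rule open_borel[OF geo_ball(1)[OF \<rho> xp]])
  have vol: "?c \<le> emeasure ?\<mu> (B n)" for n
    unfolding B_def by (rule geo_ball_volume[OF \<rho> xp _ K\<rho> sec]) (use K in simp_all)
  have c0: "?c \<noteq> 0"
  proof -
    have "0 < measure lborel (ball (0::real^'n) \<rho>)" by (rule content_ball_pos[OF \<rho>0])
    then have "emeasure lborel (ball (0::real^'n) \<rho>) \<noteq> 0"
      unfolding measure_def by (intro notI) simp
    moreover have "ennreal ((5/6) ^ CARD('n)) \<noteq> 0" by (simp add: ennreal_eq_0_iff not_le)
    ultimately show ?thesis by (simp only: mult_eq_0_iff not_False_eq_True simp_thms)
  qed
  \<comment> \<open>The lower bound \<open>?c\<close> is positive and does not depend on n, so the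
    volumes have an infinite sum.\<close>
  have "(\<Sum>n. emeasure ?\<mu> (B n)) = \<infinity>"
  proof -
    have "(\<Sum>n::nat. ?c) = \<infinity>" by (rule suminf_const_ennreal[OF c0])
    moreover have "(\<Sum>n::nat. ?c) \<le> (\<Sum>n. emeasure ?\<mu> (B n))" by (intro suminf_le vol) auto
    ultimately show ?thesis by (simp add: top_unique)
  qed
  then have inf: "emeasure ?\<mu> (\<Union>n. B n) = \<infinity>"
  proof -
    have "range B \<subseteq> sets ?\<mu>" using Bs by blast
    from suminf_emeasure[OF this disj] \<open>(\<Sum>n. emeasure ?\<mu> (B n)) = \<infinity>\<close> show ?thesis by simp
  qed
  \<comment> \<open>The constant \<delta>, the lower bound of \<lambda> on every ball, is positive,
    so its power multiplied by infinite volume is infinite; the integrand dominates that power on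
    the union of the balls.\<close>
  have "\<infinity> = ennreal (\<delta> powr p) * emeasure ?\<mu> (\<Union>n. B n)"
    unfolding inf using \<delta> by (simp add: ennreal_mult_top)
  also have "\<dots> = (\<integral>\<^sup>+z. ennreal (\<delta> powr p) * indicator (\<Union>n. B n) z \<partial>?\<mu>)"
    using Bs by (intro nn_integral_cmult_indicator[symmetric]) auto
  also have "\<dots> \<le> (\<integral>\<^sup>+x\<in>E. ennreal (lam x powr p) \<partial>?\<mu>)"
  proof (rule nn_integral_mono)
    fix z
    show "ennreal (\<delta> powr p) * indicator (\<Union>n. B n) z \<le> ennreal (lam z powr p) * indicator E z"
    proof (cases "z \<in> (\<Union>n. B n)")
      case True
      then obtain n where n: "z \<in> B n" by blast
      have "\<delta> powr p \<le> lam z powr p" using low[OF n] \<delta> p by (intro powr_mono2) auto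
      then show ?thesis using True n BE[of n] by (auto simp: indicator_def intro: ennreal_leI)
    qed simp
  qed
  finally show "(\<integral>\<^sup>+x\<in>E. ennreal (lam x powr p) \<partial>riem_measure M) = \<infinity>" by (simp add: top_unique)
qed

end
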